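(* Let $\alpha>0$ and let $K_\alpha$ be the reproducing kernel of $H_2^{(\alpha)}(\mathbb{C}^+)$. Then, for every $z=|z|e^{i\theta}\in\mathbb{C}^+$ with $\theta\in(-\pi/2,\pi/2)$: (i) for $\alpha\ge 1$, $$\frac{1}{(2\alpha-1)\Gamma(\alpha)^2}\,\frac{1}{|z|}\le\|K_\alpha(\cdot,z)\|_{2,(\alpha)}^2\le\frac{\pi}{\alpha\Gamma(\alpha)^2}\,\frac{1}{|z|};$$ (ii) for $1/2<\alpha<1$, $$\frac{1}{\Gamma(\alpha)^2}\,\frac{1}{|z|}\le\|K_\alpha(\cdot,z)\|_{2,(\alpha)}^2\le\frac{\pi}{(2\alpha-1)\Gamma(\alpha)^2}\,\frac{1}{|z|};$$ (iii) for $0<\alpha\le 1/2$, $$\frac{1}{\Gamma(\alpha)^2}\,\frac{1}{|z|}\le\|K_\alpha(\cdot,z)\|_{2,(\alpha)}^2\le\frac{2}{\Gamma(\alpha+1)^2}\,\frac{1}{|z|}\quad\text{if }|\theta|\le\pi/4,$$ and $$\frac{1}{\Gamma(\alpha)^2}\,\frac{1}{|z|}\le\|K_\alpha(\cdot,z)\|_{2,(\alpha)}^2\le\frac{2}{\Gamma(\alpha+1)^2}\,\frac{1}{\Re z}\quad\text{if }\pi/4<|\theta|<\pi/2.$$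
   Context: Notation: $\mathbb{C}^+=\{z\in\mathbb{C}:\Re z>0\}$. $H_2(\mathbb{C}^+)$ is the Hardy space of holomorphic functions $F$ on $\mathbb{C}^+$ with $\|F\|_2:=\sup_{x>0}\left(\frac{1}{2\pi}\int_{-\infty}^\infty|F(x+iy)|^2dy\right)^{1/2}<\infty$. For $t\in\mathbb{R}$ let $T_2(t)F(z)=e^{-t/2}F(e^{-t}z)$, which defines a strongly continuous group of isometries on $H_2(\mathbb{C}^+)$. For $\alpha>0$ let $\mathfrak{C}_\alpha^*F:=\int_0^\infty\alpha(1-e^{-t})^{\alpha-1}e^{-t/2}\,T_2(-t)F\,dt$ (Bochner integral), a bounded injective operator on $H_2(\mathbb{C}^+)$. Put $H_2^{(\alpha)}(\mathbb{C}^+):=\mathfrak{C}_\alpha^*(H_2(\mathbb{C}^+))$ with norm $\|F\|_{2,(\alpha)}:=\Gamma(\alpha+1)\|(\mathfrak{C}_\alpha^* )^{-1}F\|_2$; this is a Hilbert space (inner product transported from $H_2(\mathbb{C}^+)$), continuously included in $H_2(\mathbb{C}^+)$, hence a reproducing kernel Hilbert space. Its reproducing kernel $K_\alpha\colon\mathbb{C}^+\times\mathbb{C}^+\to\mathbb{C}$ is characterized by $K_\alpha(\cdot,w)\in H_2^{(\alpha)}(\mathbb{C}^+)$ and $F(w)=(F\,|\,K_\alpha(\cdot,w))_{2,(\alpha)}$ for all $F\in H_2^{(\alpha)}(\mathbb{C}^+)$, $w\in\mathbb{C}^+$. *)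

theory Defs
  imports "HOL-Complex_Analysis.Complex_Analysis"
begin

definition half_plane :: "complex set" where
  "half_plane = {z. Re z > 0}"

(* A function on the half-plane is represented by its extension by zero to the whole
   complex plane, so that equality of functions on the half-plane is HOL equality. *)
definition hardy2 :: "(complex \<Rightarrow> complex) set" where
  "hardy2 = {F. F holomorphic_on half_plane \<and> (\<forall>z. z \<notin> half_plane \<longrightarrow> F z = 0) \<and>
     (\<forall>x>0. integrable lborel (\<lambda>y. (cmod (F (Complex x y)))\<^sup>2)) \<and>
     bdd_above ((\<lambda>x. sqrt (1 / (2 * pi) * (\<integral>y. (cmod (F (Complex x y)))\<^sup>2 \<partial>lborel))) ` {0<..})}"

definition hardy2_norm :: "(complex \<Rightarrow> complex) \<Rightarrow> real" where
  "hardy2_norm F =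
     (SUP x\<in>{0<..}. sqrt (1 / (2 * pi) * (\<integral>y. (cmod (F (Complex x y)))\<^sup>2 \<partial>lborel)))"

(* The inner product inducing the norm of the Hilbert space, recovered by polarization;
   linear in the first argument. *)
definition hardy2_inner :: "(complex \<Rightarrow> complex) \<Rightarrow> (complex \<Rightarrow> complex) \<Rightarrow> complex" where
  "hardy2_inner F G =
     (of_real ((hardy2_norm (\<lambda>z. F z + G z))\<^sup>2) - of_real ((hardy2_norm (\<lambda>z. F z - G z))\<^sup>2)
      + \<i> * of_real ((hardy2_norm (\<lambda>z. F z + \<i> * G z))\<^sup>2)
      - \<i> * of_real ((hardy2_norm (\<lambda>z. F z - \<i> * G z))\<^sup>2)) / 4"

definition T2 :: "real \<Rightarrow> (complex \<Rightarrow> complex) \<Rightarrow> complex \<Rightarrow> complex" where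
  "T2 t F = (\<lambda>z. of_real (exp (- t / 2)) * F (of_real (exp (- t)) * z))"

(* The Bochner integral of HOL-Analysis, transcribed for functions taking values in a space H
   of complex-valued functions normed by N: the library version needs a type of class
   second_countable_topology as codomain. Instead of Borel measurability of f we ask that
   N (f - s n) be measurable for the approximating simple functions s n; as these norms tend
   to 0 in L1, a subsequence of s tends to f almost everywhere, so f is strongly measurable. *)
definition simple_integral_fun :: "'a measure \<Rightarrow> ('a \<Rightarrow> 'b \<Rightarrow> complex) \<Rightarrow> 'b \<Rightarrow> complex" where
  "simple_integral_fun M s =
     (\<lambda>z. \<Sum>g\<in>s ` space M. of_real (measure M {t \<in> space M. s t = g}) * g z)"

definition has_bochner_integral_in ::
  "('b \<Rightarrow> complex) set \<Rightarrow> (('b \<Rightarrow> complex) \<Rightarrow> real) \<Rightarrow> 'a measure \<Rightarrow>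
   ('a \<Rightarrow> 'b \<Rightarrow> complex) \<Rightarrow> ('b \<Rightarrow> complex) \<Rightarrow> bool" where
  "has_bochner_integral_in H N M f I \<longleftrightarrow>
     I \<in> H \<and> (\<forall>t\<in>space M. f t \<in> H) \<and>
     (\<exists>s :: nat \<Rightarrow> 'a \<Rightarrow> 'b \<Rightarrow> complex.
        (\<forall>n. simple_function M (s n) \<and> s n ` space M \<subseteq> H \<and>
             emeasure M {t \<in> space M. s n t \<noteq> (\<lambda>_. 0)} < \<infinity>) \<and>
        (\<forall>n. (\<lambda>t. N (\<lambda>z. f t z - s n t z)) \<in> borel_measurable M) \<and>
        ((\<lambda>n. \<integral>\<^sup>+t. ennreal (N (\<lambda>z. f t z - s n t z)) \<partial>M) \<longlonglongrightarrow> 0) \<and>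
        ((\<lambda>n. N (\<lambda>z. simple_integral_fun M (s n) z - I z)) \<longlonglongrightarrow> 0))"

definition cesaro_adj :: "real \<Rightarrow> (complex \<Rightarrow> complex) \<Rightarrow> complex \<Rightarrow> complex" where
  "cesaro_adj \<alpha> F =
     (THE G. has_bochner_integral_in hardy2 hardy2_norm (restrict_space lborel {0<..})
        (\<lambda>t z. of_real (\<alpha> * (1 - exp (- t)) powr (\<alpha> - 1) * exp (- t / 2)) * T2 (- t) F z) G)"

definition hardy2_frac :: "real \<Rightarrow> (complex \<Rightarrow> complex) set" where
  "hardy2_frac \<alpha> = cesaro_adj \<alpha> ` hardy2"

definition cesaro_adj_inv :: "real \<Rightarrow> (complex \<Rightarrow> complex) \<Rightarrow> complex \<Rightarrow> complex" where
  "cesaro_adj_inv \<alpha> = inv_into hardy2 (cesaro_adj \<alpha>)"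

definition hardy2_frac_norm :: "real \<Rightarrow> (complex \<Rightarrow> complex) \<Rightarrow> real" where
  "hardy2_frac_norm \<alpha> F = Gamma (\<alpha> + 1) * hardy2_norm (cesaro_adj_inv \<alpha> F)"

definition hardy2_frac_inner ::
  "real \<Rightarrow> (complex \<Rightarrow> complex) \<Rightarrow> (complex \<Rightarrow> complex) \<Rightarrow> complex" where
  "hardy2_frac_inner \<alpha> F G =
     of_real ((Gamma (\<alpha> + 1))\<^sup>2) * hardy2_inner (cesaro_adj_inv \<alpha> F) (cesaro_adj_inv \<alpha> G)"

definition is_reproducing_kernel ::
  "'b set \<Rightarrow> ('b \<Rightarrow> complex) set \<Rightarrow> (('b \<Rightarrow> complex) \<Rightarrow> ('b \<Rightarrow> complex) \<Rightarrow> complex) \<Rightarrow>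
   ('b \<Rightarrow> 'b \<Rightarrow> complex) \<Rightarrow> bool" where
  "is_reproducing_kernel X H ip K \<longleftrightarrow>
     (\<forall>w\<in>X. (\<lambda>z. K z w) \<in> H \<and> (\<forall>F\<in>H. F w = ip F (\<lambda>z. K z w)))"

end

theory Submission
  imports Defs "HOL-Probability.Probability" "HOL-Real_Asymp.Real_Asymp"
begin

text \<open>Under \<open>r = exp (- t)\<close> the adjoint operator becomes \<open>G \<mapsto> \<integral> G (w / r) / r d\<mu> r\<close> with the probability
  measure \<open>d\<mu> r = \<alpha> (1 - r)\<^sup>\<alpha>\<^sup>-\<^sup>1 dr\<close> on \<open>(0, 1)\<close>. Testing the reproducing property of \<open>K\<close> on the images of
  the Szego kernels \<open>1 / (z + cnj v)\<close> determines the preimage of \<open>K (\<cdot>, w)\<close>, and gives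
  \<open>\<Gamma> (\<alpha> + 1)\<^sup>2 \<parallel>K (\<cdot>, w)\<parallel>\<^sup>2 = \<integral>\<integral> 1 / (s cnj w + r w) d\<mu> r d\<mu> s\<close>.
  The lower bounds come from the Cauchy--Schwarz inequality for the kernel functions at \<open>w\<close> and \<open>cnj w\<close>, which
  reduces to \<open>w > 0\<close>, followed by Jensen's inequality. The upper bounds come from Schur's test for the
  homogeneous kernel \<open>Re (1 / (s cnj w + r w))\<close> when \<open>\<alpha> > 1/2\<close>, and from
  \<open>\<bar>s cnj w + r w\<bar> \<ge> 2 Re w sqrt (r s)\<close> when \<open>\<alpha> \<le> 1/2\<close>. All of this needs \<open>\<alpha>\<close>-fold integration to be injective,
  which follows from the vanishing of all polynomial moments.\<close>

section \<open>Square-integrable functions on vertical lines\<close>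

lemma integrable_cauchy_density:
  fixes a b :: real assumes "a \<noteq> 0"
  shows "integrable lborel (\<lambda>y. 1 / (a\<^sup>2 + (y - b)\<^sup>2))"
    and "(\<integral>y. 1 / (a\<^sup>2 + (y - b)\<^sup>2) \<partial>lborel) = pi / \<bar>a\<bar>"
proof -
  have i: "integrable lborel (\<lambda>x::real. inverse (1 + x\<^sup>2))"
    using integrable_inverse_1_plus_square by (simp add: set_integrable_def)
  have v: "integral\<^sup>L lborel (\<lambda>x::real. inverse (1 + x\<^sup>2)) = pi"
    using LBINT_inverse_1_plus_square
    by (simp add: interval_lebesgue_integral_def set_lebesgue_integral_def)
  have eq: "inverse (1 + (- b / a + (1 / a) * y)\<^sup>2) = a\<^sup>2 * (1 / (a\<^sup>2 + (y - b)\<^sup>2))" for y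
  proof -
    have "- b / a + (1 / a) * y = (y - b) / a" by (simp add: diff_divide_distrib)
    then show ?thesis using assms by (simp add: power_divide add_divide_eq_iff field_simps)
  qed
  have "integrable lborel (\<lambda>y. inverse (1 + (- b / a + (1 / a) * y)\<^sup>2))"
    using lborel_integrable_real_affine[OF i, of "1/a" "- b / a"] assms by simp
  then show "integrable lborel (\<lambda>y. 1 / (a\<^sup>2 + (y - b)\<^sup>2))"
    unfolding eq using integrable_mult_right_iff[where M=lborel and c="a\<^sup>2" and f="\<lambda>y. 1 / (a\<^sup>2 + (y - b)\<^sup>2)"] assms
    by (simp del: times_divide_eq_right)
  have "pi = \<bar>1 / a\<bar> *\<^sub>R (\<integral>y. inverse (1 + (- b / a + (1 / a) * y)\<^sup>2) \<partial>lborel)"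
    using lborel_integral_real_affine[of "1/a" "\<lambda>x. inverse (1 + x\<^sup>2)" "- b / a"] assms v by simp
  also have "... = \<bar>a\<bar> * (\<integral>y. 1 / (a\<^sup>2 + (y - b)\<^sup>2) \<partial>lborel)"
    unfolding eq integral_mult_right_zero using assms by (simp add: field_simps power2_eq_square abs_if)
  finally show "(\<integral>y. 1 / (a\<^sup>2 + (y - b)\<^sup>2) \<partial>lborel) = pi / \<bar>a\<bar>"
    using assms by (simp add: nonzero_eq_divide_eq mult.commute)
qed

lemma integrable_mult_L2:
  fixes f g :: "'a \<Rightarrow> complex"
  assumes [measurable]: "f \<in> borel_measurable M" "g \<in> borel_measurable M"
    and f: "integrable M (\<lambda>x. (cmod (f x))\<^sup>2)" and g: "integrable M (\<lambda>x. (cmod (g x))\<^sup>2)"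
  shows "integrable M (\<lambda>x. f x * g x)"
    and "(cmod (\<integral>x. f x * g x \<partial>M))\<^sup>2 \<le> (\<integral>x. (cmod (f x))\<^sup>2 \<partial>M) * (\<integral>x. (cmod (g x))\<^sup>2 \<partial>M)"
proof -
  have "a * b \<le> a\<^sup>2 + b\<^sup>2" if "0 \<le> a" "0 \<le> b" for a b :: real
    using sum_squares_bound[of a b] mult_nonneg_nonneg[OF that] by (simp add: mult.assoc)
  then have le: "norm (f x * g x) \<le> norm ((cmod (f x))\<^sup>2 + (cmod (g x))\<^sup>2)" for x
    by (simp add: norm_mult)
  show i: "integrable M (\<lambda>x. f x * g x)"
    by (rule Bochner_Integration.integrable_bound[OF Bochner_Integration.integrable_add[OF f g]])
      (use le in auto)
  have "(cmod (\<integral>x. f x * g x \<partial>M)) \<le> (\<integral>x. cmod (f x) * cmod (g x) \<partial>M)"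
    using integral_norm_bound[of M "\<lambda>x. f x * g x"] by (simp add: norm_mult)
  moreover have "ennreal ((\<integral>x. cmod (f x) * cmod (g x) \<partial>M)\<^sup>2) \<le>
      ennreal ((\<integral>x. (cmod (f x))\<^sup>2 \<partial>M) * (\<integral>x. (cmod (g x))\<^sup>2 \<partial>M))"
  proof -
    have i': "integrable M (\<lambda>x. cmod (f x) * cmod (g x))"
      using integrable_norm[OF i] by (simp add: norm_mult)
    have "ennreal ((\<integral>x. cmod (f x) * cmod (g x) \<partial>M)\<^sup>2)
       = (\<integral>\<^sup>+x. ennreal (cmod (f x)) * ennreal (cmod (g x)) \<partial>M)\<^sup>2"
      using nn_integral_eq_integral[OF i'] by (simp add: ennreal_power ennreal_mult integral_nonneg_AE)
    also have "... \<le> (\<integral>\<^sup>+x. (ennreal (cmod (f x)))\<^sup>2 \<partial>M) * (\<integral>\<^sup>+x. (ennreal (cmod (g x)))\<^sup>2 \<partial>M)"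
      by (rule Cauchy_Schwarz_nn_integral) auto
    also have "... = ennreal ((\<integral>x. (cmod (f x))\<^sup>2 \<partial>M) * (\<integral>x. (cmod (g x))\<^sup>2 \<partial>M))"
      by (simp add: ennreal_power nn_integral_eq_integral f g ennreal_mult integral_nonneg_AE)
    finally show ?thesis .
  qed
  then have "(\<integral>x. cmod (f x) * cmod (g x) \<partial>M)\<^sup>2 \<le> (\<integral>x. (cmod (f x))\<^sup>2 \<partial>M) * (\<integral>x. (cmod (g x))\<^sup>2 \<partial>M)"
    by (subst (asm) ennreal_le_iff) (auto intro!: mult_nonneg_nonneg)
  ultimately show "(cmod (\<integral>x. f x * g x \<partial>M))\<^sup>2 \<le> (\<integral>x. (cmod (f x))\<^sup>2 \<partial>M) * (\<integral>x. (cmod (g x))\<^sup>2 \<partial>M)"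
    by (meson norm_ge_zero order_trans power_mono)
qed

lemma continuous_on_vertical_line:
  assumes "f holomorphic_on {z. Re z > x0}" "x0 < u"
  shows "continuous_on UNIV (\<lambda>y. f (Complex u y))"
proof -
  have "continuous_on {z. Re z > x0} f" using assms(1) by (rule holomorphic_on_imp_continuous_on)
  moreover have "continuous_on UNIV (\<lambda>y. Complex u y)"
    unfolding Complex_eq by (intro continuous_intros)
  ultimately show ?thesis
    by (rule continuous_on_compose2) (use assms(2) in auto)
qed

lemma vertical_line_measurable:
  assumes "f holomorphic_on {z. Re z > x0}" "x0 < u"
  shows "(\<lambda>y. f (Complex u y)) \<in> borel_measurable borel"
  by (intro borel_measurable_continuous_onI continuous_on_vertical_line[OF assms])

lemma cauchy_rectangle:
  assumes hol: "f holomorphic_on {z. Re z > x0}" and x: "x0 < x" "x < Re w" and X: "Re w < X"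
    and R: "\<bar>Im w\<bar> < R"
  defines "q \<equiv> \<lambda>\<zeta>. f \<zeta> / (\<zeta> - w)"
  shows "\<i> * integral {-R..R} (\<lambda>y. q (Complex X y)) - \<i> * integral {-R..R} (\<lambda>y. q (Complex x y))
     + contour_integral (linepath (Complex x (-R)) (Complex X (-R))) q
     - contour_integral (linepath (Complex x R) (Complex X R)) q = 2 * pi * \<i> * f w"
proof -
  let ?S = "{z. Re z > x0}"
  let ?a1 = "Complex x (-R)" and ?a2 = "Complex X (-R)" and ?a3 = "Complex X R" and ?a4 = "Complex x R"
  have R0: "0 < R" using R by linarith
  have conv: "convex ?S" by (rule convex_halfspace_Re_gt)
  have op: "open ?S" by (rule open_halfspace_Re_gt)
  have q_cont: "continuous_on (?S - {w}) q"
    unfolding q_def by (intro continuous_intros holomorphic_on_imp_continuous_on holomorphic_on_subset[OF hol]) auto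
  have wbox: "w \<in> box ?a1 ?a3" using x X R by (simp add: in_box_complex_iff abs_less_iff)
  have "path_image (rectpath ?a1 ?a3) \<subseteq> ?S - {w}"
  proof
    fix p assume p: "p \<in> path_image (rectpath ?a1 ?a3)"
    have "p \<in> cbox ?a1 ?a3" using p path_image_rectpath_subset_cbox[of ?a1 ?a3] x X R0 by auto
    moreover have "p \<notin> box ?a1 ?a3" using p path_image_rectpath_inter_box[of ?a1 ?a3] x X R0 by auto
    ultimately show "p \<in> ?S - {w}" using wbox x by (auto simp: in_cbox_complex_iff)
  qed
  note sub = this
  have "(q has_contour_integral (2 * pi * \<i> * winding_number (rectpath ?a1 ?a3) w * f w)) (rectpath ?a1 ?a3)"
    unfolding q_def
    by (rule Cauchy_integral_formula_convex_simple[OF conv hol])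
      (use sub x op in \<open>auto simp: interior_open\<close>)
  moreover have "winding_number (rectpath ?a1 ?a3) w = 1"
    by (rule winding_number_rectpath[OF wbox])
  ultimately have main: "(q has_contour_integral (2 * pi * \<i> * f w)) (rectpath ?a1 ?a3)" by simp
  have rp: "rectpath ?a1 ?a3 = linepath ?a1 ?a2 +++ linepath ?a2 ?a3 +++ linepath ?a3 ?a4 +++ linepath ?a4 ?a1"
    by (simp add: rectpath_def Let_def)
  have "path_image (rectpath ?a1 ?a3) = closed_segment ?a1 ?a2 \<union> (closed_segment ?a2 ?a3 \<union> (closed_segment ?a3 ?a4 \<union> closed_segment ?a4 ?a1))"
    unfolding rp by (simp add: path_image_join)
  with sub have segs: "closed_segment ?a1 ?a2 \<subseteq> ?S - {w}" "closed_segment ?a2 ?a3 \<subseteq> ?S - {w}"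
    "closed_segment ?a3 ?a4 \<subseteq> ?S - {w}" "closed_segment ?a4 ?a1 \<subseteq> ?S - {w}"
    by (metis (no_types, lifting) Un_subset_iff)+
  have ci: "q contour_integrable_on linepath a b" if "closed_segment a b \<subseteq> ?S - {w}" for a b
    by (rule contour_integrable_continuous_linepath[OF continuous_on_subset[OF q_cont that]])
  have "contour_integral (rectpath ?a1 ?a3) q = contour_integral (linepath ?a1 ?a2) q +
     (contour_integral (linepath ?a2 ?a3) q + (contour_integral (linepath ?a3 ?a4) q + contour_integral (linepath ?a4 ?a1) q))"
    unfolding rp using ci[OF segs(1)] ci[OF segs(2)] ci[OF segs(3)] ci[OF segs(4)] by simp
  moreover have "contour_integral (rectpath ?a1 ?a3) q = 2 * pi * \<i> * f w"
    using main by (rule contour_integral_unique)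
  moreover have "contour_integral (linepath ?a2 ?a3) q = \<i> * integral {-R..R} (\<lambda>y. q (Complex X y))"
    using R by (intro contour_integral_linepath_same_Re) auto
  moreover have "contour_integral (linepath ?a1 ?a4) q = \<i> * integral {-R..R} (\<lambda>y. q (Complex x y))"
    using R by (intro contour_integral_linepath_same_Re) auto
  moreover have "contour_integral (linepath ?a4 ?a1) q = - contour_integral (linepath ?a1 ?a4) q"
    using contour_integral_reverse_linepath[of ?a4 ?a1 q] segs(4) q_cont
    by (metis continuous_on_subset)
  moreover have "contour_integral (linepath ?a3 ?a4) q = - contour_integral (linepath ?a4 ?a3) q"
    using contour_integral_reverse_linepath[of ?a3 ?a4 q] segs(3) q_cont
    by (metis continuous_on_subset)
  ultimately show ?thesis by (simp add: algebra_simps)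
qed

lemma nn_integral_infinite_of_gt_1:
  fixes b :: "real \<Rightarrow> ennreal"
  assumes "\<And>R. R \<ge> R0 \<Longrightarrow> 1 < b R"
  shows "(\<integral>\<^sup>+R. b R \<partial>lborel) = \<infinity>"
proof -
  have "of_nat n \<le> (\<integral>\<^sup>+R. b R \<partial>lborel)" for n
  proof -
    have "of_nat n = (\<integral>\<^sup>+R. indicator {R0..R0 + real n} R \<partial>lborel)"
      by (simp add: ennreal_of_nat_eq_real_of_nat)
    also have "... \<le> (\<integral>\<^sup>+R. b R \<partial>lborel)"
      by (intro nn_integral_mono) (auto simp: indicator_def intro: less_imp_le assms)
    finally show ?thesis .
  qed
  then show ?thesis by (metis ennreal_Ex_less_of_nat infinity_ennreal_def not_le top.not_eq_extremum)
qed

lemma horizontal_segment_small: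
  assumes hol: "f holomorphic_on {z. Re z > x0}" and x: "x0 < x" "x < X"
    and int: "\<And>u. x \<le> u \<Longrightarrow> integrable lborel (\<lambda>y. (cmod (f (Complex u y)))\<^sup>2)"
    and bd: "\<And>u. x \<le> u \<Longrightarrow> (\<integral>y. (cmod (f (Complex u y)))\<^sup>2 \<partial>lborel) \<le> B"
  obtains R where "R \<ge> R0"
    "integral {0..1} (\<lambda>t. (cmod (f (Complex (x + t * (X - x)) R)))\<^sup>2) \<le> 1"
    "integral {0..1} (\<lambda>t. (cmod (f (Complex (x + t * (X - x)) (-R))))\<^sup>2) \<le> 1"
proof -
  define g where "g t y = indicator {0..1} t * (cmod (f (Complex (x + t * (X - x)) y)))\<^sup>2" for t y :: real
  have fc: "continuous_on {z. Re z > x0} f" using hol by (rule holomorphic_on_imp_continuous_on)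
  have pos: "x \<le> x + t * (X - x)" if "0 \<le> t" for t using that x by simp
  have "continuous_on ({0..1} \<times> UNIV) (\<lambda>p. (cmod (f (Complex (x + fst p * (X - x)) (snd p))))\<^sup>2)"
    by (intro continuous_intros continuous_on_compose2[OF fc])
      (use x pos in \<open>auto simp: Complex_eq intro!: continuous_intros dest!: pos\<close>)
  then have "(\<lambda>p. indicator ({0..1} \<times> UNIV) p *\<^sub>R (cmod (f (Complex (x + fst p * (X - x)) (snd p))))\<^sup>2) \<in> borel_measurable (borel :: (real \<times> real) measure)"
    by (intro borel_measurable_continuous_on_indicator) (auto intro!: borel_closed closed_Times)
  also have "(\<lambda>p. indicator ({0..1} \<times> UNIV) p *\<^sub>R (cmod (f (Complex (x + fst p * (X - x)) (snd p))))\<^sup>2) = (\<lambda>(t, y). g t y)"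
    by (auto simp: g_def indicator_def fun_eq_iff)
  finally have gm[measurable]: "(\<lambda>(t, y). g t y) \<in> borel_measurable (lborel \<Otimes>\<^sub>M lborel)"
    by (simp add: lborel_prod)
  have gm'[measurable]: "(\<lambda>(t, y). g t (- y)) \<in> borel_measurable (lborel \<Otimes>\<^sub>M lborel)"
    using measurable_compose[OF _ gm, of "\<lambda>(t, y). (t, - y)" "lborel \<Otimes>\<^sub>M lborel"] by (simp add: case_prod_unfold)
  have g0: "0 \<le> g t y" for t y by (simp add: g_def)
  have inner: "(\<integral>\<^sup>+y. ennreal (g t y) \<partial>lborel) \<le> ennreal B * indicator {0..1} t" for t
  proof (cases "t \<in> {0..1}")
    case True
    then show ?thesis using int[OF pos, of t] bd[OF pos, of t]
      by (simp add: g_def nn_integral_eq_integral ennreal_leI)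
  qed (simp add: g_def)
  have inner': "(\<integral>\<^sup>+y. ennreal (g t (- y)) \<partial>lborel) = (\<integral>\<^sup>+y. ennreal (g t y) \<partial>lborel)" for t
    using nn_integral_real_affine[of "\<lambda>y. ennreal (g t y)" "-1" 0] by simp
  define b where "b R = (\<integral>\<^sup>+t. ennreal (g t R) \<partial>lborel) + (\<integral>\<^sup>+t. ennreal (g t (-R)) \<partial>lborel)" for R
  have "(\<integral>\<^sup>+R. b R \<partial>lborel) = (\<integral>\<^sup>+R. (\<integral>\<^sup>+t. ennreal (g t R) \<partial>lborel) \<partial>lborel) + (\<integral>\<^sup>+R. (\<integral>\<^sup>+t. ennreal (g t (-R)) \<partial>lborel) \<partial>lborel)"
    unfolding b_def by (rule nn_integral_add) measurable
  also have "... = (\<integral>\<^sup>+t. (\<integral>\<^sup>+R. ennreal (g t R) \<partial>lborel) \<partial>lborel) + (\<integral>\<^sup>+t. (\<integral>\<^sup>+R. ennreal (g t (-R)) \<partial>lborel) \<partial>lborel)"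
    by (intro arg_cong2[where f="(+)"]; rule lborel_pair.Fubini'; measurable)
  also have "... \<le> (\<integral>\<^sup>+t. ennreal B * indicator {0..1::real} t \<partial>lborel) + (\<integral>\<^sup>+t. ennreal B * indicator {0..1::real} t \<partial>lborel)"
    unfolding inner' by (intro add_mono nn_integral_mono inner)
  also have "... < \<infinity>" by (simp add: nn_integral_cmult_indicator)
  finally have "(\<integral>\<^sup>+R. b R \<partial>lborel) \<noteq> \<infinity>" by simp
  then obtain R where R: "R \<ge> R0" "b R \<le> 1"
    using nn_integral_infinite_of_gt_1[of R0 b] by (meson not_le)
  have one: "integral {0..1} (\<lambda>t. (cmod (f (Complex (x + t * (X - x)) y)))\<^sup>2) \<le> 1"
    if "(\<integral>\<^sup>+t. ennreal (g t y) \<partial>lborel) \<le> 1" for y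
  proof -
    have "continuous_on {0..1} (\<lambda>t. (cmod (f (Complex (x + t * (X - x)) y)))\<^sup>2)"
      by (intro continuous_intros continuous_on_compose2[OF fc])
        (use x pos in \<open>auto simp: Complex_eq intro!: continuous_intros dest!: pos\<close>)
    then have si: "set_integrable lborel {0..1} (\<lambda>t. (cmod (f (Complex (x + t * (X - x)) y)))\<^sup>2)"
      by (rule borel_integrable_atLeastAtMost')
    have i: "integrable lborel (\<lambda>t. g t y)" using si by (simp add: set_integrable_def g_def)
    have "ennreal (\<integral>t. g t y \<partial>lborel) \<le> ennreal 1"
      using that nn_integral_eq_integral[OF i] g0 by simp
    then have "(\<integral>t. g t y \<partial>lborel) \<le> 1" by (subst (asm) ennreal_le_iff) auto
    then show ?thesis
      using set_borel_integral_eq_integral(2)[OF si] by (simp add: set_lebesgue_integral_def g_def)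
  qed
  have "(\<integral>\<^sup>+t. ennreal (g t R) \<partial>lborel) \<le> 1" "(\<integral>\<^sup>+t. ennreal (g t (-R)) \<partial>lborel) \<le> 1"
    using R(2) unfolding b_def by (metis add_increasing2 add.commute order_trans le_add_same_cancel1 zero_le le_iff_add)+
  then show thesis using that R(1) one by blast
qed

lemma integral_symmetric_interval_tendsto:
  fixes g :: "real \<Rightarrow> complex"
  assumes g: "integrable lborel g" and R: "filterlim R at_top sequentially"
  shows "(\<lambda>n. integral {- R n..R n} g) \<longlonglongrightarrow> (\<integral>y. g y \<partial>lborel)"
proof -
  have "(\<lambda>n. \<integral>y. indicator {- R n..R n} y *\<^sub>R g y \<partial>lborel) \<longlonglongrightarrow> (\<integral>y. g y \<partial>lborel)"
  proof (rule integral_dominated_convergence[where w="\<lambda>y. norm (g y)"])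
    show "AE y in lborel. (\<lambda>n. indicator {- R n..R n} y *\<^sub>R g y) \<longlonglongrightarrow> g y"
    proof (rule AE_I2)
      fix y
      have "eventually (\<lambda>n. \<bar>y\<bar> \<le> R n) sequentially"
        using R unfolding filterlim_at_top by blast
      then have "eventually (\<lambda>n. indicator {- R n..R n} y *\<^sub>R g y = g y) sequentially"
        by eventually_elim (auto simp: abs_le_iff)
      then show "(\<lambda>n. indicator {- R n..R n} y *\<^sub>R g y) \<longlonglongrightarrow> g y"
        by (rule tendsto_eventually)
    qed
  qed (use g in \<open>auto intro!: mult_left_le_one_le simp: indicator_def\<close>)
  moreover have "(\<integral>y. indicator {- r..r} y *\<^sub>R g y \<partial>lborel) = integral {-r..r} g" for r
  proof -
    have "set_integrable lborel {-r..r} g"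
      unfolding set_integrable_def by (rule integrable_mult_indicator) (auto intro: g)
    from set_borel_integral_eq_integral(2)[OF this] show ?thesis by (simp add: set_lebesgue_integral_def)
  qed
  ultimately show ?thesis by simp
qed

lemma cauchy_kernel_line:
  assumes "u \<noteq> Re w"
  shows "(\<lambda>y. 1 / (Complex u y - w)) \<in> borel_measurable borel"
    and "integrable lborel (\<lambda>y. (cmod (1 / (Complex u y - w)))\<^sup>2)"
    and "(\<integral>y. (cmod (1 / (Complex u y - w)))\<^sup>2 \<partial>lborel) = pi / \<bar>u - Re w\<bar>"
proof -
  have "Complex u y - w \<noteq> 0" for y using assms by (auto simp: complex_eq_iff)
  then show "(\<lambda>y. 1 / (Complex u y - w)) \<in> borel_measurable borel"
    by (intro borel_measurable_continuous_onI) (auto simp: Complex_eq intro!: continuous_intros)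
  have "(cmod (1 / (Complex u y - w)))\<^sup>2 = 1 / ((u - Re w)\<^sup>2 + (y - Im w)\<^sup>2)" for y
    by (simp add: norm_divide power_divide cmod_power2)
  then show "integrable lborel (\<lambda>y. (cmod (1 / (Complex u y - w)))\<^sup>2)"
    "(\<integral>y. (cmod (1 / (Complex u y - w)))\<^sup>2 \<partial>lborel) = pi / \<bar>u - Re w\<bar>"
    using integrable_cauchy_density[of "u - Re w" "Im w"] assms by simp_all
qed

lemma horizontal_contour_integral_bound:
  fixes f :: "complex \<Rightarrow> complex"
  assumes hol: "f holomorphic_on {z. Re z > x0}" and x: "x0 < x" "x < X"
    and r: "\<bar>Im w\<bar> + \<delta> \<le> \<bar>r\<bar>" "0 < \<delta>"
    and small: "integral {0..1} (\<lambda>t. (cmod (f (Complex (x + t * (X - x)) r)))\<^sup>2) \<le> 1"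
  shows "cmod (contour_integral (linepath (Complex x r) (Complex X r)) (\<lambda>\<zeta>. f \<zeta> / (\<zeta> - w)))
     \<le> 2 * (X - x) / \<delta>"
proof -
  have fc: "continuous_on {z. Re z > x0} f" using hol by (rule holomorphic_on_imp_continuous_on)
  have pos: "x0 < x + t * (X - x)" if "0 \<le> t" for t
    using that x mult_nonneg_nonneg[of t "X - x"] by linarith
  have ne: "\<delta> \<le> cmod (Complex a r - w)" for a
    using abs_Im_le_cmod[of "Complex a r - w"] r by auto
  have lp: "linepath (Complex x r) (Complex X r) t = Complex (x + t * (X - x)) r" for t
    by (simp add: linepath_def complex_eq_iff algebra_simps)
  have d: "Complex X r - Complex x r = of_real X - of_real x" by (simp add: complex_eq_iff)
  have dn: "cmod (of_real X - of_real x) = X - x"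
    using x by (simp flip: of_real_diff)
  have cf: "continuous_on {0..1} (\<lambda>t. f (Complex (x + t * (X - x)) r))"
    by (intro continuous_on_compose2[OF fc]) (use pos in \<open>auto simp: Complex_eq intro!: continuous_intros\<close>)
  have nz: "Complex a r - w \<noteq> 0" for a using ne[of a] r by auto
  have cq: "continuous_on {0..1} (\<lambda>t. f (Complex (x + t * (X - x)) r) / (Complex (x + t * (X - x)) r - w) * (X - x))"
    by (intro continuous_intros cf) (use nz in blast)
  have cb: "continuous_on {0..1} (\<lambda>t. (1 + (cmod (f (Complex (x + t * (X - x)) r)))\<^sup>2) * ((X - x) / \<delta>))"
    by (intro continuous_intros cf)
  have "cmod (contour_integral (linepath (Complex x r) (Complex X r)) (\<lambda>\<zeta>. f \<zeta> / (\<zeta> - w)))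
     = cmod (integral {0..1} (\<lambda>t. f (Complex (x + t * (X - x)) r) / (Complex (x + t * (X - x)) r - w) * (X - x)))"
    unfolding contour_integral_integral by (simp add: lp d)
  also have "... \<le> integral {0..1} (\<lambda>t. (1 + (cmod (f (Complex (x + t * (X - x)) r)))\<^sup>2) * ((X - x) / \<delta>))"
  proof (rule integral_norm_bound_integral)
    fix t :: real
    define a where "a = cmod (f (Complex (x + t * (X - x)) r))"
    have "2 * a \<le> a\<^sup>2 + 1" using sum_squares_bound[of a 1] by simp
    then have "a \<le> 1 + a\<^sup>2" using zero_le_power2[of a] by linarith
    moreover have "cmod (f (Complex (x + t * (X - x)) r) / (Complex (x + t * (X - x)) r - w) * (X - x)) \<le> a / \<delta> * (X - x)"
      unfolding norm_mult norm_divide a_def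
      by (intro mult_mono divide_left_mono) (use ne r x nz dn in \<open>auto simp: a_def\<close>)
    ultimately show "cmod (f (Complex (x + t * (X - x)) r) / (Complex (x + t * (X - x)) r - w) * (X - x))
        \<le> (1 + (cmod (f (Complex (x + t * (X - x)) r)))\<^sup>2) * ((X - x) / \<delta>)"
      using x r by (fold a_def) (smt (verit) divide_nonneg_pos mult_right_mono times_divide_eq_left times_divide_eq_right mult.commute)
  qed (intro integrable_continuous_real cq cb)+
  also have "... = (1 + integral {0..1} (\<lambda>t. (cmod (f (Complex (x + t * (X - x)) r)))\<^sup>2)) * ((X - x) / \<delta>)"
    by (subst integral_mult_left, subst Henstock_Kurzweil_Integration.integral_add)
      (auto intro!: integrable_continuous_real continuous_intros cf)
  also have "... \<le> 2 * ((X - x) / \<delta>)"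
    by (intro mult_right_mono) (use small x r in auto)
  finally show ?thesis by simp
qed

lemma cauchy_vertical_line:
  fixes f :: "complex \<Rightarrow> complex"
  assumes hol: "f holomorphic_on {z. Re z > x0}" and x: "x0 < x" "x < Re w"
    and int: "\<And>u. x \<le> u \<Longrightarrow> integrable lborel (\<lambda>y. (cmod (f (Complex u y)))\<^sup>2)"
    and bd: "\<And>u. x \<le> u \<Longrightarrow> (\<integral>y. (cmod (f (Complex u y)))\<^sup>2 \<partial>lborel) \<le> B"
  shows "(\<integral>y. f (Complex x y) / (w - Complex x y) \<partial>lborel) = 2 * pi * f w"
proof -
  define q where "q \<zeta> = f \<zeta> / (\<zeta> - w)" for \<zeta>
  have qi: "integrable lborel (\<lambda>y. q (Complex u y))"
    and qb: "(cmod (\<integral>y. q (Complex u y) \<partial>lborel))\<^sup>2 \<le> B * (pi / \<bar>u - Re w\<bar>)"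
    if u: "x \<le> u" "u \<noteq> Re w" for u
  proof -
    have m: "(\<lambda>y. f (Complex u y)) \<in> borel_measurable lborel" "(\<lambda>y. 1 / (Complex u y - w)) \<in> borel_measurable lborel"
      using vertical_line_measurable[OF hol, of u] cauchy_kernel_line(1)[OF u(2)] u x by auto
    note L2 = integrable_mult_L2[OF m int[OF u(1)] cauchy_kernel_line(2)[OF u(2)]]
    show "integrable lborel (\<lambda>y. q (Complex u y))" using L2(1) by (simp add: q_def)
    have "(cmod (\<integral>y. q (Complex u y) \<partial>lborel))\<^sup>2 \<le>
       (\<integral>y. (cmod (f (Complex u y)))\<^sup>2 \<partial>lborel) * (pi / \<bar>u - Re w\<bar>)"
      using L2(2) unfolding cauchy_kernel_line(3)[OF u(2)] by (simp add: q_def)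
    also have "... \<le> B * (pi / \<bar>u - Re w\<bar>)" by (intro mult_right_mono bd u) auto
    finally show "(cmod (\<integral>y. q (Complex u y) \<partial>lborel))\<^sup>2 \<le> B * (pi / \<bar>u - Re w\<bar>)" .
  qed
  have shift: "(\<integral>y. q (Complex X y) \<partial>lborel) - (\<integral>y. q (Complex x y) \<partial>lborel) = 2 * pi * f w"
    if X: "Re w < X" for X
  proof -
    have "\<exists>R\<ge>\<bar>Im w\<bar> + real n + 1.
      integral {0..1} (\<lambda>t. (cmod (f (Complex (x + t * (X - x)) R)))\<^sup>2) \<le> 1 \<and>
      integral {0..1} (\<lambda>t. (cmod (f (Complex (x + t * (X - x)) (-R))))\<^sup>2) \<le> 1" for n
      by (rule horizontal_segment_small[OF hol x(1) _ int bd, of X "\<bar>Im w\<bar> + real n + 1"]) (use x X in auto)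
    then obtain R where R: "\<And>n. \<bar>Im w\<bar> + real n + 1 \<le> R n"
      "\<And>n. integral {0..1} (\<lambda>t. (cmod (f (Complex (x + t * (X - x)) (R n))))\<^sup>2) \<le> 1"
      "\<And>n. integral {0..1} (\<lambda>t. (cmod (f (Complex (x + t * (X - x)) (- R n))))\<^sup>2) \<le> 1" by metis
    have Rlim: "filterlim R at_top sequentially"
      by (rule filterlim_at_top_mono[OF filterlim_real_sequentially])
        (use R(1) in \<open>auto intro!: always_eventually order_trans[OF _ R(1)]\<close>)
    let ?h = "\<lambda>r. contour_integral (linepath (Complex x r) (Complex X r)) q"
    have hb: "cmod (?h r) \<le> 2 * (X - x) / (real n + 1)" if "r = R n \<or> r = - R n" for r n
      unfolding q_def
      by (rule horizontal_contour_integral_bound[OF hol x(1)]) (use x X that R(1)[of n] R(2,3)[of n] in auto)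
    have z: "(\<lambda>n. 2 * (X - x) / (real n + 1)) \<longlonglongrightarrow> 0" by real_asymp
    have h0: "(\<lambda>n. ?h (R n)) \<longlonglongrightarrow> 0" "(\<lambda>n. ?h (- R n)) \<longlonglongrightarrow> 0"
      by (rule Lim_null_comparison[OF always_eventually z]; use hb in blast)+
    have "(\<lambda>n. \<i> * integral {-R n..R n} (\<lambda>y. q (Complex X y)) - \<i> * integral {-R n..R n} (\<lambda>y. q (Complex x y))
        + ?h (- R n) - ?h (R n)) \<longlonglongrightarrow> \<i> * (\<integral>y. q (Complex X y) \<partial>lborel) - \<i> * (\<integral>y. q (Complex x y) \<partial>lborel) + 0 - 0"
      by (intro tendsto_intros h0 integral_symmetric_interval_tendsto qi Rlim) (use x X in auto)
    moreover have "\<i> * integral {-R n..R n} (\<lambda>y. q (Complex X y)) - \<i> * integral {-R n..R n} (\<lambda>y. q (Complex x y))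
        + ?h (- R n) - ?h (R n) = 2 * pi * \<i> * f w" for n
      unfolding q_def by (rule cauchy_rectangle[OF hol x X]) (use R(1)[of n] in linarith)
    ultimately have "\<i> * (\<integral>y. q (Complex X y) \<partial>lborel) - \<i> * (\<integral>y. q (Complex x y) \<partial>lborel) + 0 - 0 = 2 * pi * \<i> * f w"
      by (simp add: LIMSEQ_const_iff)
    then have "\<i> * ((\<integral>y. q (Complex X y) \<partial>lborel) - (\<integral>y. q (Complex x y) \<partial>lborel)) = \<i> * (2 * pi * f w)"
      by (simp add: algebra_simps)
    then show ?thesis by simp
  qed
  have "(cmod ((\<integral>y. q (Complex x y) \<partial>lborel) + 2 * pi * f w))\<^sup>2 \<le> 0"
  proof (rule tendsto_lowerbound[where F=sequentially and f="\<lambda>n. B * (pi / (real n + 1))"])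
    show "(\<lambda>n. B * (pi / (real n + 1))) \<longlonglongrightarrow> 0" by real_asymp
    have "(cmod ((\<integral>y. q (Complex x y) \<partial>lborel) + 2 * pi * f w))\<^sup>2 \<le> B * (pi / (real n + 1))" for n
      using qb[of "Re w + real n + 1"] shift[of "Re w + real n + 1"] x by (simp add: algebra_simps)
    then show "\<forall>\<^sub>F n in sequentially. (cmod ((\<integral>y. q (Complex x y) \<partial>lborel) + 2 * pi * f w))\<^sup>2 \<le> B * (pi / (real n + 1))"
      by simp
  qed simp
  then have "(\<integral>y. q (Complex x y) \<partial>lborel) = - (2 * pi * f w)"
    by (simp add: add_eq_0_iff)
  moreover have "(\<integral>y. f (Complex x y) / (w - Complex x y) \<partial>lborel) = - (\<integral>y. q (Complex x y) \<partial>lborel)"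
    unfolding integral_minus[symmetric] q_def by (simp add: minus_divide_right)
  ultimately show ?thesis by simp
qed

section \<open>The Hardy space of the half-plane\<close>

definition line_mean :: "(complex \<Rightarrow> complex) \<Rightarrow> real \<Rightarrow> real" where
  "line_mean F x = 1 / (2 * pi) * (\<integral>y. (cmod (F (Complex x y)))\<^sup>2 \<partial>lborel)"

definition line_inner :: "(complex \<Rightarrow> complex) \<Rightarrow> (complex \<Rightarrow> complex) \<Rightarrow> real \<Rightarrow> complex" where
  "line_inner F G x = 1 / (2 * pi) * (\<integral>y. F (Complex x y) * cnj (G (Complex x y)) \<partial>lborel)"

lemma line_mean_nonneg: "0 \<le> line_mean F x"
  unfolding line_mean_def by (intro mult_nonneg_nonneg integral_nonneg_AE) auto

lemma hardy2_holomorphic: "F \<in> hardy2 \<Longrightarrow> F holomorphic_on {z. Re z > 0}"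
  by (simp add: hardy2_def half_plane_def)

lemma hardy2_outside: "F \<in> hardy2 \<Longrightarrow> Re z \<le> 0 \<Longrightarrow> F z = 0"
  by (simp add: hardy2_def half_plane_def)

lemma hardy2_integrable:
  "F \<in> hardy2 \<Longrightarrow> 0 < x \<Longrightarrow> integrable lborel (\<lambda>y. (cmod (F (Complex x y)))\<^sup>2)"
  by (simp add: hardy2_def)

lemma hardy2_measurable:
  "F \<in> hardy2 \<Longrightarrow> 0 < x \<Longrightarrow> (\<lambda>y. F (Complex x y)) \<in> borel_measurable borel"
  using vertical_line_measurable[OF hardy2_holomorphic] by blast

lemma sqrt_line_mean_le: "F \<in> hardy2 \<Longrightarrow> 0 < x \<Longrightarrow> sqrt (line_mean F x) \<le> hardy2_norm F"
  unfolding hardy2_norm_def line_mean_def by (intro cSUP_upper) (auto simp: hardy2_def)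

lemma hardy2_norm_nonneg: "F \<in> hardy2 \<Longrightarrow> 0 \<le> hardy2_norm F"
  using sqrt_line_mean_le[of F 1] real_sqrt_ge_zero[OF line_mean_nonneg[of F 1]] by linarith

lemma line_mean_le: "F \<in> hardy2 \<Longrightarrow> 0 < x \<Longrightarrow> line_mean F x \<le> (hardy2_norm F)\<^sup>2"
  using sqrt_line_mean_le sqrt_le_D by blast

lemma hardy2_integral_le:
  "F \<in> hardy2 \<Longrightarrow> 0 < x \<Longrightarrow> (\<integral>y. (cmod (F (Complex x y)))\<^sup>2 \<partial>lborel) \<le> 2 * pi * (hardy2_norm F)\<^sup>2"
  using line_mean_le[of F x] by (simp add: line_mean_def field_simps)

lemma hardy2_norm_sq_le:
  assumes "\<And>x. 0 < x \<Longrightarrow> line_mean F x \<le> C" "F \<in> hardy2"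
  shows "(hardy2_norm F)\<^sup>2 \<le> C"
proof -
  have "hardy2_norm F \<le> sqrt C"
    unfolding hardy2_norm_def by (rule cSUP_least) (use assms(1) in \<open>auto simp: line_mean_def\<close>)
  then show ?thesis using hardy2_norm_nonneg[OF assms(2)]
    by (metis real_sqrt_ge_0_iff order_trans real_sqrt_le_iff real_sqrt_unique)
qed

lemma hardy2I:
  assumes "F holomorphic_on {z. Re z > 0}" "\<And>z. Re z \<le> 0 \<Longrightarrow> F z = 0"
    and "\<And>x. 0 < x \<Longrightarrow> integrable lborel (\<lambda>y. (cmod (F (Complex x y)))\<^sup>2)"
    and "\<And>x. 0 < x \<Longrightarrow> line_mean F x \<le> C"
  shows "F \<in> hardy2"
  using assms unfolding hardy2_def half_plane_def
  by (auto simp: line_mean_def intro!: bdd_aboveI2[where M="sqrt C"])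

lemma hardy2_cmult:
  assumes F: "F \<in> hardy2"
  shows "(\<lambda>z. c * F z) \<in> hardy2" and "hardy2_norm (\<lambda>z. c * F z) = cmod c * hardy2_norm F"
proof -
  have mean: "line_mean (\<lambda>z. c * F z) x = (cmod c)\<^sup>2 * line_mean F x" for c F x
    by (simp add: line_mean_def norm_mult power_mult_distrib)
  have mem: "(\<lambda>z. c * F z) \<in> hardy2" if "F \<in> hardy2" for c F
    by (rule hardy2I[where C="(cmod c)\<^sup>2 * (hardy2_norm F)\<^sup>2"])
      (use hardy2_holomorphic[OF that] hardy2_outside[OF that] hardy2_integrable[OF that] line_mean_le[OF that]
        in \<open>auto intro!: holomorphic_intros mult_left_mono simp: norm_mult power_mult_distrib mean\<close>)
  show "(\<lambda>z. c * F z) \<in> hardy2" by (rule mem[OF F])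
  have le: "hardy2_norm (\<lambda>z. c * F z) \<le> cmod c * hardy2_norm F" if F: "F \<in> hardy2" for c F
  proof -
    have "(hardy2_norm (\<lambda>z. c * F z))\<^sup>2 \<le> (cmod c * hardy2_norm F)\<^sup>2"
      by (rule hardy2_norm_sq_le[OF _ mem[OF F]])
        (simp add: mean power_mult_distrib mult_left_mono line_mean_le F)
    then show ?thesis by (rule power2_le_imp_le) (simp add: hardy2_norm_nonneg F)
  qed
  show "hardy2_norm (\<lambda>z. c * F z) = cmod c * hardy2_norm F"
  proof (cases "c = 0")
    case True
    then show ?thesis by (simp add: hardy2_norm_def)
  next
    case False
    have "hardy2_norm F \<le> cmod (1 / c) * hardy2_norm (\<lambda>z. c * F z)"
      using le[OF mem[OF F, of c], of "1 / c"] False by simp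
    with le[OF F, of c] False show ?thesis by (simp add: norm_divide field_simps)
  qed
qed

lemma hardy2_add:
  assumes F: "F \<in> hardy2" and G: "G \<in> hardy2"
  shows "(\<lambda>z. F z + G z) \<in> hardy2"
proof -
  have sq: "(cmod (a + b))\<^sup>2 \<le> 2 * (cmod a)\<^sup>2 + 2 * (cmod b)\<^sup>2" for a b :: complex
  proof -
    have "(p + q)\<^sup>2 \<le> 2 * p\<^sup>2 + 2 * q\<^sup>2" for p q :: real
      using zero_le_power2[of "p - q"] by (simp add: power2_eq_square algebra_simps)
    from this[of "Re a" "Re b"] this[of "Im a" "Im b"] show ?thesis unfolding cmod_power2 by simp
  qed
  have i: "integrable lborel (\<lambda>y. 2 * (cmod (F (Complex x y)))\<^sup>2 + 2 * (cmod (G (Complex x y)))\<^sup>2)" if "0 < x" for x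
    by (auto intro!: hardy2_integrable F G that)
  have i': "integrable lborel (\<lambda>y. (cmod (F (Complex x y) + G (Complex x y)))\<^sup>2)" if "0 < x" for x
    by (rule Bochner_Integration.integrable_bound[OF i[OF that]])
      (use hardy2_measurable[OF F that] hardy2_measurable[OF G that] in \<open>auto intro!: sq\<close>)
  show ?thesis
  proof (rule hardy2I[where C="2 * (hardy2_norm F)\<^sup>2 + 2 * (hardy2_norm G)\<^sup>2"])
    fix x :: real assume x: "0 < x"
    show "integrable lborel (\<lambda>y. (cmod (F (Complex x y) + G (Complex x y)))\<^sup>2)" by (rule i'[OF x])
    have "(\<integral>y. (cmod (F (Complex x y) + G (Complex x y)))\<^sup>2 \<partial>lborel) \<le>
       (\<integral>y. 2 * (cmod (F (Complex x y)))\<^sup>2 + 2 * (cmod (G (Complex x y)))\<^sup>2 \<partial>lborel)"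
      by (intro integral_mono i i' x sq)
    also have "... = 2 * (\<integral>y. (cmod (F (Complex x y)))\<^sup>2 \<partial>lborel) + 2 * (\<integral>y. (cmod (G (Complex x y)))\<^sup>2 \<partial>lborel)"
      by (subst Bochner_Integration.integral_add) (auto intro!: hardy2_integrable F G x)
    finally have "line_mean (\<lambda>z. F z + G z) x \<le> 2 * line_mean F x + 2 * line_mean G x"
      by (simp add: line_mean_def field_simps)
    then show "line_mean (\<lambda>z. F z + G z) x \<le> 2 * (hardy2_norm F)\<^sup>2 + 2 * (hardy2_norm G)\<^sup>2"
      using line_mean_le[OF F x] line_mean_le[OF G x] by linarith
  qed (use hardy2_holomorphic[OF F] hardy2_holomorphic[OF G] hardy2_outside[OF F] hardy2_outside[OF G]
      in \<open>auto intro!: holomorphic_intros\<close>)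
qed

lemma hardy2_zero: "(\<lambda>_. 0) \<in> hardy2" "hardy2_norm (\<lambda>_. 0) = 0"
  by (auto intro!: hardy2I[where C=0] simp: line_mean_def) (simp add: hardy2_norm_def)

lemma hardy2_diff:
  assumes F: "F \<in> hardy2" and G: "G \<in> hardy2"
  shows "(\<lambda>z. F z - G z) \<in> hardy2"
  using hardy2_add[OF F hardy2_cmult(1)[OF G, of "-1"]] by simp

lemma hardy2_sum:
  assumes "finite A" "\<And>a. a \<in> A \<Longrightarrow> F a \<in> hardy2"
  shows "(\<lambda>z. \<Sum>a\<in>A. F a z) \<in> hardy2"
  using assms by (induction A rule: finite_induct) (auto simp: hardy2_zero hardy2_add)

lemma poisson_half_plane:
  assumes F: "F \<in> hardy2" and x: "0 < x" and h: "0 < h"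
  shows "F (Complex (x + h) y) = (\<integral>s. of_real (h / pi * (1 / (h\<^sup>2 + (s - y)\<^sup>2))) * F (Complex x s) \<partial>lborel)"
proof -
  define w where "w = Complex (x + h) y"
  define w' where "w' = Complex (x - h) y"
  have ww: "w - w' = 2 * of_real h" by (simp add: w_def w'_def complex_eq_iff)
  define f where "f \<zeta> = F \<zeta> * ((w - w') / (\<zeta> - w'))" for \<zeta>
  define x0 where "x0 = max 0 (x - h)"
  have ne: "\<zeta> - w' \<noteq> 0" if "x0 < Re \<zeta>" for \<zeta> using that by (auto simp: x0_def w'_def)
  have hol: "f holomorphic_on {z. Re z > x0}"
    unfolding f_def by (intro holomorphic_intros holomorphic_on_subset[OF hardy2_holomorphic[OF F]])
      (use ne in \<open>auto simp: x0_def\<close>)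
  have fb: "(cmod (f (Complex u s)))\<^sup>2 \<le> 4 * (cmod (F (Complex u s)))\<^sup>2" if "x \<le> u" for u s
  proof -
    have "h \<le> cmod (Complex u s - w')"
      using complex_Re_le_cmod[of "Complex u s - w'"] that by (simp add: w'_def)
    moreover have "cmod (w - w') = 2 * h" using h unfolding ww by (simp add: norm_mult)
    ultimately have "cmod ((w - w') / (Complex u s - w')) \<le> 2" using h by (simp add: norm_divide divide_le_eq)
    then have "cmod (f (Complex u s)) \<le> cmod (F (Complex u s)) * 2"
      unfolding f_def norm_mult by (intro mult_left_mono) auto
    then have "(cmod (f (Complex u s)))\<^sup>2 \<le> (cmod (F (Complex u s)) * 2)\<^sup>2" by (intro power_mono) auto
    then show ?thesis by (simp add: power_mult_distrib)
  qed
  have fm: "(\<lambda>s. f (Complex u s)) \<in> borel_measurable borel" if "x \<le> u" for u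
    using vertical_line_measurable[OF hol, of u] that x h by (simp add: x0_def)
  have int: "integrable lborel (\<lambda>s. (cmod (f (Complex u s)))\<^sup>2)" if "x \<le> u" for u
    by (rule Bochner_Integration.integrable_bound[of _ "\<lambda>s. 4 * (cmod (F (Complex u s)))\<^sup>2"])
      (use fm[OF that] fb[OF that] x that in \<open>auto intro!: hardy2_integrable F\<close>)
  have bd: "(\<integral>s. (cmod (f (Complex u s)))\<^sup>2 \<partial>lborel) \<le> 4 * (2 * pi * (hardy2_norm F)\<^sup>2)" if "x \<le> u" for u
  proof -
    have "(\<integral>s. (cmod (f (Complex u s)))\<^sup>2 \<partial>lborel) \<le> (\<integral>s. 4 * (cmod (F (Complex u s)))\<^sup>2 \<partial>lborel)"
      by (intro integral_mono int fb) (use x that in \<open>auto intro!: hardy2_integrable F\<close>)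
    then show ?thesis using hardy2_integral_le[OF F, of u] x that by simp
  qed
  have "(\<integral>s. f (Complex x s) / (w - Complex x s) \<partial>lborel) = 2 * pi * f w"
    by (rule cauchy_vertical_line[OF hol _ _ int bd]) (use x h in \<open>auto simp: x0_def w_def\<close>)
  moreover have "f w = F w" using h by (auto simp: f_def w_def w'_def complex_eq_iff)
  moreover have "f (Complex x s) / (w - Complex x s) = 2 * pi * (of_real (h / pi * (1 / (h\<^sup>2 + (s - y)\<^sup>2))) * F (Complex x s))" for s
  proof -
    note ww
    moreover have "(Complex x s - w') * (w - Complex x s) = of_real (h\<^sup>2 + (s - y)\<^sup>2)"
      by (simp add: w_def w'_def complex_eq_iff power2_eq_square algebra_simps)
    ultimately have "f (Complex x s) / (w - Complex x s) = F (Complex x s) * (2 * of_real h) / of_real (h\<^sup>2 + (s - y)\<^sup>2)"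
      unfolding f_def by (metis divide_divide_eq_left times_divide_eq_right)
    then show ?thesis by simp
  qed
  ultimately have "2 * pi * (\<integral>s. of_real (h / pi * (1 / (h\<^sup>2 + (s - y)\<^sup>2))) * F (Complex x s) \<partial>lborel) = 2 * pi * F w"
    by (simp only: integral_mult_right_zero)
  then show ?thesis by (simp add: w_def)
qed

lemma line_mean_antimono:
  assumes F: "F \<in> hardy2" and x: "0 < x" and h: "0 < h"
  shows "line_mean F (x + h) \<le> line_mean F x"
proof -
  define P where "P t = h / pi * (1 / (h\<^sup>2 + t\<^sup>2))" for t
  have "1 / (h\<^sup>2 + t\<^sup>2) \<le> 1 / h\<^sup>2" for t
    by (intro divide_left_mono) (use h in \<open>auto intro!: mult_pos_pos add_pos_nonneg\<close>)
  moreover define c where "c = h / pi * (1 / h\<^sup>2)"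
  ultimately have Ppos: "0 \<le> P t" and Ple: "P t \<le> c" for t
    unfolding P_def c_def by (intro mult_nonneg_nonneg mult_left_mono; use h in simp)+
  then have c0: "0 \<le> c" by (rule order_trans)
  have Pi: "integrable lborel (\<lambda>s. P (s - y))" "(\<integral>s. P (s - y) \<partial>lborel) = 1" for y
    unfolding P_def integral_mult_right_zero integrable_cauchy_density(2)[OF less_imp_neq[OF h, symmetric]]
    by (intro integrable_mult_right integrable_cauchy_density) (use h in auto)
  have Pc: "continuous_on UNIV P"
    unfolding P_def by (intro continuous_intros) (use h in \<open>auto simp: add_pos_nonneg less_imp_neq\<close>)
  have Pm[measurable]: "P \<in> borel_measurable borel" by (rule borel_measurable_continuous_onI[OF Pc])
  have Fm[measurable]: "(\<lambda>s. F (Complex x s)) \<in> borel_measurable borel" by (rule hardy2_measurable[OF F x])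
  have Fh[measurable]: "(\<lambda>s. F (Complex (x + h) s)) \<in> borel_measurable borel"
    by (rule hardy2_measurable[OF F]) (use x h in auto)
  have jensen: "ennreal ((cmod (F (Complex (x + h) y)))\<^sup>2) \<le> (\<integral>\<^sup>+s. ennreal (P (s - y) * (cmod (F (Complex x s)))\<^sup>2) \<partial>lborel)" for y
  proof -
    let ?c = "F (Complex (x + h) y)"
    have i1: "integrable lborel (\<lambda>s. of_real (P (s - y)) * F (Complex x s))"
    proof -
      have "integrable lborel (\<lambda>s. c * P (s - y))" using Pi by simp
      then have "integrable lborel (\<lambda>s. (cmod (of_real (P (s - y))))\<^sup>2)"
        by (rule Bochner_Integration.integrable_bound)
          (auto simp: power2_eq_square Ppos abs_mult c0 intro!: mult_right_mono Ple)
      then show ?thesis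
        using integrable_mult_L2(1)[of "\<lambda>s. of_real (P (s - y))" lborel, OF _ _ _ hardy2_integrable[OF F x]] by simp
    qed
    have i2: "integrable lborel (\<lambda>s. P (s - y) * (cmod (F (Complex x s)))\<^sup>2)"
      by (rule Bochner_Integration.integrable_bound[of _ "\<lambda>s. c * (cmod (F (Complex x s)))\<^sup>2"])
        (auto simp: abs_mult Ppos c0 intro!: mult_right_mono hardy2_integrable[OF F x] Ple)
    have c: "(\<integral>s. of_real (P (s - y)) * F (Complex x s) \<partial>lborel) = ?c"
      using poisson_half_plane[OF F x h, of y] by (simp add: P_def)
    define r where "r s = Re (cnj ?c * (of_real (P (s - y)) * F (Complex x s)))" for s
    have i3: "integrable lborel r"
      unfolding r_def by (intro integrable_Re integrable_mult_right i1)
    have e3: "(\<integral>s. r s \<partial>lborel) = Re (cnj ?c * ?c)"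
      unfolding r_def by (subst integral_Re[OF integrable_mult_right[OF i1]]) (simp only: integral_mult_right_zero c)
    have "0 \<le> (\<integral>s. P (s - y) * (cmod (F (Complex x s) - ?c))\<^sup>2 \<partial>lborel)"
      by (intro integral_nonneg_AE AE_I2 mult_nonneg_nonneg Ppos) auto
    also have "... = (\<integral>s. P (s - y) * (cmod (F (Complex x s)))\<^sup>2 - 2 * r s + (cmod ?c)\<^sup>2 * P (s - y) \<partial>lborel)"
      unfolding cmod_power2 r_def
      by (intro Bochner_Integration.integral_cong refl) (simp add: power2_eq_square algebra_simps)
    also have "... = (\<integral>s. P (s - y) * (cmod (F (Complex x s)))\<^sup>2 \<partial>lborel) - 2 * Re (cnj ?c * ?c) + (cmod ?c)\<^sup>2"
      unfolding e3[symmetric] using i2 i3 Pi by simp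
    also have "Re (cnj ?c * ?c) = (cmod ?c)\<^sup>2" unfolding cmod_power2 by (simp add: power2_eq_square)
    finally have "(cmod ?c)\<^sup>2 \<le> (\<integral>s. P (s - y) * (cmod (F (Complex x s)))\<^sup>2 \<partial>lborel)" by simp
    then show ?thesis using nn_integral_eq_integral[OF i2] Ppos by (simp add: ennreal_leI)
  qed
  have "ennreal (\<integral>y. (cmod (F (Complex (x + h) y)))\<^sup>2 \<partial>lborel) = (\<integral>\<^sup>+y. ennreal ((cmod (F (Complex (x + h) y)))\<^sup>2) \<partial>lborel)"
    by (rule nn_integral_eq_integral[symmetric]) (use x h in \<open>auto intro!: hardy2_integrable F\<close>)
  also have "... \<le> (\<integral>\<^sup>+y. (\<integral>\<^sup>+s. ennreal (P (s - y) * (cmod (F (Complex x s)))\<^sup>2) \<partial>lborel) \<partial>lborel)"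
    by (intro nn_integral_mono jensen)
  also have "... = (\<integral>\<^sup>+s. (\<integral>\<^sup>+y. ennreal (P (s - y) * (cmod (F (Complex x s)))\<^sup>2) \<partial>lborel) \<partial>lborel)"
    by (rule lborel_pair.Fubini') measurable
  also have "... = (\<integral>\<^sup>+s. ennreal ((cmod (F (Complex x s)))\<^sup>2) \<partial>lborel)"
  proof (intro nn_integral_cong)
    fix s :: real
    have "(\<integral>\<^sup>+y. ennreal (P (y - s)) \<partial>lborel) = 1"
      using nn_integral_eq_integral[OF Pi(1)[of s]] Pi(2)[of s] Ppos by simp
    moreover have "P (s - y) = P (y - s)" for y by (simp add: P_def power2_commute)
    ultimately show "(\<integral>\<^sup>+y. ennreal (P (s - y) * (cmod (F (Complex x s)))\<^sup>2) \<partial>lborel) = ennreal ((cmod (F (Complex x s)))\<^sup>2)"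
      by (simp add: ennreal_mult Ppos nn_integral_multc)
  qed
  also have "... = ennreal (\<integral>y. (cmod (F (Complex x y)))\<^sup>2 \<partial>lborel)"
    by (rule nn_integral_eq_integral) (auto intro!: hardy2_integrable F x)
  finally have "(\<integral>y. (cmod (F (Complex (x + h) y)))\<^sup>2 \<partial>lborel) \<le> (\<integral>y. (cmod (F (Complex x y)))\<^sup>2 \<partial>lborel)"
    by (subst (asm) ennreal_le_iff) (auto intro!: integral_nonneg_AE)
  then show ?thesis by (simp add: line_mean_def divide_right_mono)
qed

lemma line_mean_tendsto:
  assumes F: "F \<in> hardy2"
  shows "(line_mean F \<longlongrightarrow> (hardy2_norm F)\<^sup>2) (at_right 0)"
proof (rule order_tendstoI)
  fix a assume a: "a < (hardy2_norm F)\<^sup>2"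
  then obtain x where x: "0 < x" "a < line_mean F x"
    using hardy2_norm_sq_le[OF _ F, of a] by (meson not_le)
  have "a < line_mean F u" if "0 < u" "u < x" for u
    using line_mean_antimono[OF F that(1), of "x - u"] that x by simp
  then show "\<forall>\<^sub>F u in at_right 0. a < line_mean F u"
    using x(1) unfolding eventually_at_right_field by blast
next
  fix a assume "(hardy2_norm F)\<^sup>2 < a"
  then have "line_mean F u < a" if "0 < u" for u using line_mean_le[OF F that] by simp
  then show "\<forall>\<^sub>F u in at_right 0. line_mean F u < a"
    by (simp add: eventually_at_filter)
qed

lemma polarization_line:
  assumes F: "F \<in> hardy2" and G: "G \<in> hardy2" and x: "0 < x"
  shows "line_inner F G x = (of_real (line_mean (\<lambda>z. F z + G z) x) - of_real (line_mean (\<lambda>z. F z - G z) x)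
      + \<i> * of_real (line_mean (\<lambda>z. F z + \<i> * G z) x) - \<i> * of_real (line_mean (\<lambda>z. F z - \<i> * G z) x)) / 4"
proof -
  have pol: "a * cnj b = (of_real ((cmod (a + b))\<^sup>2) - of_real ((cmod (a - b))\<^sup>2)
      + \<i> * of_real ((cmod (a + \<i> * b))\<^sup>2) - \<i> * of_real ((cmod (a - \<i> * b))\<^sup>2)) / 4" for a b
    unfolding cmod_power2 by (simp add: complex_eq_iff power2_eq_square algebra_simps)
  have "(\<integral>y. F (Complex x y) * cnj (G (Complex x y)) \<partial>lborel) =
     (\<integral>y. (of_real ((cmod (F (Complex x y) + G (Complex x y)))\<^sup>2) - of_real ((cmod (F (Complex x y) - G (Complex x y)))\<^sup>2)
      + \<i> * of_real ((cmod (F (Complex x y) + \<i> * G (Complex x y)))\<^sup>2)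
      - \<i> * of_real ((cmod (F (Complex x y) - \<i> * G (Complex x y)))\<^sup>2)) / 4 \<partial>lborel)"
    by (intro Bochner_Integration.integral_cong refl pol)
  also have "... = (of_real (2 * pi * line_mean (\<lambda>z. F z + G z) x) - of_real (2 * pi * line_mean (\<lambda>z. F z - G z) x)
      + \<i> * of_real (2 * pi * line_mean (\<lambda>z. F z + \<i> * G z) x) - \<i> * of_real (2 * pi * line_mean (\<lambda>z. F z - \<i> * G z) x)) / 4"
  proof -
    have ii: "integrable lborel (\<lambda>y. complex_of_real ((cmod (H (Complex x y)))\<^sup>2))" if "H \<in> hardy2" for H
      by (intro integrable_of_real hardy2_integrable that x)
    have o: "of_real (2 * pi * line_mean H x) = (\<integral>y. complex_of_real ((cmod (H (Complex x y)))\<^sup>2) \<partial>lborel)" for H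
      by (simp add: line_mean_def del: of_real_power)
    show ?thesis
      unfolding o
      using ii[OF hardy2_add[OF F G]] ii[OF hardy2_diff[OF F G]]
        ii[OF hardy2_add[OF F hardy2_cmult(1)[OF G, of \<i>]]] ii[OF hardy2_diff[OF F hardy2_cmult(1)[OF G, of \<i>]]]
      by (simp del: integral_complex_of_real of_real_power)
  qed
  also have "... = 2 * pi * ((of_real (line_mean (\<lambda>z. F z + G z) x) - of_real (line_mean (\<lambda>z. F z - G z) x)
      + \<i> * of_real (line_mean (\<lambda>z. F z + \<i> * G z) x) - \<i> * of_real (line_mean (\<lambda>z. F z - \<i> * G z) x)) / 4)"
    by (simp add: algebra_simps)
  finally have e: "(\<integral>y. F (Complex x y) * cnj (G (Complex x y)) \<partial>lborel) = ..." .
  show ?thesis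
    unfolding line_inner_def e by simp
qed

lemma hardy2_inner_tendsto:
  assumes F: "F \<in> hardy2" and G: "G \<in> hardy2"
  shows "(line_inner F G \<longlongrightarrow> hardy2_inner F G) (at_right 0)"
proof -
  have "((\<lambda>x. (of_real (line_mean (\<lambda>z. F z + G z) x) - of_real (line_mean (\<lambda>z. F z - G z) x)
      + \<i> * of_real (line_mean (\<lambda>z. F z + \<i> * G z) x) - \<i> * of_real (line_mean (\<lambda>z. F z - \<i> * G z) x)) / 4)
      \<longlongrightarrow> hardy2_inner F G) (at_right 0)"
    unfolding hardy2_inner_def
    by (intro tendsto_intros line_mean_tendsto hardy2_add hardy2_diff hardy2_cmult F G) simp
  then show ?thesis
    by (rule Lim_transform_eventually) (simp add: eventually_at_filter polarization_line[OF F G])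
qed

lemma cnj_measurable: "cnj \<in> borel_measurable borel"
  by (intro borel_measurable_continuous_onI continuous_intros)

lemma hardy2_inner_self:
  assumes F: "F \<in> hardy2"
  shows "hardy2_inner F F = of_real ((hardy2_norm F)\<^sup>2)"
proof -
  have "line_inner F F x = of_real (line_mean F x)" for x
    unfolding line_inner_def line_mean_def complex_norm_square[symmetric]
    by (simp del: of_real_power)
  then have "(line_inner F F \<longlongrightarrow> of_real ((hardy2_norm F)\<^sup>2)) (at_right 0)"
    using tendsto_of_real[OF line_mean_tendsto[OF F], where 'a=complex] by presburger
  with hardy2_inner_tendsto[OF F F] show ?thesis
    by (intro tendsto_unique[of "at_right (0::real)"]) auto
qed

lemma hardy2_inner_commute:
  assumes F: "F \<in> hardy2" and G: "G \<in> hardy2"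
  shows "hardy2_inner G F = cnj (hardy2_inner F G)"
proof -
  have "line_inner G F x = cnj (line_inner F G x)" for x
  proof -
    have "(\<integral>y. G (Complex x y) * cnj (F (Complex x y)) \<partial>lborel)
        = (\<integral>y. cnj (F (Complex x y) * cnj (G (Complex x y))) \<partial>lborel)"
      by (simp add: mult.commute)
    also have "... = cnj (\<integral>y. F (Complex x y) * cnj (G (Complex x y)) \<partial>lborel)" by (rule Bochner_Integration.integral_cnj)
    finally have e: "(\<integral>y. G (Complex x y) * cnj (F (Complex x y)) \<partial>lborel) = ..." .
    show ?thesis unfolding line_inner_def e by simp
  qed
  then have "(line_inner G F \<longlongrightarrow> cnj (hardy2_inner F G)) (at_right 0)"
    using tendsto_cnj[OF hardy2_inner_tendsto[OF F G]] by presburger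
  with hardy2_inner_tendsto[OF G F] show ?thesis
    by (intro tendsto_unique[of "at_right (0::real)"]) auto
qed

lemma hardy2_Cauchy_Schwarz:
  assumes F: "F \<in> hardy2" and G: "G \<in> hardy2"
  shows "cmod (hardy2_inner F G) \<le> hardy2_norm F * hardy2_norm G"
proof (rule tendsto_upperbound[of "\<lambda>x. cmod (line_inner F G x)" _ "at_right (0::real)"])
  show "((\<lambda>x. cmod (line_inner F G x)) \<longlongrightarrow> cmod (hardy2_inner F G)) (at_right 0)"
    by (intro tendsto_intros hardy2_inner_tendsto F G)
  have "cmod (line_inner F G x) \<le> hardy2_norm F * hardy2_norm G" if x: "0 < x" for x
  proof -
    have m: "(\<lambda>y. F (Complex x y)) \<in> borel_measurable lborel" "(\<lambda>y. cnj (G (Complex x y))) \<in> borel_measurable lborel"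
      using hardy2_measurable[OF F x] measurable_compose[OF hardy2_measurable[OF G x] cnj_measurable] by auto
    have "(cmod (\<integral>y. F (Complex x y) * cnj (G (Complex x y)) \<partial>lborel))\<^sup>2
        \<le> (\<integral>y. (cmod (F (Complex x y)))\<^sup>2 \<partial>lborel) * (\<integral>y. (cmod (G (Complex x y)))\<^sup>2 \<partial>lborel)"
      using integrable_mult_L2(2)[OF m hardy2_integrable[OF F x]] hardy2_integrable[OF G x] by simp
    then have "(cmod (line_inner F G x))\<^sup>2 \<le> line_mean F x * line_mean G x"
      by (simp add: line_inner_def line_mean_def norm_divide power_divide field_simps power2_eq_square)
    also have "... \<le> (hardy2_norm F * hardy2_norm G)\<^sup>2"
      unfolding power_mult_distrib by (intro mult_mono line_mean_le F G x line_mean_nonneg) auto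
    finally show ?thesis by (rule power2_le_imp_le) (simp add: hardy2_norm_nonneg F G)
  qed
  then show "\<forall>\<^sub>F x in at_right 0. cmod (line_inner F G x) \<le> hardy2_norm F * hardy2_norm G"
    by (simp add: eventually_at_filter)
qed simp

definition szego :: "complex \<Rightarrow> complex \<Rightarrow> complex" where
  "szego w z = (if z \<in> half_plane then 1 / (z + cnj w) else 0)"

lemma szego_in_hardy2:
  assumes w: "w \<in> half_plane"
  shows "szego w \<in> hardy2"
proof (rule hardy2I[where C="1 / (2 * pi) * (pi / Re w)"])
  have w0: "0 < Re w" using w by (simp add: half_plane_def)
  have eq: "szego w (Complex x y) = 1 / (Complex x y - (- cnj w))" if "0 < x" for x y
    using that by (simp add: szego_def half_plane_def)
  show "szego w holomorphic_on {z. 0 < Re z}"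
    by (rule holomorphic_transform[of "\<lambda>z. 1 / (z + cnj w)"])
      (use w0 in \<open>auto simp: szego_def half_plane_def complex_eq_iff intro!: holomorphic_intros\<close>)
  fix x :: real assume x: "0 < x"
  have ne: "x \<noteq> Re (- cnj w)" using x w0 by simp
  show "integrable lborel (\<lambda>y. (cmod (szego w (Complex x y)))\<^sup>2)"
    unfolding eq[OF x] by (rule cauchy_kernel_line(2)[OF ne])
  have "pi / \<bar>x - Re (- cnj w)\<bar> \<le> pi / Re w"
    using x w0 by (intro divide_left_mono) auto
  then show "line_mean (szego w) x \<le> 1 / (2 * pi) * (pi / Re w)"
    unfolding line_mean_def eq[OF x] cauchy_kernel_line(3)[OF ne] by (intro mult_left_mono) auto
qed (auto simp: szego_def half_plane_def)

lemma hardy2_inner_szego: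
  assumes F: "F \<in> hardy2" and w: "w \<in> half_plane"
  shows "hardy2_inner F (szego w) = F w"
proof -
  have w0: "0 < Re w" using w by (simp add: half_plane_def)
  have "line_inner F (szego w) x = F (w + of_real (2 * x))" if x: "0 < x" for x
  proof -
    have "F (Complex x y) * cnj (szego w (Complex x y)) = F (Complex x y) / (w + of_real (2 * x) - Complex x y)" for y
    proof -
      have "cnj (Complex x y + cnj w) = w + of_real (2 * x) - Complex x y" by (simp add: complex_eq_iff)
      then show ?thesis using x by (simp add: szego_def half_plane_def)
    qed
    moreover have "(\<integral>y. F (Complex x y) / (w + of_real (2 * x) - Complex x y) \<partial>lborel) = 2 * pi * F (w + of_real (2 * x))"
      by (rule cauchy_vertical_line[OF hardy2_holomorphic[OF F] x _ hardy2_integrable[OF F] hardy2_integral_le[OF F]])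
        (use x w0 in auto)
    ultimately show ?thesis by (simp add: line_inner_def)
  qed
  moreover have "((\<lambda>x. F (w + of_real (2 * x))) \<longlongrightarrow> F (w + of_real (2 * 0))) (at_right 0)"
  proof (rule isCont_tendsto_compose[of _ F])
    have "continuous_on half_plane F" using F by (auto simp: hardy2_def intro: holomorphic_on_imp_continuous_on)
    then show "isCont F (w + of_real (2 * 0))"
      using w by (auto simp: continuous_on_eq_continuous_at half_plane_def open_halfspace_Re_gt)
    show "((\<lambda>x. w + of_real (2 * x)) \<longlongrightarrow> w + of_real (2 * 0)) (at_right 0)"
      by (intro tendsto_intros)
  qed
  ultimately have "(line_inner F (szego w) \<longlongrightarrow> F w) (at_right 0)"
    by (subst Lim_cong_within[OF refl refl refl]) (auto simp: at_within_def)
  with hardy2_inner_tendsto[OF F szego_in_hardy2[OF w]] show ?thesis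
    by (intro tendsto_unique[of "at_right (0::real)"]) auto
qed

lemma hardy2_norm_szego:
  assumes w: "w \<in> half_plane"
  shows "(hardy2_norm (szego w))\<^sup>2 = 1 / (2 * Re w)"
proof -
  have "complex_of_real ((hardy2_norm (szego w))\<^sup>2) = szego w w"
    using hardy2_inner_self[OF szego_in_hardy2[OF w]] hardy2_inner_szego[OF szego_in_hardy2[OF w] w] by simp
  also have "... = of_real (1 / (2 * Re w))"
  proof -
    have "w + cnj w = of_real (2 * Re w)" by (simp add: complex_eq_iff)
    then show ?thesis using w by (simp add: szego_def)
  qed
  finally show ?thesis by (simp only: of_real_eq_iff)
qed

lemma hardy2_point_bound:
  assumes F: "F \<in> hardy2" and w: "w \<in> half_plane"
  shows "cmod (F w) \<le> hardy2_norm F / sqrt (2 * Re w)"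
proof -
  have "hardy2_norm (szego w) = sqrt (1 / (2 * Re w))"
    using hardy2_norm_szego[OF w] hardy2_norm_nonneg[OF szego_in_hardy2[OF w]] real_sqrt_unique by metis
  then show ?thesis
    using hardy2_Cauchy_Schwarz[OF F szego_in_hardy2[OF w]] hardy2_inner_szego[OF F w]
    by (simp add: real_sqrt_divide)
qed

lemma hardy2_parallelogram:
  assumes F: "F \<in> hardy2" and G: "G \<in> hardy2"
  shows "(hardy2_norm (\<lambda>z. F z + G z))\<^sup>2 + (hardy2_norm (\<lambda>z. F z - G z))\<^sup>2
    = 2 * (hardy2_norm F)\<^sup>2 + 2 * (hardy2_norm G)\<^sup>2"
proof -
  have pl: "(cmod (a + b))\<^sup>2 + (cmod (a - b))\<^sup>2 = 2 * (cmod a)\<^sup>2 + 2 * (cmod b)\<^sup>2" for a b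
    unfolding cmod_power2 by (simp add: power2_eq_square algebra_simps)
  have eq: "line_mean (\<lambda>z. F z + G z) x + line_mean (\<lambda>z. F z - G z) x = 2 * line_mean F x + 2 * line_mean G x"
    if x: "0 < x" for x
  proof -
    note i = hardy2_integrable[OF hardy2_add[OF F G] x] hardy2_integrable[OF hardy2_diff[OF F G] x]
      hardy2_integrable[OF F x] hardy2_integrable[OF G x]
    have "(\<integral>y. (cmod (F (Complex x y) + G (Complex x y)))\<^sup>2 \<partial>lborel) + (\<integral>y. (cmod (F (Complex x y) - G (Complex x y)))\<^sup>2 \<partial>lborel)
       = (\<integral>y. (cmod (F (Complex x y) + G (Complex x y)))\<^sup>2 + (cmod (F (Complex x y) - G (Complex x y)))\<^sup>2 \<partial>lborel)"
      using i by simp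
    also have "... = 2 * (\<integral>y. (cmod (F (Complex x y)))\<^sup>2 \<partial>lborel) + 2 * (\<integral>y. (cmod (G (Complex x y)))\<^sup>2 \<partial>lborel)"
      unfolding pl using i by simp
    finally show ?thesis by (simp add: line_mean_def field_simps)
  qed
  have "((\<lambda>x. line_mean (\<lambda>z. F z + G z) x + line_mean (\<lambda>z. F z - G z) x) \<longlongrightarrow>
     (hardy2_norm (\<lambda>z. F z + G z))\<^sup>2 + (hardy2_norm (\<lambda>z. F z - G z))\<^sup>2) (at_right 0)"
    by (intro tendsto_intros line_mean_tendsto hardy2_add hardy2_diff F G)
  moreover have "((\<lambda>x. 2 * line_mean F x + 2 * line_mean G x) \<longlongrightarrow> 2 * (hardy2_norm F)\<^sup>2 + 2 * (hardy2_norm G)\<^sup>2) (at_right 0)"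
    by (intro tendsto_intros line_mean_tendsto F G)
  then have "((\<lambda>x. line_mean (\<lambda>z. F z + G z) x + line_mean (\<lambda>z. F z - G z) x) \<longlongrightarrow>
     2 * (hardy2_norm F)\<^sup>2 + 2 * (hardy2_norm G)\<^sup>2) (at_right 0)"
    by (rule Lim_transform_eventually) (simp add: eventually_at_filter eq)
  ultimately show ?thesis by (intro tendsto_unique[of "at_right (0::real)"]) auto
qed

lemma hardy2_inner_add_left:
  assumes F: "F \<in> hardy2" and G: "G \<in> hardy2" and S: "S \<in> hardy2"
  shows "hardy2_inner (\<lambda>z. F z + G z) S = hardy2_inner F S + hardy2_inner G S"
proof -
  have eq: "line_inner F S x + line_inner G S x = line_inner (\<lambda>z. F z + G z) S x" if x: "0 < x" for x
  proof -
    have i: "integrable lborel (\<lambda>y. H (Complex x y) * cnj (S (Complex x y)))" if "H \<in> hardy2" for H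
    proof (rule integrable_mult_L2(1)[OF _ _ hardy2_integrable[OF that x]])
      show "(\<lambda>y. H (Complex x y)) \<in> borel_measurable lborel"
        "(\<lambda>y. cnj (S (Complex x y))) \<in> borel_measurable lborel"
        using hardy2_measurable[OF that x] measurable_compose[OF hardy2_measurable[OF S x] cnj_measurable] by auto
      show "integrable lborel (\<lambda>y. (cmod (cnj (S (Complex x y))))\<^sup>2)"
        unfolding complex_mod_cnj by (rule hardy2_integrable[OF S x])
    qed
    show ?thesis unfolding line_inner_def distrib_right
        Bochner_Integration.integral_add[OF i[OF F] i[OF G]] by (rule distrib_left[symmetric])
  qed
  have "((\<lambda>x. line_inner F S x + line_inner G S x) \<longlongrightarrow> hardy2_inner F S + hardy2_inner G S) (at_right 0)"
    by (intro tendsto_intros hardy2_inner_tendsto F G S)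
  then have "(line_inner (\<lambda>z. F z + G z) S \<longlongrightarrow> hardy2_inner F S + hardy2_inner G S) (at_right 0)"
    by (rule Lim_transform_eventually) (use eq in \<open>auto simp: eventually_at_filter\<close>)
  with hardy2_inner_tendsto[OF hardy2_add[OF F G] S] show ?thesis
    by (intro tendsto_unique[of "at_right (0::real)"]) auto
qed

lemma hardy2_triangle:
  assumes F: "F \<in> hardy2" and G: "G \<in> hardy2"
  shows "hardy2_norm (\<lambda>z. F z + G z) \<le> hardy2_norm F + hardy2_norm G"
proof -
  define S where "S = (\<lambda>z. F z + G z)"
  have S: "S \<in> hardy2" unfolding S_def by (rule hardy2_add[OF F G])
  have "(hardy2_norm S)\<^sup>2 = cmod (hardy2_inner S S)"
    unfolding hardy2_inner_self[OF S] norm_of_real by simp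
  also have "hardy2_inner S S = hardy2_inner F S + hardy2_inner G S"
    using hardy2_inner_add_left[OF F G S] by (simp flip: S_def)
  also have "cmod ... \<le> cmod (hardy2_inner F S) + cmod (hardy2_inner G S)"
    by (rule norm_triangle_ineq)
  also have "... \<le> (hardy2_norm F + hardy2_norm G) * hardy2_norm S"
    using hardy2_Cauchy_Schwarz[OF F S] hardy2_Cauchy_Schwarz[OF G S] by (simp add: distrib_right)
  finally have le: "hardy2_norm S * hardy2_norm S \<le> (hardy2_norm F + hardy2_norm G) * hardy2_norm S"
    by (simp add: power2_eq_square)
  have "hardy2_norm S \<le> hardy2_norm F + hardy2_norm G"
  proof (cases "hardy2_norm S = 0")
    case True
    then show ?thesis using hardy2_norm_nonneg[OF F] hardy2_norm_nonneg[OF G] by simp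
  next
    case False
    then have "0 < hardy2_norm S" using hardy2_norm_nonneg[OF S] by simp
    with le show ?thesis by (simp only: mult_le_cancel_right_pos)
  qed
  then show ?thesis by (simp add: S_def)
qed

lemma hardy2_inner_cmult_left:
  assumes F: "F \<in> hardy2" and S: "S \<in> hardy2"
  shows "hardy2_inner (\<lambda>z. c * F z) S = c * hardy2_inner F S"
proof -
  have eq: "c * line_inner F S x = line_inner (\<lambda>z. c * F z) S x" for x
    unfolding line_inner_def mult.assoc Bochner_Integration.integral_mult_right_zero by simp
  have "((\<lambda>x. c * line_inner F S x) \<longlongrightarrow> c * hardy2_inner F S) (at_right 0)"
    by (intro tendsto_intros hardy2_inner_tendsto F S)
  then have "(line_inner (\<lambda>z. c * F z) S \<longlongrightarrow> c * hardy2_inner F S) (at_right 0)"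
    unfolding eq .
  with hardy2_inner_tendsto[OF hardy2_cmult(1)[OF F] S] show ?thesis
    by (intro tendsto_unique[of "at_right (0::real)"]) auto
qed

lemma hardy2_inner_diff_left:
  assumes F: "F \<in> hardy2" and G: "G \<in> hardy2" and S: "S \<in> hardy2"
  shows "hardy2_inner (\<lambda>z. F z - G z) S = hardy2_inner F S - hardy2_inner G S"
  using hardy2_inner_add_left[OF F hardy2_cmult(1)[OF G, of "-1"] S] hardy2_inner_cmult_left[OF G S, of "-1"]
  by simp

lemma hardy2_inner_zero_left:
  "S \<in> hardy2 \<Longrightarrow> hardy2_inner (\<lambda>_. 0) S = 0"
  using hardy2_inner_cmult_left[OF hardy2_zero(1), of S 0] by simp

lemma hardy2_inner_sum_left:
  assumes "finite A" "\<And>a. a \<in> A \<Longrightarrow> F a \<in> hardy2" and S: "S \<in> hardy2"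
  shows "hardy2_inner (\<lambda>z. \<Sum>a\<in>A. c a * F a z) S = (\<Sum>a\<in>A. c a * hardy2_inner (F a) S)"
  using assms(1,2)
proof (induction A rule: finite_induct)
  case (insert a A)
  have "hardy2_inner (\<lambda>z. c a * F a z + (\<Sum>a\<in>A. c a * F a z)) S
     = hardy2_inner (\<lambda>z. c a * F a z) S + hardy2_inner (\<lambda>z. \<Sum>a\<in>A. c a * F a z) S"
    by (intro hardy2_inner_add_left hardy2_cmult(1) hardy2_sum S) (use insert in auto)
  then show ?case using insert hardy2_inner_cmult_left[OF _ S, of "F a" "c a"] by simp
qed (simp add: hardy2_inner_zero_left S)

abbreviation hardy2_dist :: "(complex \<Rightarrow> complex) \<Rightarrow> (complex \<Rightarrow> complex) \<Rightarrow> real" where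
  "hardy2_dist F G \<equiv> hardy2_norm (\<lambda>z. F z - G z)"

lemma hardy2_norm_minus_commute:
  assumes "F \<in> hardy2" "G \<in> hardy2"
  shows "hardy2_dist F G = hardy2_dist G F"
  using hardy2_cmult(2)[OF hardy2_diff[OF assms], of "-1"] by simp

lemma hardy2_triangle_diff:
  assumes F: "F \<in> hardy2" and G: "G \<in> hardy2" and H: "H \<in> hardy2"
  shows "hardy2_dist F H \<le> hardy2_dist F G + hardy2_dist G H"
  using hardy2_triangle[OF hardy2_diff[OF F G] hardy2_diff[OF G H]] by simp

lemma nn_line_fatou:
  assumes "\<And>n. G n \<in> hardy2" "0 < x" "\<And>y. (\<lambda>n. G n (Complex x y)) \<longlonglongrightarrow> F (Complex x y)"
  shows "(\<integral>\<^sup>+y. ennreal ((cmod (F (Complex x y)))\<^sup>2) \<partial>lborel)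
    \<le> liminf (\<lambda>n. ennreal (2 * pi * line_mean (G n) x))"
proof -
  have "(\<integral>\<^sup>+y. ennreal ((cmod (F (Complex x y)))\<^sup>2) \<partial>lborel)
     = (\<integral>\<^sup>+y. liminf (\<lambda>n. ennreal ((cmod (G n (Complex x y)))\<^sup>2)) \<partial>lborel)"
    by (intro nn_integral_cong lim_imp_Liminf[symmetric] tendsto_intros tendsto_ennrealI assms) simp
  also have "... \<le> liminf (\<lambda>n. \<integral>\<^sup>+y. ennreal ((cmod (G n (Complex x y)))\<^sup>2) \<partial>lborel)"
    by (rule nn_integral_liminf) (use hardy2_measurable[OF assms(1,2)] in measurable)
  also have "(\<lambda>n. \<integral>\<^sup>+y. ennreal ((cmod (G n (Complex x y)))\<^sup>2) \<partial>lborel) = (\<lambda>n. ennreal (2 * pi * line_mean (G n) x))"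
    by (intro ext, subst nn_integral_eq_integral) (auto simp: line_mean_def intro!: hardy2_integrable assms)
  finally show ?thesis .
qed

lemma hardy2_fatou:
  assumes G: "\<And>n. G n \<in> hardy2" and lim: "\<And>z. z \<in> half_plane \<Longrightarrow> (\<lambda>n. G n z) \<longlonglongrightarrow> F z"
    and hol: "F holomorphic_on half_plane" and out: "\<And>z. z \<notin> half_plane \<Longrightarrow> F z = 0"
    and C: "\<forall>\<^sub>F n in sequentially. hardy2_norm (G n) \<le> C" "0 \<le> C"
  shows "F \<in> hardy2" and "hardy2_norm F \<le> C"
proof -
  have le: "(\<integral>\<^sup>+y. ennreal ((cmod (F (Complex x y)))\<^sup>2) \<partial>lborel) \<le> ennreal (2 * pi * C\<^sup>2)" if x: "0 < x" for x
  proof -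
    have "(\<integral>\<^sup>+y. ennreal ((cmod (F (Complex x y)))\<^sup>2) \<partial>lborel) \<le> liminf (\<lambda>n. ennreal (2 * pi * line_mean (G n) x))"
      by (rule nn_line_fatou[OF G x]) (use x in \<open>auto simp: half_plane_def intro: lim\<close>)
    also have "... \<le> limsup (\<lambda>n. ennreal (2 * pi * line_mean (G n) x))"
      by (rule Liminf_le_Limsup) simp
    also have "... \<le> ennreal (2 * pi * C\<^sup>2)"
    proof (rule Limsup_bounded)
      show "\<forall>\<^sub>F n in sequentially. ennreal (2 * pi * line_mean (G n) x) \<le> ennreal (2 * pi * C\<^sup>2)"
        using C(1)
      proof eventually_elim
        case (elim n)
        have "line_mean (G n) x \<le> (hardy2_norm (G n))\<^sup>2" by (rule line_mean_le[OF G x])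
        also have "... \<le> C\<^sup>2" by (rule power_mono[OF elim hardy2_norm_nonneg[OF G]])
        finally show ?case by (intro ennreal_leI) simp
      qed
    qed
    finally show ?thesis .
  qed
  have hol': "F holomorphic_on {z. Re z > 0}" using hol by (simp add: half_plane_def)
  have int: "integrable lborel (\<lambda>y. (cmod (F (Complex x y)))\<^sup>2)" if x: "0 < x" for x
  proof (rule integrableI_nonneg)
    show "(\<lambda>y. (cmod (F (Complex x y)))\<^sup>2) \<in> borel_measurable lborel"
      using vertical_line_measurable[OF hol' x] by measurable
    show "(\<integral>\<^sup>+y. ennreal ((cmod (F (Complex x y)))\<^sup>2) \<partial>lborel) < \<infinity>"
      using le[OF x] by (simp add: le_less_trans)
  qed simp
  have mean: "line_mean F x \<le> C\<^sup>2" if x: "0 < x" for x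
  proof -
    have "ennreal (\<integral>y. (cmod (F (Complex x y)))\<^sup>2 \<partial>lborel) \<le> ennreal (2 * pi * C\<^sup>2)"
      using le[OF x] nn_integral_eq_integral[OF int[OF x]] by simp
    then have "(\<integral>y. (cmod (F (Complex x y)))\<^sup>2 \<partial>lborel) \<le> 2 * pi * C\<^sup>2"
      by (subst (asm) ennreal_le_iff) auto
    then show ?thesis by (simp add: line_mean_def field_simps)
  qed
  show F: "F \<in> hardy2"
    by (rule hardy2I[OF hol' _ int mean]) (auto intro: out simp: half_plane_def)
  show "hardy2_norm F \<le> C"
    by (rule power2_le_imp_le[OF hardy2_norm_sq_le[OF mean F] C(2)])
qed

lemma hardy2_complete:
  assumes S: "\<And>n. S n \<in> hardy2"
    and cauchy: "\<And>e. 0 < e \<Longrightarrow> \<exists>N. \<forall>m\<ge>N. \<forall>n\<ge>N. hardy2_dist (S m) (S n) < e"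
  obtains F where "F \<in> hardy2" "(\<lambda>n. hardy2_dist (S n) F) \<longlonglongrightarrow> 0"
proof -
  have unif: "uniformly_Cauchy_on {z. d \<le> Re z} S" if d: "0 < d" for d
  proof (rule uniformly_Cauchy_onI)
    fix e :: real assume e: "0 < e"
    from cauchy[of "e * sqrt (2 * d)"] obtain N where
      N: "\<And>m n. N \<le> m \<Longrightarrow> N \<le> n \<Longrightarrow> hardy2_dist (S m) (S n) < e * sqrt (2 * d)"
      using e d by auto
    have "dist (S m z) (S n z) < e" if z: "d \<le> Re z" and mn: "N \<le> m" "N \<le> n" for m n z
    proof -
      have "cmod (S m z - S n z) \<le> hardy2_dist (S m) (S n) / sqrt (2 * Re z)"
        by (rule hardy2_point_bound[OF hardy2_diff[OF S S]]) (use z d in \<open>simp add: half_plane_def\<close>)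
      also have "... \<le> hardy2_dist (S m) (S n) / sqrt (2 * d)"
        by (intro divide_left_mono) (use z d in \<open>auto intro!: hardy2_norm_nonneg hardy2_diff S\<close>)
      also have "... < e" using N[OF mn] d by (simp add: divide_less_eq)
      finally show ?thesis by (simp add: dist_norm)
    qed
    then show "\<exists>M. \<forall>z\<in>{z. d \<le> Re z}. \<forall>m\<ge>M. \<forall>n\<ge>M. dist (S m z) (S n z) < e" by blast
  qed
  define F where "F z = lim (\<lambda>n. S n z)" for z
  have UL: "uniform_limit {z. d \<le> Re z} S F sequentially" if d: "0 < d" for d
    using Cauchy_uniformly_convergent[OF unif[OF d]] unfolding F_def by (simp add: uniformly_convergent_uniform_limit_iff)
  have lim: "(\<lambda>n. S n z) \<longlonglongrightarrow> F z" if "z \<in> half_plane" for z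
    using tendsto_uniform_limitI[OF UL[of "Re z"]] that by (simp add: half_plane_def)
  have out: "F z = 0" if "z \<notin> half_plane" for z
    using that hardy2_outside[OF S] by (simp add: F_def half_plane_def)
  have hol: "F holomorphic_on half_plane"
  proof (rule holomorphic_uniform_sequence)
    show "open half_plane" by (simp add: half_plane_def open_halfspace_Re_gt)
    show "S n holomorphic_on half_plane" for n using hardy2_holomorphic[OF S] by (simp add: half_plane_def)
    fix z assume "z \<in> half_plane"
    then have z: "0 < Re z" by (simp add: half_plane_def)
    have sub: "cball z (Re z / 2) \<subseteq> {u. Re z / 2 \<le> Re u}"
    proof
      fix u assume "u \<in> cball z (Re z / 2)"
      then have "cmod (z - u) \<le> Re z / 2" by (simp add: dist_norm)
      then show "u \<in> {u. Re z / 2 \<le> Re u}" using complex_Re_le_cmod[of "z - u"] by simp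
    qed
    show "\<exists>d>0. cball z d \<subseteq> half_plane \<and> uniform_limit (cball z d) S F sequentially"
      by (rule exI[of _ "Re z / 2"])
        (use sub z uniform_limit_on_subset[OF UL[of "Re z / 2"] sub] in \<open>auto simp: half_plane_def\<close>)
  qed
  have close: "(\<lambda>z. S n z - F z) \<in> hardy2 \<and> hardy2_dist (S n) F \<le> e"
    if N: "\<And>m. N \<le> m \<Longrightarrow> hardy2_dist (S n) (S m) < e" and e: "0 < e" for n N e
  proof -
    have "\<forall>\<^sub>F m in sequentially. hardy2_dist (S n) (S m) \<le> e"
      using eventually_ge_at_top[of N] by eventually_elim (use N in \<open>auto intro: less_imp_le\<close>)
    note ev = this
    have l: "(\<lambda>m. S n z - S m z) \<longlonglongrightarrow> S n z - F z" if "z \<in> half_plane" for z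
      by (intro tendsto_intros lim that)
    have h: "(\<lambda>z. S n z - F z) holomorphic_on half_plane"
      using hardy2_holomorphic[OF S, of n] by (intro holomorphic_intros hol) (simp add: half_plane_def)
    have o: "S n z - F z = 0" if "z \<notin> half_plane" for z
      using that out[OF that] hardy2_outside[OF S] by (simp add: half_plane_def)
    show ?thesis
      using hardy2_fatou[OF hardy2_diff[OF S S] l h o ev less_imp_le[OF e]] by blast
  qed
  show thesis
  proof
    obtain N where N: "\<And>m n. N \<le> m \<Longrightarrow> N \<le> n \<Longrightarrow> hardy2_dist (S m) (S n) < 1"
      using cauchy[of 1] by auto
    have "(\<lambda>z. S N z - F z) \<in> hardy2" using close[of N N 1] N by auto
    from hardy2_diff[OF S[of N] this] show "F \<in> hardy2" by simp
    show "(\<lambda>n. hardy2_dist (S n) F) \<longlonglongrightarrow> 0"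
    proof (rule LIMSEQ_I)
      fix e :: real assume e: "0 < e"
      then obtain N where N: "\<And>m n. N \<le> m \<Longrightarrow> N \<le> n \<Longrightarrow> hardy2_dist (S m) (S n) < e / 2"
        using cauchy[of "e / 2"] by auto
      have "norm (hardy2_dist (S n) F - 0) < e" if "N \<le> n" for n
      proof -
        have "hardy2_dist (S n) F \<le> e / 2" "0 \<le> hardy2_dist (S n) F"
          using close[of N n "e / 2"] N[OF that] e hardy2_norm_nonneg by auto
        then show ?thesis using e by simp
      qed
      then show "\<exists>N. \<forall>n\<ge>N. norm (hardy2_dist (S n) F - 0) < e" by blast
    qed
  qed
qed

lemma line_mean_T2: "line_mean (T2 t F) x = line_mean F (exp (- t) * x)"
proof -
  have eq: "(cmod (T2 t F (Complex x y)))\<^sup>2 = exp (- t) * (cmod (F (Complex (exp (- t) * x) (0 + exp (- t) * y))))\<^sup>2" for y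
  proof -
    have "of_real (exp (- t)) * Complex x y = Complex (exp (- t) * x) (exp (- t) * y)" by (simp add: complex_eq_iff)
    moreover have "(exp (- t / 2))\<^sup>2 = exp (- t)" by (simp add: power2_eq_square flip: exp_add)
    ultimately show ?thesis by (simp add: T2_def norm_mult power_mult_distrib)
  qed
  have "(\<integral>y. (cmod (F (Complex (exp (- t) * x) y)))\<^sup>2 \<partial>lborel)
      = \<bar>exp (- t)\<bar> *\<^sub>R (\<integral>y. (cmod (F (Complex (exp (- t) * x) (0 + exp (- t) * y))))\<^sup>2 \<partial>lborel)"
    by (rule lborel_integral_real_affine) simp
  then show ?thesis unfolding line_mean_def eq by simp
qed

lemma T2_in_hardy2:
  assumes F: "F \<in> hardy2"
  shows "T2 t F \<in> hardy2" and "hardy2_norm (T2 t F) = hardy2_norm F"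
proof -
  have mem: "T2 t F \<in> hardy2" if F: "F \<in> hardy2" for t F
  proof (rule hardy2I[where C="(hardy2_norm F)\<^sup>2"])
    have "(\<lambda>z. F (of_real (exp (- t)) * z)) holomorphic_on {z. 0 < Re z}"
      by (intro holomorphic_on_compose_gen[OF _ hardy2_holomorphic[OF F], unfolded o_def] holomorphic_intros) auto
    then show "T2 t F holomorphic_on {z. 0 < Re z}"
      unfolding T2_def by (intro holomorphic_intros)
    show "T2 t F z = 0" if "Re z \<le> 0" for z
      using hardy2_outside[OF F, of "of_real (exp (- t)) * z"] that by (simp add: T2_def mult_nonneg_nonpos)
    fix x :: real assume x: "0 < x"
    show "line_mean (T2 t F) x \<le> (hardy2_norm F)\<^sup>2"
      unfolding line_mean_T2 by (rule line_mean_le[OF F]) (use x in simp)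
    have "integrable lborel (\<lambda>y. (cmod (F (Complex (exp (- t) * x) (0 + exp (- t) * y))))\<^sup>2)"
      by (rule lborel_integrable_real_affine[OF hardy2_integrable[OF F]]) (use x in auto)
    moreover have "(cmod (T2 t F (Complex x y)))\<^sup>2 = (exp (- t / 2))\<^sup>2 * (cmod (F (Complex (exp (- t) * x) (0 + exp (- t) * y))))\<^sup>2" for y
    proof -
      have "of_real (exp (- t)) * Complex x y = Complex (exp (- t) * x) (exp (- t) * y)" by (simp add: complex_eq_iff)
      then show ?thesis by (simp add: T2_def norm_mult power_mult_distrib)
    qed
    ultimately show "integrable lborel (\<lambda>y. (cmod (T2 t F (Complex x y)))\<^sup>2)" by simp
  qed
  have le: "hardy2_norm (T2 t F) \<le> hardy2_norm F" if F: "F \<in> hardy2" for t F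
  proof (rule power2_le_imp_le)
    show "(hardy2_norm (T2 t F))\<^sup>2 \<le> (hardy2_norm F)\<^sup>2"
      by (rule hardy2_norm_sq_le[OF _ mem[OF F]]) (auto simp: line_mean_T2 intro!: line_mean_le F)
  qed (rule hardy2_norm_nonneg[OF F])
  show "T2 t F \<in> hardy2" by (rule mem[OF F])
  have "T2 (- t) (T2 t F) = F"
  proof
    fix z
    have "exp (t / 2) * exp (- t / 2) = (1::real)" "exp (- t) * exp t = (1::real)" by (simp_all flip: exp_add)
    then show "T2 (- t) (T2 t F) z = F z"
      unfolding T2_def by (simp flip: mult.assoc of_real_mult)
  qed
  with le[OF mem[OF F], of "- t" t] le[OF F, of t] show "hardy2_norm (T2 t F) = hardy2_norm F" by simp
qed

lemma hardy2_norm_lower_semicontinuous: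
  assumes G: "\<And>n. G n \<in> hardy2" and F: "F \<in> hardy2"
    and lim: "\<And>z. (\<lambda>n. G n z) \<longlonglongrightarrow> F z" and a: "a < (hardy2_norm F)\<^sup>2"
  shows "\<forall>\<^sub>F n in sequentially. a < (hardy2_norm (G n))\<^sup>2"
proof -
  obtain x where x: "0 < x" "a < line_mean F x"
    using hardy2_norm_sq_le[OF _ F, of a] a by (meson not_le)
  show ?thesis
  proof (cases "a < 0")
    case True
    then show ?thesis by (auto intro!: always_eventually less_le_trans[OF True])
  next
    case False
    have "ennreal (2 * pi * a) < ennreal (2 * pi * line_mean F x)"
      using x False by (intro ennreal_lessI) (auto simp: line_mean_nonneg intro!: mult_strict_left_mono)
    also have "... = (\<integral>\<^sup>+y. ennreal ((cmod (F (Complex x y)))\<^sup>2) \<partial>lborel)"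
      by (subst nn_integral_eq_integral) (auto simp: line_mean_def intro!: hardy2_integrable F x)
    also have "... \<le> liminf (\<lambda>n. ennreal (2 * pi * line_mean (G n) x))"
      by (rule nn_line_fatou[OF G x(1) lim])
    finally have "\<forall>\<^sub>F n in sequentially. ennreal (2 * pi * a) < ennreal (2 * pi * line_mean (G n) x)"
      by (rule less_LiminfD)
    then show ?thesis
    proof eventually_elim
      case (elim n)
      then have "a < line_mean (G n) x" using False by (subst (asm) ennreal_less_iff) auto
      then show ?case using line_mean_le[OF G x(1), of n] by linarith
    qed
  qed
qed

text \<open>Pointwise convergence together with convergence of norms forces norm convergence: by the
  parallelogram law it suffices that \<open>G n + F\<close> has asymptotically the full norm \<open>2 \<parallel>F\<parallel>\<close>.\<close>
lemma hardy2_tendsto_of_pointwise: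
  assumes G: "\<And>n. G n \<in> hardy2" and F: "F \<in> hardy2"
    and lim: "\<And>z. (\<lambda>n. G n z) \<longlonglongrightarrow> F z"
    and nlim: "(\<lambda>n. hardy2_norm (G n)) \<longlonglongrightarrow> hardy2_norm F"
  shows "(\<lambda>n. hardy2_dist (G n) F) \<longlonglongrightarrow> 0"
proof -
  let ?N = "\<lambda>n. (hardy2_dist (G n) F)\<^sup>2"
  have "?N \<longlonglongrightarrow> 0"
  proof (rule order_tendstoI)
    fix e :: real assume e: "0 < e"
    have dbl: "hardy2_norm (\<lambda>z. F z + F z) = 2 * hardy2_norm F"
      using hardy2_cmult(2)[OF F, of 2] unfolding mult_2[of "F _"] by simp
    have "4 * (hardy2_norm F)\<^sup>2 - e / 2 < (hardy2_norm (\<lambda>z. F z + F z))\<^sup>2"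
      unfolding dbl using e by (simp add: power_mult_distrib)
    then have "\<forall>\<^sub>F n in sequentially. 4 * (hardy2_norm F)\<^sup>2 - e / 2 < (hardy2_norm (\<lambda>z. G n z + F z))\<^sup>2"
      by (rule hardy2_norm_lower_semicontinuous[OF hardy2_add[OF G F] hardy2_add[OF F F] tendsto_add[OF lim tendsto_const]])
    moreover have "(\<lambda>n. 2 * (hardy2_norm (G n))\<^sup>2) \<longlonglongrightarrow> 2 * (hardy2_norm F)\<^sup>2"
      by (intro tendsto_intros nlim)
    then have "\<forall>\<^sub>F n in sequentially. 2 * (hardy2_norm (G n))\<^sup>2 < 2 * (hardy2_norm F)\<^sup>2 + e / 2"
      by (rule order_tendstoD(2)) (use e in simp)
    ultimately show "\<forall>\<^sub>F n in sequentially. ?N n < e"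
    proof eventually_elim
      case (elim n)
      then show ?case using hardy2_parallelogram[OF G F, of n] by linarith
    qed
  qed (intro always_eventually allI, erule less_le_trans, simp)
  then have "(\<lambda>n. sqrt (?N n)) \<longlonglongrightarrow> sqrt 0" by (rule tendsto_real_sqrt)
  moreover have "sqrt (?N n) = hardy2_dist (G n) F" for n
    using hardy2_norm_nonneg[OF hardy2_diff[OF G F]] by simp
  ultimately show ?thesis by simp
qed

lemma T2_tendsto:
  assumes F: "F \<in> hardy2" and u: "u \<longlonglongrightarrow> t"
  shows "(\<lambda>n. T2 (- u n) F z) \<longlonglongrightarrow> T2 (- t) F z"
proof (cases "z \<in> half_plane")
  case True
  then have pos: "0 < Re (of_real (exp t) * z)" by (simp add: half_plane_def)
  have "isCont F (of_real (exp t) * z)"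
    using holomorphic_on_imp_continuous_on[OF hardy2_holomorphic[OF F]] pos
    by (auto simp: continuous_on_eq_continuous_at open_halfspace_Re_gt)
  then have "(\<lambda>n. F (of_real (exp (u n)) * z)) \<longlonglongrightarrow> F (of_real (exp t) * z)"
    by (rule isCont_tendsto_compose) (intro tendsto_intros u)
  then show ?thesis unfolding T2_def by (simp, intro tendsto_intros u) simp
next
  case False
  then have "T2 s F z = 0" for s
    using hardy2_outside[OF T2_in_hardy2(1)[OF F]] by (simp add: half_plane_def)
  then show ?thesis by simp
qed

section \<open>Bochner integrals in the Hardy space\<close>

abbreviation half_line :: "real measure" where
  "half_line \<equiv> restrict_space lborel {0<..}"

lemma integral_simple_functional:
  fixes l :: "('b \<Rightarrow> complex) \<Rightarrow> complex"
  assumes s: "simple_function M s" and fin: "emeasure M {t \<in> space M. s t \<noteq> (\<lambda>_. 0)} < \<infinity>"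
    and l0: "l (\<lambda>_. 0) = 0"
  shows "integrable M (\<lambda>t. l (s t))"
    and "(\<integral>t. l (s t) \<partial>M) = (\<Sum>g\<in>s ` space M. of_real (measure M {t \<in> space M. s t = g}) * l g)"
proof -
  let ?A = "\<lambda>g. {t \<in> space M. s t = g}"
  have A: "?A g \<in> sets M" for g
    using simple_functionD(2)[OF s, of "{g}"] by (simp add: vimage_def Int_def conj_commute)
  have Z: "{t \<in> space M. s t \<noteq> (\<lambda>_. 0)} \<in> sets M"
    using simple_functionD(2)[OF s, of "- {\<lambda>_. 0}"] by (simp add: vimage_def Int_def conj_commute)
  have trm: "has_bochner_integral M (\<lambda>t. indicator (?A g) t *\<^sub>R l g) (measure M (?A g) *\<^sub>R l g)" for g
  proof (cases "l g = 0")
    case False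
    then have "g \<noteq> (\<lambda>_. 0)" using l0 by auto
    then have "emeasure M (?A g) \<le> emeasure M {t \<in> space M. s t \<noteq> (\<lambda>_. 0)}"
      by (intro emeasure_mono Z) auto
    then have "emeasure M (?A g) < \<infinity>" using fin by (rule le_less_trans)
    then show ?thesis by (intro has_bochner_integral_scaleR_left has_bochner_integral_real_indicator A)
  qed (simp add: has_bochner_integral_zero)
  have "has_bochner_integral M (\<lambda>t. \<Sum>g\<in>s ` space M. indicator (?A g) t *\<^sub>R l g)
      (\<Sum>g\<in>s ` space M. measure M (?A g) *\<^sub>R l g)"
    by (intro has_bochner_integral_sum trm)
  moreover have "(\<Sum>g\<in>s ` space M. indicator (?A g) t *\<^sub>R l g) = l (s t)" if "t \<in> space M" for t
  proof -
    have "(\<Sum>g\<in>s ` space M. indicator (?A g) t *\<^sub>R l g) = (\<Sum>g\<in>s ` space M. if g = s t then l g else 0)"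
      by (intro sum.cong) (use that in \<open>auto simp: indicator_def\<close>)
    also have "... = l (s t)" using simple_functionD(1)[OF s] that by simp
    finally show ?thesis .
  qed
  ultimately have "has_bochner_integral M (\<lambda>t. l (s t)) (\<Sum>g\<in>s ` space M. measure M (?A g) *\<^sub>R l g)"
    by (simp cong: has_bochner_integral_cong)
  then show "integrable M (\<lambda>t. l (s t))"
    "(\<integral>t. l (s t) \<partial>M) = (\<Sum>g\<in>s ` space M. of_real (measure M (?A g)) * l g)"
    by (auto simp: has_bochner_integral_iff scaleR_conv_of_real)
qed

lemma simple_integral_fun_in_hardy2:
  assumes "simple_function M s" "s ` space M \<subseteq> hardy2"
  shows "simple_integral_fun M s \<in> hardy2"
  unfolding simple_integral_fun_def
  by (intro hardy2_sum hardy2_cmult) (use assms simple_functionD(1) in auto)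

text \<open>Point evaluations are bounded on \<open>hardy2\<close>, so a vector-valued integral is computed pointwise;
  in particular it is unique.\<close>
lemma has_bochner_integral_in_hardy2_eval:
  assumes B: "has_bochner_integral_in hardy2 hardy2_norm M f I"
    and meas: "(\<lambda>t. f t z) \<in> borel_measurable M" and z: "z \<in> half_plane"
  shows "integrable M (\<lambda>t. f t z)" and "I z = (\<integral>t. f t z \<partial>M)"
proof -
  have I: "I \<in> hardy2" and f: "\<And>t. t \<in> space M \<Longrightarrow> f t \<in> hardy2"
    using B unfolding has_bochner_integral_in_def by simp_all
  obtain s where "(\<forall>n. simple_function M (s n) \<and> s n ` space M \<subseteq> hardy2 \<and> emeasure M {t \<in> space M. s n t \<noteq> (\<lambda>_. 0)} < \<infinity>)
      \<and> (\<forall>n. (\<lambda>t. hardy2_dist (f t) (s n t)) \<in> borel_measurable M)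
      \<and> ((\<lambda>n. \<integral>\<^sup>+t. ennreal (hardy2_dist (f t) (s n t)) \<partial>M) \<longlonglongrightarrow> 0)
      \<and> ((\<lambda>n. hardy2_norm (\<lambda>z. simple_integral_fun M (s n) z - I z)) \<longlonglongrightarrow> 0)"
    using B unfolding has_bochner_integral_in_def by (elim conjE exE) (rule that, intro conjI)
  then have s: "\<And>n. simple_function M (s n)" "\<And>n. s n ` space M \<subseteq> hardy2"
      "\<And>n. emeasure M {t \<in> space M. s n t \<noteq> (\<lambda>_. 0)} < \<infinity>"
    and m: "\<And>n. (\<lambda>t. hardy2_dist (f t) (s n t)) \<in> borel_measurable M"
    and lim: "(\<lambda>n. \<integral>\<^sup>+t. ennreal (hardy2_dist (f t) (s n t)) \<partial>M) \<longlonglongrightarrow> 0"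
    and limI: "(\<lambda>n. hardy2_norm (\<lambda>z. simple_integral_fun M (s n) z - I z)) \<longlonglongrightarrow> 0"
    by simp_all
  define c where "c = 1 / sqrt (2 * Re z)"
  have c: "0 < c" using z by (simp add: c_def half_plane_def)
  have bound: "cmod (F z) \<le> c * hardy2_norm F" if "F \<in> hardy2" for F
    using hardy2_point_bound[OF that z] by (simp add: c_def)
  note si = integral_simple_functional[OF s(1) s(3), of "\<lambda>g. g z", simplified]
  have sm[measurable]: "(\<lambda>t. s n t z) \<in> borel_measurable M" for n using si(1) by (rule borel_measurable_integrable)
  note meas[measurable]
  let ?e = "\<lambda>n. \<integral>\<^sup>+t. ennreal (cmod (f t z - s n t z)) \<partial>M"
  have le: "?e n \<le> ennreal c * (\<integral>\<^sup>+t. ennreal (hardy2_dist (f t) (s n t)) \<partial>M)" for n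
  proof -
    have "?e n \<le> (\<integral>\<^sup>+t. ennreal c * ennreal (hardy2_dist (f t) (s n t)) \<partial>M)"
    proof (rule nn_integral_mono)
      fix t assume "t \<in> space M"
      then have "(\<lambda>z. f t z - s n t z) \<in> hardy2" using f s(2)[of n] by (intro hardy2_diff) auto
      from ennreal_leI[OF bound[OF this]]
      show "ennreal (cmod (f t z - s n t z)) \<le> ennreal c * ennreal (hardy2_dist (f t) (s n t))"
        unfolding ennreal_mult'[OF less_imp_le[OF c]] .
    qed
    also have "... = ennreal c * (\<integral>\<^sup>+t. ennreal (hardy2_dist (f t) (s n t)) \<partial>M)"
      using m by (intro nn_integral_cmult) measurable
    finally show ?thesis .
  qed
  have "(\<lambda>n. ennreal c * (\<integral>\<^sup>+t. ennreal (hardy2_dist (f t) (s n t)) \<partial>M)) \<longlonglongrightarrow> ennreal c * 0"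
    by (intro ennreal_tendsto_cmult lim) simp
  then have "(\<lambda>n. ennreal c * (\<integral>\<^sup>+t. ennreal (hardy2_dist (f t) (s n t)) \<partial>M)) \<longlonglongrightarrow> 0" by simp
  then have elim: "?e \<longlonglongrightarrow> 0"
    by (rule tendsto_sandwich[OF always_eventually[OF allI[OF zero_le]] always_eventually[OF allI[OF le]] tendsto_const])
  then have "\<forall>\<^sub>F n in sequentially. ?e n < 1" by (rule order_tendstoD) simp
  then obtain n0 where "?e n0 < 1" by (auto simp: eventually_sequentially)
  then have "?e n0 < \<infinity>" by (rule less_trans) simp
  then have "integrable M (\<lambda>t. f t z - s n0 t z)"
    by (rule integrableI_bounded[rotated]) measurable
  from Bochner_Integration.integrable_add[OF this si(1)[of n0]] show int: "integrable M (\<lambda>t. f t z)" by simp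
  have "(\<lambda>n. \<integral>t. s n t z \<partial>M) \<longlonglongrightarrow> (\<integral>t. f t z \<partial>M)"
    by (rule tendsto_L1_int[OF si(1) int]) (use elim in \<open>simp add: norm_minus_commute\<close>)
  moreover have "(\<lambda>n. \<integral>t. s n t z \<partial>M) \<longlonglongrightarrow> I z"
  proof (rule LIM_zero_cancel, rule Lim_null_comparison[OF always_eventually])
    show "(\<lambda>n. c * hardy2_norm (\<lambda>z. simple_integral_fun M (s n) z - I z)) \<longlonglongrightarrow> 0"
      using tendsto_mult_right_zero[OF limI] by simp
    show "\<forall>n. norm ((\<integral>t. s n t z \<partial>M) - I z) \<le> c * hardy2_norm (\<lambda>z. simple_integral_fun M (s n) z - I z)"
      using bound[OF hardy2_diff[OF simple_integral_fun_in_hardy2[OF s(1,2)] I]] by (simp add: si(2) simple_integral_fun_def)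
  qed
  ultimately show "I z = (\<integral>t. f t z \<partial>M)" using LIMSEQ_unique by blast
qed

lemma hardy2_norm_simple_integral_diff:
  assumes s: "simple_function M s" "s ` space M \<subseteq> hardy2" "emeasure M {t \<in> space M. s t \<noteq> (\<lambda>_. 0)} < \<infinity>"
    and r: "simple_function M r" "r ` space M \<subseteq> hardy2" "emeasure M {t \<in> space M. r t \<noteq> (\<lambda>_. 0)} < \<infinity>"
    and w: "integrable M w" "\<And>t. t \<in> space M \<Longrightarrow> hardy2_dist (s t) (r t) \<le> w t"
  shows "hardy2_dist (simple_integral_fun M s) (simple_integral_fun M r) \<le> (\<integral>t. w t \<partial>M)"
proof -
  define D where "D = (\<lambda>z. simple_integral_fun M s z - simple_integral_fun M r z)"
  have S: "simple_integral_fun M s \<in> hardy2" "simple_integral_fun M r \<in> hardy2"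
    by (intro simple_integral_fun_in_hardy2 s r)+
  then have D: "D \<in> hardy2" unfolding D_def by (rule hardy2_diff)
  let ?l = "\<lambda>g. hardy2_inner g D"
  have l: "hardy2_inner (simple_integral_fun M q) D = (\<integral>t. ?l (q t) \<partial>M)" "integrable M (\<lambda>t. ?l (q t))"
    if q: "simple_function M q" "q ` space M \<subseteq> hardy2" "emeasure M {t \<in> space M. q t \<noteq> (\<lambda>_. 0)} < \<infinity>" for q
    using integral_simple_functional[OF q(1,3), of ?l] hardy2_inner_zero_left[OF D]
      hardy2_inner_sum_left[OF simple_functionD(1)[OF q(1)] subsetD[OF q(2)] D, where c="\<lambda>g. of_real (measure M {t \<in> space M. q t = g})"]
    by (auto simp: simple_integral_fun_def subset_iff)
  have ge: "0 \<le> w t" if "t \<in> space M" for t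
    using w(2)[OF that] hardy2_norm_nonneg[OF hardy2_diff, of "s t" "r t"] s(2) r(2) that by force
  have "(hardy2_norm D)\<^sup>2 = cmod (hardy2_inner D D)" unfolding hardy2_inner_self[OF D] norm_of_real by simp
  also have "hardy2_inner D D = (\<integral>t. ?l (s t) \<partial>M) - (\<integral>t. ?l (r t) \<partial>M)"
    using hardy2_inner_diff_left[OF S D] l(1)[OF s] l(1)[OF r] by (simp flip: D_def)
  also have "... = (\<integral>t. ?l (s t) - ?l (r t) \<partial>M)" using l(2)[OF s] l(2)[OF r] by simp
  also have "cmod ... \<le> (\<integral>t. w t * hardy2_norm D \<partial>M)"
  proof (rule order_trans[OF integral_norm_bound], rule Bochner_Integration.integral_mono)
    fix t assume t: "t \<in> space M"
    then have st: "s t \<in> hardy2" "r t \<in> hardy2" using s(2) r(2) by auto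
    have "cmod (?l (s t) - ?l (r t)) \<le> hardy2_dist (s t) (r t) * hardy2_norm D"
      using hardy2_Cauchy_Schwarz[OF hardy2_diff[OF st] D] by (simp add: hardy2_inner_diff_left[OF st D])
    also have "... \<le> w t * hardy2_norm D" by (intro mult_right_mono w(2) t hardy2_norm_nonneg D)
    finally show "cmod (?l (s t) - ?l (r t)) \<le> w t * hardy2_norm D" .
  qed (use l(2)[OF s] l(2)[OF r] w(1) in auto)
  also have "... = (\<integral>t. w t \<partial>M) * hardy2_norm D" by simp
  finally have le: "hardy2_norm D * hardy2_norm D \<le> (\<integral>t. w t \<partial>M) * hardy2_norm D"
    by (simp add: power2_eq_square)
  have "hardy2_norm D \<le> (\<integral>t. w t \<partial>M)"
  proof (cases "hardy2_norm D = 0")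
    case True
    then show ?thesis using ge by (auto intro!: integral_nonneg_AE)
  next
    case False
    then have "0 < hardy2_norm D" using hardy2_norm_nonneg[OF D] by simp
    with le show ?thesis by (simp only: mult_le_cancel_right_pos)
  qed
  then show ?thesis by (simp add: D_def)
qed

lemma dyadic_floor_tendsto:
  fixes t :: real
  shows "(\<lambda>n. of_int \<lfloor>2 ^ n * t\<rfloor> / 2 ^ n) \<longlonglongrightarrow> t"
proof (rule LIM_zero_cancel, rule Lim_null_comparison[OF always_eventually])
  show "(\<lambda>n. (1 / 2 :: real) ^ n) \<longlonglongrightarrow> 0" by (rule LIMSEQ_power_zero) simp
  show "\<forall>n. norm (of_int \<lfloor>2 ^ n * t\<rfloor> / 2 ^ n - t) \<le> (1 / 2) ^ n"
  proof
    fix n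
    have "\<bar>of_int \<lfloor>2 ^ n * t\<rfloor> - 2 ^ n * t\<bar> \<le> 1" by linarith
    then have "\<bar>of_int \<lfloor>2 ^ n * t\<rfloor> - 2 ^ n * t\<bar> / 2 ^ n \<le> 1 / 2 ^ n" by (rule divide_right_mono) simp
    moreover have "of_int \<lfloor>2 ^ n * t\<rfloor> / 2 ^ n - t = (of_int \<lfloor>2 ^ n * t\<rfloor> - 2 ^ n * t) / 2 ^ n"
      by (simp add: diff_divide_distrib)
    ultimately show "norm (of_int \<lfloor>2 ^ n * t\<rfloor> / 2 ^ n - t) \<le> (1 / 2) ^ n"
      by (simp add: power_one_over abs_divide)
  qed
qed

text \<open>The approximating simple functions sample \<open>f\<close> at dyadic points, but only where the sampled
  norm exceeds the true norm by at most an integrable amount; this makes them dominated without any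
  monotonicity of the norm.\<close>
lemma bochner_integral_in_hardy2_exists:
  assumes f: "\<And>t. 0 < t \<Longrightarrow> f t \<in> hardy2"
    and cont: "\<And>t u. 0 < t \<Longrightarrow> (\<And>n. 0 < u n) \<Longrightarrow> u \<longlonglongrightarrow> t \<Longrightarrow>
      (\<lambda>n. hardy2_dist (f (u n)) (f t)) \<longlonglongrightarrow> 0"
    and int: "integrable half_line (\<lambda>t. hardy2_norm (f t))"
  obtains I where "has_bochner_integral_in hardy2 hardy2_norm half_line f I"
proof -
  define p where "p t = hardy2_norm (f t)" for t
  define b where "b t = inverse (1 + t\<^sup>2)" for t :: real
  define w where "w t = 2 * p t + b t" for t
  define d :: "nat \<Rightarrow> real \<Rightarrow> real" where "d n t = of_int \<lfloor>2 ^ n * t\<rfloor> / 2 ^ n" for n t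
  define j where "j n t = (if 0 < d n t \<and> d n t \<le> real n \<and> p (d n t) \<le> p t + b t then d n t else 0)" for n t
  define f' where "f' r = (if 0 < r then f r else (\<lambda>_. 0))" for r
  define s where "s n t = f' (j n t)" for n t
  have sp: "space half_line = {0<..}" by (simp add: space_restrict_space)
  have b0: "0 < b t" for t by (simp add: b_def add_pos_nonneg)
  have p0: "0 \<le> p t" if "0 < t" for t by (simp add: p_def hardy2_norm_nonneg f that)
  have f': "f' r \<in> hardy2" for r by (simp add: f'_def f hardy2_zero)
  have pm[measurable]: "p \<in> borel_measurable half_line"
    using borel_measurable_integrable[OF int] by (simp add: p_def[abs_def])
  have bi: "integrable half_line b"
    using integrable_mult_indicator[of "{0<..}" lborel b] integrable_inverse_1_plus_square
    by (simp add: integrable_restrict_space set_integrable_def b_def[abs_def])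
  note bm[measurable] = borel_measurable_integrable[OF bi]
  have wi: "integrable half_line w" unfolding w_def[abs_def] using int bi by (simp add: p_def)
  have idm[measurable]: "(\<lambda>t. t) \<in> borel_measurable half_line" by (rule measurable_restrict_space1) simp
  have dm[measurable]: "(\<lambda>t. h (d n t)) \<in> borel_measurable half_line" for n and h :: "real \<Rightarrow> real"
  proof -
    have "(\<lambda>t. \<lfloor>2 ^ n * t\<rfloor>) \<in> half_line \<rightarrow>\<^sub>M count_space UNIV" by measurable
    then show ?thesis unfolding d_def by (rule measurable_compose) simp
  qed
  have jm[measurable]: "j n \<in> borel_measurable half_line" for n
    unfolding j_def[abs_def] using dm[of "\<lambda>x. x" n] dm[of p n] by measurable
  have jfin: "finite (range (j n))" for n
  proof (rule finite_subset)
    show "range (j n) \<subseteq> insert 0 ((\<lambda>k. of_int k / 2 ^ n) ` {0..int (n * 2 ^ n)})"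
    proof
      fix y assume "y \<in> range (j n)"
      then obtain t where y: "y = j n t" by blast
      show "y \<in> insert 0 ((\<lambda>k. of_int k / 2 ^ n) ` {0..int (n * 2 ^ n)})"
      proof (cases "y = 0")
        case False
        then have "y = d n t" "0 < d n t" "d n t \<le> real n" using y by (auto simp: j_def split: if_splits)
        then have "0 \<le> \<lfloor>2 ^ n * t\<rfloor>" "of_int \<lfloor>2 ^ n * t\<rfloor> \<le> real n * 2 ^ n"
          by (auto simp: d_def zero_less_divide_iff divide_le_eq)
        moreover have "real n * 2 ^ n = of_int (int (n * 2 ^ n))" by simp
        ultimately have "\<lfloor>2 ^ n * t\<rfloor> \<in> {0..int (n * 2 ^ n)}"
          by (metis atLeastAtMost_iff of_int_le_iff)
        then show ?thesis using \<open>y = d n t\<close> by (auto simp: d_def)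
      qed simp
    qed
  qed simp
  have js: "simple_function half_line (j n)" for n
    by (rule simple_function_borel_measurable) (use jfin in \<open>auto intro: finite_subset[of _ "range (j n)"]\<close>)
  have ss: "simple_function half_line (s n)" for n
    using simple_function_compose[OF js, of f' n] by (simp add: s_def[abs_def] o_def)
  have sH: "s n t \<in> hardy2" for n t by (simp add: s_def f')
  have sfin: "emeasure half_line {t \<in> space half_line. s n t \<noteq> (\<lambda>_. 0)} < \<infinity>" for n
  proof -
    have "{t \<in> space half_line. s n t \<noteq> (\<lambda>_. 0)} \<subseteq> {0<..real n + 1}"
    proof
      fix t assume "t \<in> {t \<in> space half_line. s n t \<noteq> (\<lambda>_. 0)}"
      then have "0 < t" "j n t \<noteq> 0" by (auto simp: sp s_def f'_def split: if_splits)
      then have "d n t \<le> real n" by (auto simp: j_def split: if_splits)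
      moreover have "t \<le> d n t + 1"
      proof -
        have "2 ^ n * t \<le> of_int \<lfloor>2 ^ n * t\<rfloor> + 1" by linarith
        also have "... \<le> of_int \<lfloor>2 ^ n * t\<rfloor> + 2 ^ n" by simp
        finally show ?thesis by (simp add: d_def field_simps)
      qed
      ultimately show "t \<in> {0<..real n + 1}" using \<open>0 < t\<close> by simp
    qed
    then have "emeasure half_line {t \<in> space half_line. s n t \<noteq> (\<lambda>_. 0)} \<le> emeasure half_line {0<..real n + 1}"
      by (rule emeasure_mono) (auto simp: sets_restrict_space_iff)
    also have "... = emeasure lborel {0<..real n + 1}"
      by (rule emeasure_restrict_space) auto
    also have "... < \<infinity>" by simp
    finally show ?thesis .
  qed
  define e where "e n t = hardy2_dist (f t) (s n t)" for n t
  have e0: "0 \<le> e n t" if "0 < t" for n t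
    unfolding e_def by (intro hardy2_norm_nonneg hardy2_diff sH f that)
  have em: "e n \<in> borel_measurable half_line" for n
  proof -
    have "(\<lambda>t. hardy2_dist (f t) (f' r)) \<in> borel_measurable half_line" for r
    proof -
      have "continuous_on {0<..} (\<lambda>t. hardy2_dist (f t) (f' r))"
        unfolding continuous_on_sequentially
      proof (intro allI impI ballI)
        fix u :: "nat \<Rightarrow> real" and t :: real
        assume t: "t \<in> {0<..}" and "(\<forall>n. u n \<in> {0<..}) \<and> u \<longlonglongrightarrow> t"
        then have u: "\<And>n. 0 < u n" "u \<longlonglongrightarrow> t" and t0: "0 < t" by auto
        have "\<bar>hardy2_dist (f (u n)) (f' r) - hardy2_dist (f t) (f' r)\<bar>
            \<le> hardy2_dist (f (u n)) (f t)" for n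
          using hardy2_triangle_diff[OF f[OF u(1)[of n]] f[OF t0] f'[of r]]
            hardy2_triangle_diff[OF f[OF t0] f[OF u(1)[of n]] f'[of r]]
            hardy2_norm_minus_commute[OF f[OF u(1)[of n]] f[OF t0]] by linarith
        then have "\<forall>n. norm (hardy2_dist (f (u n)) (f' r) - hardy2_dist (f t) (f' r))
            \<le> hardy2_dist (f (u n)) (f t)" by simp
        from LIM_zero_cancel[OF Lim_null_comparison[OF always_eventually[OF this] cont[OF t0 u]]]
        show "((\<lambda>t. hardy2_dist (f t) (f' r)) \<circ> u) \<longlonglongrightarrow> hardy2_dist (f t) (f' r)"
          by (simp add: o_def)
      qed
      from borel_measurable_continuous_on_restrict[OF this] show ?thesis
        using measurable_cong_sets[OF sets_restrict_space_cong[OF sets_lborel] refl] by blast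
    qed
    moreover have "j n \<in> half_line \<rightarrow>\<^sub>M count_space (range (j n))"
      unfolding measurable_count_space_eq2[OF jfin] using simple_functionD(2)[OF js] by auto
    ultimately have "(\<lambda>t. hardy2_norm (\<lambda>z. f t z - f' (j n t) z)) \<in> borel_measurable half_line"
      using measurable_compose_countable'[of "range (j n)" "\<lambda>r t. hardy2_dist (f t) (f' r)" half_line borel "j n"]
        countable_finite[OF jfin] by blast
    then show ?thesis by (simp add: e_def[abs_def] s_def)
  qed
  have ele: "e n t \<le> w t" if t: "0 < t" for n t
  proof -
    have "hardy2_norm (s n t) \<le> p t + b t"
    proof (cases "0 < d n t \<and> d n t \<le> real n \<and> p (d n t) \<le> p t + b t")
      case True
      then have "s n t = f (d n t)" by (simp add: s_def f'_def j_def)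
      then show ?thesis using True by (simp add: p_def)
    next
      case False
      then have "j n t = 0" unfolding j_def by (rule if_not_P)
      then have "s n t = (\<lambda>_. 0)" by (simp add: s_def f'_def)
      then show ?thesis using b0[of t] p0[OF t] by (simp add: hardy2_zero)
    qed
    moreover have "e n t \<le> hardy2_norm (f t) + hardy2_norm (s n t)"
      using hardy2_triangle_diff[OF f[OF t] hardy2_zero(1) sH[of n t]] hardy2_cmult(2)[OF sH[of n t], of "-1"]
      by (simp add: e_def)
    ultimately show ?thesis by (simp add: w_def p_def)
  qed
  have elim: "(\<lambda>n. e n t) \<longlonglongrightarrow> 0" if t: "0 < t" for t
  proof -
    define u where "u n = (if 0 < d n t then d n t else t)" for n
    have dl: "(\<lambda>n. d n t) \<longlonglongrightarrow> t" unfolding d_def by (rule dyadic_floor_tendsto)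
    have dpos: "\<forall>\<^sub>F n in sequentially. 0 < d n t" using order_tendstoD(1)[OF dl t] .
    then have "\<forall>\<^sub>F n in sequentially. d n t = u n" by eventually_elim (simp add: u_def)
    with dl have ul: "u \<longlonglongrightarrow> t" by (rule Lim_transform_eventually)
    have u0: "0 < u n" for n using t by (simp add: u_def)
    note ulim = cont[OF t u0 ul]
    have "\<forall>\<^sub>F n in sequentially. d n t < t + 1" using order_tendstoD(2)[OF dl] by simp
    moreover have "\<forall>\<^sub>F n in sequentially. t + 1 \<le> real n"
      using filterlim_real_sequentially unfolding filterlim_at_top by blast
    moreover have "\<forall>\<^sub>F n in sequentially. hardy2_dist (f (u n)) (f t) < b t"
      using order_tendstoD(2)[OF ulim b0] .
    ultimately have "\<forall>\<^sub>F n in sequentially. hardy2_dist (f (u n)) (f t) = e n t"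
      using dpos
    proof eventually_elim
      case (elim n)
      have ud: "u n = d n t" using elim by (simp add: u_def)
      have "hardy2_norm (f (u n)) \<le> hardy2_dist (f (u n)) (f t) + hardy2_norm (f t)"
        using hardy2_triangle_diff[OF f[OF u0[of n]] f[OF t] hardy2_zero(1)] by simp
      then have "p (d n t) \<le> p t + b t" using elim ud by (simp add: p_def)
      then have "s n t = f (u n)" using elim ud by (simp add: s_def f'_def j_def)
      then show ?case using hardy2_norm_minus_commute[OF f[OF u0[of n]] f[OF t]] by (simp add: e_def)
    qed
    with ulim show ?thesis by (rule Lim_transform_eventually)
  qed
  have nle: "norm (e n t) \<le> w t" "norm (e n t) \<le> norm (w t)" if "t \<in> space half_line" for n t
    using e0[of t n] ele[of t n] that by (simp_all add: sp)
  have eint: "integrable half_line (e n)" for n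
    by (rule Bochner_Integration.integrable_bound[OF wi em AE_I2[OF nle(2)]])
  have Elim: "(\<lambda>n. \<integral>t. e n t \<partial>half_line) \<longlonglongrightarrow> 0"
  proof -
    have "(\<lambda>n. \<integral>t. e n t \<partial>half_line) \<longlonglongrightarrow> (\<integral>t. 0 \<partial>half_line)"
      by (rule integral_dominated_convergence[OF _ em wi _ AE_I2[OF nle(1)]])
        (use elim in \<open>auto simp: sp intro!: AE_I2\<close>)
    then show ?thesis by simp
  qed
  have enn: "(\<integral>\<^sup>+t. ennreal (e n t) \<partial>half_line) = ennreal (\<integral>t. e n t \<partial>half_line)" for n
    by (rule nn_integral_eq_integral[OF eint]) (use e0 in \<open>auto simp: sp intro!: AE_I2\<close>)
  let ?S = "\<lambda>n. simple_integral_fun half_line (s n)"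
  have SH: "?S n \<in> hardy2" for n by (rule simple_integral_fun_in_hardy2[OF ss]) (use sH in auto)
  have diff: "hardy2_dist (?S m) (?S n) \<le> (\<integral>t. e m t \<partial>half_line) + (\<integral>t. e n t \<partial>half_line)" for m n
  proof -
    have "hardy2_dist (?S m) (?S n) \<le> (\<integral>t. e m t + e n t \<partial>half_line)"
    proof (rule hardy2_norm_simple_integral_diff[OF ss _ sfin ss _ sfin])
      show "integrable half_line (\<lambda>t. e m t + e n t)" using eint by simp
      fix t assume "t \<in> space half_line"
      then have t: "0 < t" by (simp add: sp)
      show "hardy2_dist (s m t) (s n t) \<le> e m t + e n t"
        using hardy2_triangle_diff[OF sH[of m t] f[OF t] sH[of n t]] hardy2_norm_minus_commute[OF sH[of m t] f[OF t]]
        by (simp add: e_def)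
    qed (use sH in auto)
    then show ?thesis using eint by simp
  qed
  have cauchy: "\<exists>N. \<forall>m\<ge>N. \<forall>n\<ge>N. hardy2_dist (?S m) (?S n) < \<epsilon>" if \<epsilon>: "0 < \<epsilon>" for \<epsilon>
  proof -
    have "\<forall>\<^sub>F n in sequentially. (\<integral>t. e n t \<partial>half_line) < \<epsilon> / 2"
      by (rule order_tendstoD(2)[OF Elim]) (use \<epsilon> in simp)
    then obtain N where N: "\<And>n. N \<le> n \<Longrightarrow> (\<integral>t. e n t \<partial>half_line) < \<epsilon> / 2"
      unfolding eventually_sequentially by blast
    have "hardy2_dist (?S m) (?S n) < \<epsilon>" if "N \<le> m" "N \<le> n" for m n
      using diff[of m n] N[OF that(1)] N[OF that(2)] by linarith
    then show ?thesis by blast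
  qed
  obtain I where I: "I \<in> hardy2" "(\<lambda>n. hardy2_dist (?S n) I) \<longlonglongrightarrow> 0"
    by (rule hardy2_complete[OF SH cauchy])
  have "has_bochner_integral_in hardy2 hardy2_norm half_line f I"
    unfolding has_bochner_integral_in_def
  proof (intro conjI exI[of _ s])
    show "\<forall>t\<in>space half_line. f t \<in> hardy2" using f by (simp add: sp)
    show "\<forall>n. simple_function half_line (s n) \<and> s n ` space half_line \<subseteq> hardy2 \<and>
        emeasure half_line {t \<in> space half_line. s n t \<noteq> (\<lambda>_. 0)} < \<infinity>"
      using ss sH sfin by blast
    show "\<forall>n. (\<lambda>t. hardy2_dist (f t) (s n t)) \<in> borel_measurable half_line"
      using em by (simp add: e_def[abs_def])
    show "(\<lambda>n. \<integral>\<^sup>+t. ennreal (hardy2_dist (f t) (s n t)) \<partial>half_line) \<longlonglongrightarrow> 0"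
      using tendsto_ennrealI[OF Elim] unfolding enn[symmetric] by (simp add: e_def)
  qed (use I in auto)
  then show thesis by (rule that)
qed

section \<open>The operator as an average over dilations\<close>

lemma integrable_Beta_lborel:
  fixes a b :: real
  assumes "0 < a" "0 < b"
  shows "integrable lborel (\<lambda>t. indicator {0<..<1} t * (t powr (a - 1) * (1 - t) powr (b - 1)))"
    and "(\<integral>t. indicator {0<..<1} t * (t powr (a - 1) * (1 - t) powr (b - 1)) \<partial>lborel) = Beta a b"
proof -
  have eq: "indicator {0<..<1} t * (t powr (a - 1) * (1 - t) powr (b - 1))
      = indicator {0..1} t *\<^sub>R (t powr (a - 1) * (1 - t) powr (b - 1))" for t :: real
    by (cases "t = 0 \<or> t = 1") (auto simp: indicator_def)
  show "integrable lborel (\<lambda>t. indicator {0<..<1} t * (t powr (a - 1) * (1 - t) powr (b - 1)))"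
    using integrable_Beta[OF assms] unfolding eq set_integrable_def .
  have "(LINT t:{0..1}|lborel. t powr (a - 1) * (1 - t) powr (b - 1)) = Beta a b"
    unfolding set_borel_integral_eq_integral(2)[OF integrable_Beta[OF assms]]
    by (rule integral_unique[OF has_integral_Beta_real[OF assms]])
  then show "(\<integral>t. indicator {0<..<1} t * (t powr (a - 1) * (1 - t) powr (b - 1)) \<partial>lborel) = Beta a b"
    unfolding eq set_lebesgue_integral_def .
qed

lemma exp_substitution_real:
  fixes g :: "real \<Rightarrow> real"
  assumes g: "g \<in> borel_measurable borel"
  shows "integrable lborel (\<lambda>t. indicator {0<..} t * (exp (- t) * g (exp (- t)))) \<longleftrightarrow>
      integrable lborel (\<lambda>r. indicator {0<..<1} r * g r)"
    and "(\<integral>t. indicator {0<..} t * (exp (- t) * g (exp (- t))) \<partial>lborel) = (\<integral>r. indicator {0<..<1} r * g r \<partial>lborel)"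
proof -
  have img: "(\<lambda>t. exp (- t)) ` {0<..} = {0<..<1::real}"
  proof safe
    fix r :: real assume "r \<in> {0<..<1}"
    then have "r = exp (- (- ln r))" "- ln r \<in> {0<..}" by auto
    then show "r \<in> (\<lambda>t. exp (- t)) ` {0<..}" by (rule image_eqI)
  qed auto
  have cv: "((\<lambda>t. exp (- t) * g (exp (- t))) absolutely_integrable_on {0<..} \<and>
      integral {0<..} (\<lambda>t. exp (- t) * g (exp (- t))) = b) \<longleftrightarrow>
      (g absolutely_integrable_on {0<..<1} \<and> integral {0<..<1} g = b)" for b
  proof -
    have der: "((\<lambda>t. exp (- t)) has_field_derivative - exp (- t)) (at t within {0<..})" for t :: real
      by (auto intro!: derivative_eq_intros)
    have inj: "inj_on (\<lambda>t. exp (- t)) ({0<..} :: real set)" by (auto simp: inj_on_def)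
    show ?thesis
      using has_absolute_integral_change_of_variables_1'[OF _ der inj, of g b] unfolding img by simp
  qed
  have leb: "f absolutely_integrable_on A \<longleftrightarrow> set_integrable lborel A f"
    if "f \<in> borel_measurable borel" "A \<in> sets borel" for f :: "real \<Rightarrow> real" and A
    unfolding set_integrable_def by (rule integrable_completion) (use that in measurable)
  note l1 = leb[of "\<lambda>t. exp (- t) * g (exp (- t))" "{0<..}"] and l2 = leb[OF g, of "{0<..<1}"]
  have m: "(\<lambda>t. exp (- t) * g (exp (- t))) \<in> borel_measurable borel" using g by measurable
  show iff: "integrable lborel (\<lambda>t. indicator {0<..} t * (exp (- t) * g (exp (- t)))) \<longleftrightarrow>
      integrable lborel (\<lambda>r. indicator {0<..<1} r * g r)"
    using cv l1[OF m] l2 by (auto simp: set_integrable_def)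
  show "(\<integral>t. indicator {0<..} t * (exp (- t) * g (exp (- t))) \<partial>lborel) = (\<integral>r. indicator {0<..<1} r * g r \<partial>lborel)"
  proof (cases "integrable lborel (\<lambda>r. indicator {0<..<1} r * g r)")
    case True
    then have si: "set_integrable lborel {0<..} (\<lambda>t. exp (- t) * g (exp (- t)))" "set_integrable lborel {0<..<1} g"
      using iff by (auto simp: set_integrable_def)
    then have "integral {0<..} (\<lambda>t. exp (- t) * g (exp (- t))) = integral {0<..<1} g"
      using cv l1[OF m] l2 by auto
    with set_borel_integral_eq_integral(2)[OF si(1)] set_borel_integral_eq_integral(2)[OF si(2)]
    show ?thesis by (simp add: set_lebesgue_integral_def)
  next
    case False
    then show ?thesis using iff by (simp add: not_integrable_integral_eq)
  qed
qed

lemma exp_substitution_complex: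
  fixes g :: "real \<Rightarrow> complex"
  assumes g: "g \<in> borel_measurable borel"
    and int: "integrable lborel (\<lambda>t. indicator {0<..} t *\<^sub>R (of_real (exp (- t)) * g (exp (- t))))"
  shows "integrable lborel (\<lambda>r. indicator {0<..<1} r *\<^sub>R g r)"
    and "(\<integral>t. indicator {0<..} t *\<^sub>R (of_real (exp (- t)) * g (exp (- t))) \<partial>lborel) = (\<integral>r. indicator {0<..<1} r *\<^sub>R g r \<partial>lborel)"
proof -
  let ?f = "\<lambda>t. indicator {0<..} t *\<^sub>R (of_real (exp (- t)) * g (exp (- t)))"
  let ?h = "\<lambda>r. indicator {0<..<1} r *\<^sub>R g r"
  have R: "(\<lambda>r. Re (g r)) \<in> borel_measurable borel" and I: "(\<lambda>r. Im (g r)) \<in> borel_measurable borel"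
    using g by measurable
  have fR: "Re (?f t) = indicator {0<..} t * (exp (- t) * Re (g (exp (- t))))"
    and fI: "Im (?f t) = indicator {0<..} t * (exp (- t) * Im (g (exp (- t))))" for t by simp_all
  have hR: "Re (?h r) = indicator {0<..<1} r * Re (g r)" and hI: "Im (?h r) = indicator {0<..<1} r * Im (g r)" for r by simp_all
  have iR: "integrable lborel (\<lambda>r. Re (?h r))" and iI: "integrable lborel (\<lambda>r. Im (?h r))"
    using exp_substitution_real(1)[OF R] exp_substitution_real(1)[OF I] integrable_Re[OF int] integrable_Im[OF int]
    unfolding hR hI fR fI by auto
  have "integrable lborel (\<lambda>r. of_real (Re (?h r)) + \<i> * of_real (Im (?h r)))"
    by (intro Bochner_Integration.integrable_add integrable_mult_right integrable_of_real iR iI)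
  then show ih: "integrable lborel ?h" by (simp only: complex_eq[symmetric])
  show "(\<integral>t. ?f t \<partial>lborel) = (\<integral>r. ?h r \<partial>lborel)"
  proof (rule complex_eqI)
    show "Re (\<integral>t. ?f t \<partial>lborel) = Re (\<integral>r. ?h r \<partial>lborel)"
      unfolding integral_Re[OF int, symmetric] integral_Re[OF ih, symmetric] fR hR by (rule exp_substitution_real(2)[OF R])
    show "Im (\<integral>t. ?f t \<partial>lborel) = Im (\<integral>r. ?h r \<partial>lborel)"
      unfolding integral_Im[OF int, symmetric] integral_Im[OF ih, symmetric] fI hI by (rule exp_substitution_real(2)[OF I])
  qed
qed

definition cesaro_density :: "real \<Rightarrow> real \<Rightarrow> real" where
  "cesaro_density \<alpha> r = indicator {0<..<1} r * (\<alpha> * (1 - r) powr (\<alpha> - 1))"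

text \<open>After the substitution \<open>r = exp (-t)\<close> the operator becomes an average
  over the probability measure \<open>\<alpha> (1 - r)\<^sup>\<alpha>\<^sup>-\<^sup>1 dr\<close> on \<open>(0, 1)\<close>.\<close>
definition cesaro_measure :: "real \<Rightarrow> real measure" where
  "cesaro_measure \<alpha> = density lborel (cesaro_density \<alpha>)"

lemma cesaro_density_nonneg: "0 < \<alpha> \<Longrightarrow> 0 \<le> cesaro_density \<alpha> r"
  by (simp add: cesaro_density_def)

lemma cesaro_density_measurable[measurable]: "cesaro_density \<alpha> \<in> borel_measurable borel"
  unfolding cesaro_density_def by measurable

lemma sets_cesaro_measure[measurable_cong, simp]: "sets (cesaro_measure \<alpha>) = sets borel"
  by (simp add: cesaro_measure_def)

lemma space_cesaro_measure[simp]: "space (cesaro_measure \<alpha>) = UNIV"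
  by (simp add: cesaro_measure_def)

lemma integrable_cesaro_measure:
  fixes f :: "real \<Rightarrow> 'b::{banach, second_countable_topology}"
  assumes "0 < \<alpha>" "f \<in> borel_measurable borel"
  shows "integrable (cesaro_measure \<alpha>) f \<longleftrightarrow> integrable lborel (\<lambda>r. cesaro_density \<alpha> r *\<^sub>R f r)"
  unfolding cesaro_measure_def by (rule integrable_density) (use assms cesaro_density_nonneg in auto)

lemma integral_cesaro_measure:
  fixes f :: "real \<Rightarrow> 'b::{banach, second_countable_topology}"
  assumes "0 < \<alpha>" "f \<in> borel_measurable borel"
  shows "(\<integral>r. f r \<partial>cesaro_measure \<alpha>) = (\<integral>r. cesaro_density \<alpha> r *\<^sub>R f r \<partial>lborel)"
  unfolding cesaro_measure_def by (rule integral_density) (use assms cesaro_density_nonneg in auto)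

lemma AE_cesaro_measure: "0 < \<alpha> \<Longrightarrow> AE r in cesaro_measure \<alpha>. 0 < r \<and> r < 1"
  unfolding cesaro_measure_def by (subst AE_density) (auto simp: cesaro_density_def indicator_def)

lemma cesaro_measure_powr:
  assumes "0 < \<alpha>" "-1 < a"
  shows "integrable (cesaro_measure \<alpha>) (\<lambda>r. r powr a)" and "(\<integral>r. r powr a \<partial>cesaro_measure \<alpha>) = \<alpha> * Beta (a + 1) \<alpha>"
proof -
  have eq: "cesaro_density \<alpha> r *\<^sub>R r powr a = \<alpha> * (indicator {0<..<1} r * (r powr (a + 1 - 1) * (1 - r) powr (\<alpha> - 1)))" for r
    by (simp add: cesaro_density_def)
  show "integrable (cesaro_measure \<alpha>) (\<lambda>r. r powr a)"
    by (subst integrable_cesaro_measure[OF assms(1)], measurable) (unfold eq, intro integrable_mult_right integrable_Beta_lborel, use assms in auto)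
  show "(\<integral>r. r powr a \<partial>cesaro_measure \<alpha>) = \<alpha> * Beta (a + 1) \<alpha>"
    by (subst integral_cesaro_measure[OF assms(1)], measurable)
      (unfold eq integral_mult_right_zero, subst integrable_Beta_lborel(2), use assms in auto)
qed

lemma Gamma_plus1_pos: "0 < \<alpha> \<Longrightarrow> Gamma (\<alpha> + 1) = \<alpha> * Gamma \<alpha>" for \<alpha> :: real
  by (rule Gamma_plus1) (auto elim!: nonpos_Ints_cases)

lemma prob_space_cesaro_measure:
  assumes "0 < \<alpha>"
  shows "prob_space (cesaro_measure \<alpha>)"
proof (rule prob_spaceI)
  have eq: "cesaro_density \<alpha> r = \<alpha> * (indicator {0<..<1} r * (r powr (1 - 1) * (1 - r) powr (\<alpha> - 1)))" for r
    by (simp add: cesaro_density_def indicator_def)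
  have i: "integrable lborel (cesaro_density \<alpha>)" "(\<integral>r. cesaro_density \<alpha> r \<partial>lborel) = 1"
  proof -
    show "integrable lborel (cesaro_density \<alpha>)"
      unfolding eq[abs_def] by (intro integrable_mult_right integrable_Beta_lborel) (use assms in auto)
    have "(\<integral>r. cesaro_density \<alpha> r \<partial>lborel) = \<alpha> * Beta 1 \<alpha>"
      unfolding eq integral_mult_right_zero by (subst integrable_Beta_lborel(2)) (use assms in auto)
    then show "(\<integral>r. cesaro_density \<alpha> r \<partial>lborel) = 1"
      using assms less_imp_neq[OF Gamma_real_pos[of \<alpha>]] by (simp add: Beta_def Gamma_plus1_pos add.commute[of 1])
  qed
  have "emeasure (cesaro_measure \<alpha>) UNIV = (\<integral>\<^sup>+r. ennreal (cesaro_density \<alpha> r) \<partial>lborel)"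
    unfolding cesaro_measure_def by (subst emeasure_density) auto
  also have "... = 1" using nn_integral_eq_integral[OF i(1)] i(2) cesaro_density_nonneg[OF assms] by simp
  finally show "emeasure (cesaro_measure \<alpha>) (space (cesaro_measure \<alpha>)) = 1" by simp
qed

definition cesaro_weight :: "real \<Rightarrow> real \<Rightarrow> real" where
  "cesaro_weight \<alpha> t = \<alpha> * (1 - exp (- t)) powr (\<alpha> - 1) * exp (- t / 2)"

lemma cesaro_weight_integrable:
  assumes "0 < \<alpha>"
  shows "integrable half_line (cesaro_weight \<alpha>)"
proof -
  define g where "g r = \<alpha> * (r powr (1 / 2 - 1) * (1 - r) powr (\<alpha> - 1))" for r :: real
  have gm: "g \<in> borel_measurable borel" unfolding g_def by measurable
  have "integrable lborel (\<lambda>r. \<alpha> * (indicator {0<..<1} r * (r powr (1 / 2 - 1) * (1 - r) powr (\<alpha> - 1))))"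
    by (intro integrable_mult_right integrable_Beta_lborel) (use assms in auto)
  then have "integrable lborel (\<lambda>r. indicator {0<..<1} r * g r)"
    by (simp add: g_def mult_ac)
  then have "integrable lborel (\<lambda>t. indicator {0<..} t * (exp (- t) * g (exp (- t))))"
    using exp_substitution_real(1)[OF gm] by simp
  moreover have "exp (- t) * g (exp (- t)) = cesaro_weight \<alpha> t" for t
  proof -
    have "exp (- t) * exp (- t) powr (1 / 2 - 1) = exp (- t / 2)"
      by (simp add: powr_def flip: exp_add)
    then show ?thesis by (simp add: g_def cesaro_weight_def mult_ac)
  qed
  ultimately show ?thesis by (simp add: integrable_restrict_space set_integrable_def)
qed

lemma dilation_measurable:
  assumes G: "G \<in> hardy2" and w: "w \<in> half_plane"
  shows "(\<lambda>r::real. G (w / of_real r) / of_real r) \<in> borel_measurable borel"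
proof -
  have w0: "0 < Re w" using w by (simp add: half_plane_def)
  have "continuous_on {0<..} (\<lambda>r::real. G (w / of_real r) / of_real r)"
    by (intro continuous_intros continuous_on_compose2[OF holomorphic_on_imp_continuous_on[OF hardy2_holomorphic[OF G]]])
      (use w0 in \<open>auto simp: Re_divide_of_real\<close>)
  then have "(\<lambda>r. indicator {0<..} r *\<^sub>R (G (w / of_real r) / of_real r)) \<in> borel_measurable borel"
    by (intro borel_measurable_continuous_on_indicator) auto
  moreover have "indicator {0<..} r *\<^sub>R (G (w / of_real r) / of_real r) = G (w / of_real r) / of_real r" for r :: real
    using hardy2_outside[OF G, of "w / of_real r"] w0
    by (auto simp: indicator_def Re_divide_of_real divide_nonneg_nonpos)
  ultimately show ?thesis by simp
qed

lemma cesaro_adj_eval: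
  assumes \<alpha>: "0 < \<alpha>" and G: "G \<in> hardy2" and w: "w \<in> half_plane"
  shows "integrable (cesaro_measure \<alpha>) (\<lambda>r. G (w / of_real r) / of_real r)"
    and "cesaro_adj \<alpha> G w = (\<integral>r. G (w / of_real r) / of_real r \<partial>cesaro_measure \<alpha>)"
proof -
  define f where "f t = (\<lambda>z. of_real (\<alpha> * (1 - exp (- t)) powr (\<alpha> - 1) * exp (- t / 2)) * T2 (- t) G z)" for t
  have fw: "f t = (\<lambda>z. of_real (cesaro_weight \<alpha> t) * T2 (- t) G z)" for t
    by (simp add: f_def cesaro_weight_def)
  have wpos: "0 \<le> cesaro_weight \<alpha> t" for t using \<alpha> by (simp add: cesaro_weight_def)
  have fH: "f t \<in> hardy2" for t unfolding fw by (intro hardy2_cmult T2_in_hardy2 G)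
  have fN: "hardy2_norm (f t) = cesaro_weight \<alpha> t * hardy2_norm G" for t
    unfolding fw by (simp add: hardy2_cmult T2_in_hardy2 G wpos)
  have cont: "(\<lambda>n. hardy2_dist (f (u n)) (f t)) \<longlonglongrightarrow> 0"
    if t: "0 < t" and u: "\<And>n. 0 < u n" "u \<longlonglongrightarrow> t" for t u
  proof (rule hardy2_tendsto_of_pointwise[OF fH fH])
    have cw: "(\<lambda>n. cesaro_weight \<alpha> (u n)) \<longlonglongrightarrow> cesaro_weight \<alpha> t"
      unfolding cesaro_weight_def by (intro tendsto_intros u) (use t in auto)
    show "(\<lambda>n. hardy2_norm (f (u n))) \<longlonglongrightarrow> hardy2_norm (f t)"
      unfolding fN by (intro tendsto_intros cw)
    show "(\<lambda>n. f (u n) z) \<longlonglongrightarrow> f t z" for z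
      unfolding fw by (intro tendsto_intros cw T2_tendsto G u)
  qed
  have "integrable half_line (\<lambda>t. hardy2_norm (f t))"
    unfolding fN using cesaro_weight_integrable[OF \<alpha>] by simp
  then obtain I where I: "has_bochner_integral_in hardy2 hardy2_norm half_line f I"
    using bochner_integral_in_hardy2_exists[of f] fH cont by blast
  have meas: "(\<lambda>t. f t z) \<in> borel_measurable half_line" if z: "z \<in> half_plane" for z
  proof -
    have "continuous_on {0<..} (\<lambda>t. f t z)"
      unfolding continuous_on_sequentially
    proof (intro allI impI ballI)
      fix u :: "nat \<Rightarrow> real" and t :: real assume t: "t \<in> {0<..}" and "(\<forall>n. u n \<in> {0<..}) \<and> u \<longlonglongrightarrow> t"
      then have u: "u \<longlonglongrightarrow> t" by simp
      have cw: "(\<lambda>n. cesaro_weight \<alpha> (u n)) \<longlonglongrightarrow> cesaro_weight \<alpha> t"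
        unfolding cesaro_weight_def by (intro tendsto_intros u) (use t in auto)
      show "((\<lambda>t. f t z) \<circ> u) \<longlonglongrightarrow> f t z"
        unfolding fw o_def by (intro tendsto_intros cw T2_tendsto G u)
    qed
    from borel_measurable_continuous_on_restrict[OF this] show ?thesis
      using measurable_cong_sets[OF sets_restrict_space_cong[OF sets_lborel] refl] by blast
  qed
  have val: "J z = (\<integral>t. f t z \<partial>half_line)" if "has_bochner_integral_in hardy2 hardy2_norm half_line f J" "z \<in> half_plane" for J z
    by (rule has_bochner_integral_in_hardy2_eval(2)[OF that(1) meas[OF that(2)] that(2)])
  have uniq: "J = I" if J: "has_bochner_integral_in hardy2 hardy2_norm half_line f J" for J
  proof
    fix z
    have JI: "J \<in> hardy2" "I \<in> hardy2" using J I by (simp_all add: has_bochner_integral_in_def)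
    show "J z = I z"
      using val[OF J, of z] val[OF I, of z] hardy2_outside[OF JI(1), of z] hardy2_outside[OF JI(2), of z]
      by (cases "z \<in> half_plane") (auto simp: half_plane_def)
  qed
  have "cesaro_adj \<alpha> G = I"
    unfolding cesaro_adj_def f_def[symmetric] by (rule the_equality, rule I, erule uniq)
  then have e1: "cesaro_adj \<alpha> G w = (\<integral>t. f t w \<partial>half_line)" using val[OF I w] by simp
  have i1: "integrable half_line (\<lambda>t. f t w)"
    by (rule has_bochner_integral_in_hardy2_eval(1)[OF I meas[OF w] w])
  define g where "g r = of_real (\<alpha> * (1 - r) powr (\<alpha> - 1)) * (G (w / of_real r) / of_real r)" for r :: real
  note dm[measurable] = dilation_measurable[OF G w]
  have gm: "g \<in> borel_measurable borel" unfolding g_def by measurable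
  have fg: "f t w = of_real (exp (- t)) * g (exp (- t))" for t
  proof -
    have "exp (- t / 2) * exp (t / 2) = (1::real)" by (simp flip: exp_add)
    then have "complex_of_real (exp (- t / 2)) * of_real (exp (t / 2)) = 1" by (simp flip: of_real_mult)
    then show ?thesis
      by (simp add: fw cesaro_weight_def T2_def g_def exp_minus field_simps)
  qed
  have i2: "integrable lborel (\<lambda>t. indicator {0<..} t *\<^sub>R (of_real (exp (- t)) * g (exp (- t))))"
    using i1 by (simp add: integrable_restrict_space set_integrable_def fg)
  have gd: "indicator {0<..<1} r *\<^sub>R g r = cesaro_density \<alpha> r *\<^sub>R (G (w / of_real r) / of_real r)" for r
    by (simp add: g_def cesaro_density_def indicator_def scaleR_conv_of_real)
  show "integrable (cesaro_measure \<alpha>) (\<lambda>r. G (w / of_real r) / of_real r)"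
    using exp_substitution_complex(1)[OF gm i2] unfolding gd integrable_cesaro_measure[OF \<alpha> dm] .
  show "cesaro_adj \<alpha> G w = (\<integral>r. G (w / of_real r) / of_real r \<partial>cesaro_measure \<alpha>)"
    unfolding e1 integral_cesaro_measure[OF \<alpha> dm] gd[symmetric] exp_substitution_complex(2)[OF gm i2, symmetric]
    by (simp add: integral_restrict_space set_lebesgue_integral_def fg)
qed

section \<open>Injectivity\<close>

lemma continuous_moments_zero:
  fixes f :: "real \<Rightarrow> real"
  assumes f: "continuous_on {0..1} f" and mom: "\<And>n. integral {0..1} (\<lambda>x. (1 - x) ^ n * f x) = 0"
    and x: "x \<in> {0..1}"
  shows "f x = 0"
proof -
  obtain M where "\<forall>x\<in>{0..1}. \<bar>f x\<bar> \<le> M"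
    using compact_imp_bounded[OF compact_continuous_image[OF f compact_Icc]] unfolding bounded_real by auto
  then have M: "\<bar>f x\<bar> \<le> M" if "x \<in> {0..1}" for x using that by blast
  have M0: "0 \<le> M" using M[of 0] by simp
  have cf2: "continuous_on {0..1} (\<lambda>x. (f x)\<^sup>2)" by (intro continuous_intros f)
  have "integral {0..1} (\<lambda>x. (f x)\<^sup>2) \<le> e * M" if e: "0 < e" for e
  proof -
    have "continuous_on {0..1} (\<lambda>u. f (1 - u))"
      by (intro continuous_on_compose2[OF f] continuous_intros) auto
    then obtain g where g: "real_polynomial_function g" "\<And>u. u \<in> {0..1} \<Longrightarrow> \<bar>f (1 - u) - g u\<bar> < e"
      using Stone_Weierstrass_real_polynomial_function[OF compact_Icc _ e] by metis
    obtain a n where an: "g = (\<lambda>u. \<Sum>i\<le>n. a i * u ^ i)"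
      using g(1) unfolding real_polynomial_function_iff_sum by blast
    have ii: "(\<lambda>x. (1 - x) ^ i * f x) integrable_on {0..1}" for i
      by (intro integrable_continuous_real continuous_intros f)
    have "integral {0..1} (\<lambda>x. g (1 - x) * f x) = integral {0..1} (\<lambda>x. \<Sum>i\<le>n. a i * ((1 - x) ^ i * f x))"
      by (simp add: an sum_distrib_right mult.assoc)
    also have "... = (\<Sum>i\<le>n. a i * integral {0..1} (\<lambda>x. (1 - x) ^ i * f x))"
      by (subst integral_sum) (auto intro!: integrable_on_mult_right ii)
    finally have z: "integral {0..1} (\<lambda>x. g (1 - x) * f x) = 0" by (simp add: mom)
    have gf: "(\<lambda>x. g (1 - x) * f x) integrable_on {0..1}"
      unfolding an by (intro integrable_continuous_real continuous_intros f)
    have f2: "(\<lambda>x. (f x)\<^sup>2) integrable_on {0..1}" by (intro integrable_continuous_real cf2)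
    have "integral {0..1} (\<lambda>x. (f x)\<^sup>2) = integral {0..1} (\<lambda>x. (f x)\<^sup>2 - g (1 - x) * f x)"
      by (subst Henstock_Kurzweil_Integration.integral_diff[OF f2 gf]) (simp add: z)
    also have "... \<le> integral {0..1} (\<lambda>x::real. e * M)"
    proof (rule integral_le)
      fix x :: real assume x: "x \<in> {0..1}"
      have "(f x)\<^sup>2 - g (1 - x) * f x = (f x - g (1 - x)) * f x" by (simp add: power2_eq_square algebra_simps)
      also have "... \<le> \<bar>f x - g (1 - x)\<bar> * \<bar>f x\<bar>" by (metis abs_ge_self abs_mult)
      also have "... \<le> e * M" by (intro mult_mono M x) (use g(2)[of "1 - x"] x e in auto)
      finally show "(f x)\<^sup>2 - g (1 - x) * f x \<le> e * M" .
    qed (use f2 gf in \<open>auto intro: integrable_diff\<close>)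
    also have "... = e * M" by simp
    finally show ?thesis .
  qed
  note small = this
  have "integral {0..1} (\<lambda>x. (f x)\<^sup>2) \<le> 0"
  proof (rule field_le_epsilon)
    fix e :: real assume e: "0 < e"
    have "integral {0..1} (\<lambda>x. (f x)\<^sup>2) \<le> e / (M + 1) * M" by (rule small) (use e M0 in auto)
    also have "... \<le> e" using e M0 by (simp add: divide_le_eq mult_left_mono)
    finally show "integral {0..1} (\<lambda>x. (f x)\<^sup>2) \<le> 0 + e" by simp
  qed
  moreover have "0 \<le> integral {0..1} (\<lambda>x. (f x)\<^sup>2)"
    by (rule Henstock_Kurzweil_Integration.integral_nonneg[OF integrable_continuous_real[OF cf2]]) simp
  ultimately have "integral {0..1} (\<lambda>x. (f x)\<^sup>2) = 0" by simp
  then have "(f x)\<^sup>2 = 0" using integral_eq_0_iff[OF cf2] x by auto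
  then show ?thesis by simp
qed

lemma Beta_integral_shift:
  fixes v :: real
  assumes "v < 1" "0 < a" "0 < b"
  shows "integrable lborel (\<lambda>y. indicator {v<..<1} y * ((1 - y) powr (b - 1) * (y - v) powr (a - 1)))"
    and "(\<integral>y. indicator {v<..<1} y * ((1 - y) powr (b - 1) * (y - v) powr (a - 1)) \<partial>lborel) = (1 - v) powr (a + b - 1) * Beta a b"
proof -
  let ?f = "\<lambda>y. indicator {v<..<1} y * ((1 - y) powr (b - 1) * (y - v) powr (a - 1)) :: real"
  have eq: "?f (v + (1 - v) * x) = (1 - v) powr (a + b - 2) * (indicator {0<..<1} x * (x powr (a - 1) * (1 - x) powr (b - 1)))" for x
  proof (cases "x \<in> {0<..<1}")
    case True
    have "v + (1 - v) * x < v + (1 - v) * 1" using assms True by (intro add_strict_left_mono mult_strict_left_mono) auto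
    then have ind: "v + (1 - v) * x \<in> {v<..<1}" using assms True by auto
    have e1: "1 - (v + (1 - v) * x) = (1 - v) * (1 - x)" by (simp add: algebra_simps)
    have "((1 - v) * (1 - x)) powr (b - 1) = (1 - v) powr (b - 1) * (1 - x) powr (b - 1)"
      "((1 - v) * x) powr (a - 1) = (1 - v) powr (a - 1) * x powr (a - 1)"
      using assms True by (auto simp: powr_mult)
    moreover have "(1 - v) powr (a + b - 2) = (1 - v) powr (b - 1) * (1 - v) powr (a - 1)"
      by (simp add: algebra_simps flip: powr_add)
    ultimately show ?thesis using ind True unfolding e1 by simp
  next
    case False
    have "v + (1 - v) * x \<notin> {v<..<1}"
    proof
      assume "v + (1 - v) * x \<in> {v<..<1}"
      then have "v < v + (1 - v) * x" "v + (1 - v) * x < 1" unfolding greaterThanLessThan_iff by blast+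
      then have "0 < (1 - v) * x" "(1 - v) * x < (1 - v) * 1" by (simp_all add: algebra_simps)
      then have "0 < x" "x < 1"
        using zero_less_mult_pos[of "1 - v" x] mult_less_cancel_left_pos[of "1 - v" x 1] assms by linarith+
      then show False using False by simp
    qed
    then show ?thesis using False by simp
  qed
  have i: "integrable lborel (\<lambda>x. ?f (v + (1 - v) * x))"
    unfolding eq by (intro integrable_mult_right integrable_Beta_lborel assms)
  then show "integrable lborel ?f" using lborel_integrable_real_affine_iff[of "1 - v" ?f v] assms by simp
  have "(\<integral>y. ?f y \<partial>lborel) = \<bar>1 - v\<bar> *\<^sub>R (\<integral>x. ?f (v + (1 - v) * x) \<partial>lborel)"
    by (rule lborel_integral_real_affine) (use assms in simp)
  also have "... = (1 - v) * ((1 - v) powr (a + b - 2) * Beta a b)"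
    unfolding eq integral_mult_right_zero integrable_Beta_lborel(2)[OF assms(2,3)] using assms by simp
  also have "... = (1 - v) powr (a + b - 1) * Beta a b"
    using assms powr_add[of "1 - v" 1 "a + b - 2"] by simp
  finally show "(\<integral>y. ?f y \<partial>lborel) = (1 - v) powr (a + b - 1) * Beta a b" .
qed

lemma hardy2_inversion_bound:
  assumes G: "G \<in> hardy2" and v: "0 < v"
  shows "cmod (G (1 / of_real v)) \<le> hardy2_norm G * v powr (1 / 2)"
proof -
  have "Re (1 / of_real v) = 1 / v" by (simp add: Re_divide_of_real)
  then have "cmod (G (1 / of_real v)) \<le> hardy2_norm G / sqrt (2 * (1 / v))"
    using hardy2_point_bound[OF G, of "1 / of_real v"] v by (simp add: half_plane_def)
  also have "... \<le> hardy2_norm G / sqrt (1 / v)"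
    by (intro divide_left_mono) (use v in \<open>auto intro: hardy2_norm_nonneg G divide_right_mono\<close>)
  also have "... = hardy2_norm G * v powr (1 / 2)" using v by (simp add: real_sqrt_divide powr_half_sqrt)
  finally show ?thesis .
qed

text \<open>Up to powers of \<open>y\<close>, \<open>y \<mapsto> cesaro_adj \<alpha> G (1 / y)\<close> is the Riemann--Liouville integral of order
  \<open>\<alpha>\<close> of \<open>v \<mapsto> G (1 / v) / v\<close>; integrating it against \<open>(1 - y)\<^sup>m\<^sup>-\<^sup>\<alpha>\<close> produces, by Euler's Beta
  integral, the \<open>m\<close>-th moment of that function.\<close>
lemma cesaro_adj_zero_imp_moment_zero:
  assumes \<alpha>: "0 < \<alpha>" and G: "G \<in> hardy2" and zero: "\<forall>w\<in>half_plane. cesaro_adj \<alpha> G w = 0"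
    and m: "\<alpha> \<le> real m"
  shows "integrable lborel (\<lambda>v. (indicator {0<..<1} v * (1 - v) ^ m) *\<^sub>R (G (1 / of_real v) / of_real v))"
    and "(\<integral>v. (indicator {0<..<1} v * (1 - v) ^ m) *\<^sub>R (G (1 / of_real v) / of_real v) \<partial>lborel) = 0"
proof -
  define \<beta> where "\<beta> = real m + 1 - \<alpha>"
  have \<beta>: "0 < \<beta>" using m by (simp add: \<beta>_def)
  define k where "k v = G (1 / of_real v) / of_real v" for v :: real
  have km[measurable]: "k \<in> borel_measurable borel"
    unfolding k_def by (rule dilation_measurable[OF G]) (simp add: half_plane_def)
  define \<psi> where "\<psi> v y = indicator {0<..<1} v * (indicator {v<..<1} y * ((1 - y) powr (\<beta> - 1) * (y - v) powr (\<alpha> - 1)))" for v y :: real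
  have \<psi>0: "0 \<le> \<psi> v y" for v y by (simp add: \<psi>_def)
  have \<psi>m[measurable]: "(\<lambda>(v, y). \<psi> v y) \<in> borel_measurable (lborel \<Otimes>\<^sub>M lborel)"
  proof -
    have "\<psi> v y = (if 0 < v \<and> v < y \<and> y < 1 then (1 - y) powr (\<beta> - 1) * (y - v) powr (\<alpha> - 1) else 0)" for v y
      by (auto simp: \<psi>_def indicator_def)
    then show ?thesis by simp
  qed
  have \<psi>i: "integrable lborel (\<psi> v)" and \<psi>v: "(\<integral>y. \<psi> v y \<partial>lborel) = indicator {0<..<1} v * (1 - v) ^ m * Beta \<alpha> \<beta>" for v
  proof -
    have *: "v \<in> {0<..<1} \<Longrightarrow> (1 - v) powr (\<alpha> + \<beta> - 1) = (1 - v) ^ m" by (simp add: \<beta>_def powr_realpow)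
    show "integrable lborel (\<psi> v)" "(\<integral>y. \<psi> v y \<partial>lborel) = indicator {0<..<1} v * (1 - v) ^ m * Beta \<alpha> \<beta>"
      using Beta_integral_shift[OF _ \<alpha> \<beta>, of v] *
      by (cases "v \<in> {0<..<1}"; simp add: \<psi>_def[abs_def])+
  qed
  have B: "0 < Beta \<alpha> \<beta>" using \<alpha> \<beta> by (simp add: Beta_def Gamma_real_pos)
  define H where "H v y = \<psi> v y *\<^sub>R k v" for v y
  have Hm[measurable]: "(\<lambda>(v, y). H v y) \<in> borel_measurable (lborel \<Otimes>\<^sub>M lborel)"
    unfolding H_def by measurable
  have Hint: "(\<integral>y. H v y \<partial>lborel) = Beta \<alpha> \<beta> *\<^sub>R ((indicator {0<..<1} v * (1 - v) ^ m) *\<^sub>R k v)" for v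
    unfolding H_def using \<psi>i[of v] \<psi>v[of v] by simp
  have Hnorm: "(\<integral>y. norm (H v y) \<partial>lborel) = indicator {0<..<1} v * (1 - v) ^ m * Beta \<alpha> \<beta> * cmod (k v)" for v
    unfolding H_def using \<psi>i[of v] \<psi>v[of v] by (simp add: \<psi>0)
  have N: "integrable lborel (\<lambda>v. indicator {0<..<1} v * (1 - v) ^ m * Beta \<alpha> \<beta> * cmod (k v))"
  proof (rule Bochner_Integration.integrable_bound)
    show "integrable lborel (\<lambda>v. Beta \<alpha> \<beta> * hardy2_norm G * (indicator {0<..<1} v * (v powr (1/2 - 1) * (1 - v) powr (1 - 1))))"
      by (intro integrable_mult_right integrable_Beta_lborel) auto
    have "norm (indicator {0<..<1} v * (1 - v) ^ m * Beta \<alpha> \<beta> * cmod (k v))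
        \<le> norm (Beta \<alpha> \<beta> * hardy2_norm G * (indicator {0<..<1} v * (v powr (1/2 - 1) * (1 - v) powr (1 - 1))))" for v
    proof (cases "v \<in> {0<..<1}")
      case True
      have "cmod (k v) \<le> hardy2_norm G * v powr (1 / 2) / v"
        using hardy2_inversion_bound[OF G, of v] True by (simp add: k_def norm_divide divide_right_mono)
      also have "... = hardy2_norm G * v powr (1 / 2 - 1)" using True powr_diff[of v "1 / 2" 1] by simp
      finally have "(1 - v) ^ m * cmod (k v) \<le> 1 * (hardy2_norm G * v powr (1 / 2 - 1))"
        by (intro mult_mono power_le_one) (use True in auto)
      then have "Beta \<alpha> \<beta> * ((1 - v) ^ m * cmod (k v)) \<le> Beta \<alpha> \<beta> * (hardy2_norm G * v powr (1 / 2 - 1))"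
        using B by (intro mult_left_mono) auto
      then show ?thesis using True B hardy2_norm_nonneg[OF G] by (simp add: abs_mult mult_ac)
    qed simp
    then show "AE v in lborel. norm (indicator {0<..<1} v * (1 - v) ^ m * Beta \<alpha> \<beta> * cmod (k v))
        \<le> norm (Beta \<alpha> \<beta> * hardy2_norm G * (indicator {0<..<1} v * (v powr (1/2 - 1) * (1 - v) powr (1 - 1))))"
      by simp
  qed measurable
  have HI: "integrable (lborel \<Otimes>\<^sub>M lborel) (\<lambda>(v, y). H v y)"
  proof (rule lborel_pair.Fubini_integrable)
    show "integrable lborel (\<lambda>v. \<integral>y. norm (case (v, y) of (v, y) \<Rightarrow> H v y) \<partial>lborel)"
      using N by (simp add: Hnorm)
    show "AE v in lborel. integrable lborel (\<lambda>y. case (v, y) of (v, y) \<Rightarrow> H v y)"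
      by (simp add: H_def \<psi>i)
  qed measurable
  have inner0: "(\<integral>v. H v y \<partial>lborel) = 0" for y
  proof (cases "y \<in> {0<..<1}")
    case True
    then have y: "0 < y" "y < 1" by auto
    have "(\<integral>v. H v y \<partial>lborel) = \<bar>y\<bar> *\<^sub>R (\<integral>r. H (0 + y * r) y \<partial>lborel)"
      by (rule lborel_integral_real_affine) (use y in simp)
    also have "(\<integral>r. H (0 + y * r) y \<partial>lborel) = (\<integral>r. ((1 - y) powr (\<beta> - 1) * y powr (\<alpha> - 1) / \<alpha> / y) *\<^sub>R
        (cesaro_density \<alpha> r *\<^sub>R (G (of_real (1 / y) / of_real r) / of_real r)) \<partial>lborel)"
    proof (rule Bochner_Integration.integral_cong[OF refl])
      fix r :: real
      show "H (0 + y * r) y = ((1 - y) powr (\<beta> - 1) * y powr (\<alpha> - 1) / \<alpha> / y) *\<^sub>R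
        (cesaro_density \<alpha> r *\<^sub>R (G (of_real (1 / y) / of_real r) / of_real r))"
      proof (cases "r \<in> {0<..<1}")
        case r: True
        have yr: "y * r < y" "0 < y * r" using y r mult_strict_left_mono[of r 1 y] by auto
        have "y - y * r = y * (1 - r)" by (simp add: algebra_simps)
        then have "(y - y * r) powr (\<alpha> - 1) = y powr (\<alpha> - 1) * (1 - r) powr (\<alpha> - 1)"
          using y r by (simp add: powr_mult)
        then have "\<psi> (y * r) y = (1 - y) powr (\<beta> - 1) * (y powr (\<alpha> - 1) * (1 - r) powr (\<alpha> - 1))"
          using y yr by (simp add: \<psi>_def)
        moreover have "k (y * r) = G (of_real (1 / y) / of_real r) / of_real r / of_real y"
          by (simp add: k_def divide_divide_eq_left mult.commute)
        ultimately show ?thesis using r y \<alpha> by (simp add: H_def cesaro_density_def scaleR_conv_of_real field_simps)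
      next
        case r: False
        then have "\<not> (0 < y * r \<and> y * r < y)"
          using y by (auto simp: zero_less_mult_iff mult_less_cancel_left2)
        then have "\<psi> (y * r) y = 0" by (auto simp: \<psi>_def indicator_def)
        then show ?thesis using r by (simp add: H_def cesaro_density_def)
      qed
    qed
    also have "... = ((1 - y) powr (\<beta> - 1) * y powr (\<alpha> - 1) / \<alpha> / y) *\<^sub>R cesaro_adj \<alpha> G (of_real (1 / y))"
    proof -
      have hp: "of_real (1 / y) \<in> half_plane" using y by (simp add: half_plane_def)
      show ?thesis
        unfolding integral_scaleR_right cesaro_adj_eval(2)[OF \<alpha> G hp] integral_cesaro_measure[OF \<alpha> dilation_measurable[OF G hp]] ..
    qed
    also have "cesaro_adj \<alpha> G (of_real (1 / y)) = 0" by (rule bspec[OF zero]) (use y in \<open>simp add: half_plane_def\<close>)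
    finally show ?thesis by simp
  next
    case False
    then have "\<psi> v y = 0" for v by (auto simp: \<psi>_def indicator_def)
    then show ?thesis by (simp add: H_def)
  qed
  have "(\<integral>v. (\<integral>y. H v y \<partial>lborel) \<partial>lborel) = (\<integral>y. (\<integral>v. H v y \<partial>lborel) \<partial>lborel)"
    using lborel_pair.Fubini_integral[OF HI] by simp
  then have "Beta \<alpha> \<beta> *\<^sub>R (\<integral>v. (indicator {0<..<1} v * (1 - v) ^ m) *\<^sub>R k v \<partial>lborel) = 0"
    unfolding Hint integral_scaleR_right inner0 by simp
  then show "(\<integral>v. (indicator {0<..<1} v * (1 - v) ^ m) *\<^sub>R (G (1 / of_real v) / of_real v) \<partial>lborel) = 0"
    using B by (simp add: k_def)
  have "integrable lborel (\<lambda>v. (indicator {0<..<1} v * (1 - v) ^ m) *\<^sub>R k v)"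
  proof (rule Bochner_Integration.integrable_bound)
    show "integrable lborel (\<lambda>v. (1 / Beta \<alpha> \<beta>) * (indicator {0<..<1} v * (1 - v) ^ m * Beta \<alpha> \<beta> * cmod (k v)))"
      by (rule integrable_mult_right[OF N])
  qed (use B in \<open>auto simp: indicator_def abs_mult\<close>)
  then show "integrable lborel (\<lambda>v. (indicator {0<..<1} v * (1 - v) ^ m) *\<^sub>R (G (1 / of_real v) / of_real v))"
    by (simp add: k_def)
qed

lemma cesaro_adj_injective:
  assumes \<alpha>: "0 < \<alpha>" and G: "G \<in> hardy2" and zero: "\<forall>w\<in>half_plane. cesaro_adj \<alpha> G w = 0"
  shows "G z = 0"
proof -
  obtain m where m: "\<alpha> \<le> real m" using real_arch_simple by blast
  then have m0: "0 < m" using \<alpha> by (cases m) auto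
  define Q where "Q v = of_real ((1 - v) ^ m) * G (1 / of_real v)" for v :: real
  have G0: "G 0 = 0" by (rule hardy2_outside[OF G]) simp
  have qc: "continuous_on {0..1} (\<lambda>v::real. G (1 / of_real v))"
    unfolding continuous_on_eq_continuous_within
  proof
    fix v :: real assume v: "v \<in> {0..1}"
    show "continuous (at v within {0..1}) (\<lambda>v. G (1 / of_real v))"
    proof (cases "v = 0")
      case True
      have "((\<lambda>v::real. G (1 / of_real v)) \<longlongrightarrow> 0) (at 0 within {0..1})"
      proof (rule Lim_null_comparison)
        show "\<forall>\<^sub>F v in at 0 within {0..1}. norm (G (1 / of_real v)) \<le> hardy2_norm G * v powr (1 / 2)"
          by (auto simp: eventually_at_filter intro!: always_eventually hardy2_inversion_bound[OF G])
        have "((\<lambda>v. hardy2_norm G * sqrt v) \<longlongrightarrow> hardy2_norm G * sqrt 0) (at 0 within {0..1})"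
          by (intro tendsto_intros)
        then have "((\<lambda>v. hardy2_norm G * sqrt v) \<longlongrightarrow> 0) (at 0 within {0..1})" by simp
        then show "((\<lambda>v. hardy2_norm G * v powr (1 / 2)) \<longlongrightarrow> 0) (at 0 within {0..1})"
          by (rule Lim_transform_eventually) (auto simp: eventually_at_filter powr_half_sqrt intro!: always_eventually)
      qed
      then show ?thesis using True G0 by (simp add: continuous_within)
    next
      case False
      then have v0: "0 < v" using v by simp
      have "isCont G (1 / of_real v)"
        using holomorphic_on_imp_continuous_on[OF hardy2_holomorphic[OF G]] v0
        by (auto simp: continuous_on_eq_continuous_at open_halfspace_Re_gt Re_divide_of_real)
      moreover have "isCont (\<lambda>v. 1 / complex_of_real v) v"
        by (intro continuous_intros) (use v0 in auto)
      ultimately have "continuous (at v) (\<lambda>v. G (1 / of_real v))" by (rule isCont_o2[rotated])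
      then show ?thesis by (rule continuous_at_imp_continuous_at_within)
    qed
  qed
  have Qc: "continuous_on {0..1} Q" unfolding Q_def by (intro continuous_intros qc)
  have mom: "integral {0..1} (\<lambda>v. of_real ((1 - v) ^ n) * Q v) = 0" for n
  proof -
    have mn: "\<alpha> \<le> real (m + n)" "\<alpha> \<le> real (m + n + 1)" using m by auto
    note M1 = cesaro_adj_zero_imp_moment_zero[OF \<alpha> G zero mn(1)]
      and M2 = cesaro_adj_zero_imp_moment_zero[OF \<alpha> G zero mn(2)]
    have eq: "(indicator {0<..<1} v * (1 - v) ^ (m + n)) *\<^sub>R (G (1 / of_real v) / of_real v) -
        (indicator {0<..<1} v * (1 - v) ^ (m + n + 1)) *\<^sub>R (G (1 / of_real v) / of_real v)
        = indicator {0..1} v *\<^sub>R (of_real ((1 - v) ^ n) * Q v)" for v :: real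
    proof (cases "v \<in> {0<..<1}")
      case True
      let ?g = "G (1 / of_real v) / of_real v"
      have "(1 - v) ^ (m + n) - (1 - v) ^ (m + n + 1) = ((1 - v) ^ n * (1 - v) ^ m) * v"
        by (simp add: power_add algebra_simps)
      then have "(1 - v) ^ (m + n) *\<^sub>R ?g - (1 - v) ^ (m + n + 1) *\<^sub>R ?g = ((1 - v) ^ n * (1 - v) ^ m) *\<^sub>R (v *\<^sub>R ?g)"
        by (simp only: scaleR_left_diff_distrib[symmetric] scaleR_scaleR)
      also have "v *\<^sub>R ?g = G (1 / of_real v)" using True by (simp add: scaleR_conv_of_real)
      finally show ?thesis using True by (simp add: Q_def scaleR_conv_of_real)
    next
      case False
      then show ?thesis using G0 m0 by (cases "v = 0 \<or> v = 1") (auto simp: Q_def indicator_def)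
    qed
    have "(\<integral>v. indicator {0..1} v *\<^sub>R (of_real ((1 - v) ^ n) * Q v) \<partial>lborel) = 0"
      unfolding eq[symmetric] by (subst Bochner_Integration.integral_diff[OF M1(1) M2(1)]) (rule trans[OF arg_cong2[where f="(-)", OF M1(2) M2(2)] diff_zero])
    moreover have "set_integrable lborel {0..1} (\<lambda>v. of_real ((1 - v) ^ n) * Q v)"
      by (intro borel_integrable_atLeastAtMost' continuous_intros Qc)
    ultimately show ?thesis
      using set_borel_integral_eq_integral(2) unfolding set_lebesgue_integral_def by metis
  qed
  have Q0: "Q v = 0" if v: "v \<in> {0..1}" for v
  proof -
    have ii: "(\<lambda>v. of_real ((1 - v) ^ n) * Q v) integrable_on {0..1}" for n
      by (intro integrable_continuous_real continuous_intros Qc)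
    have mRe: "integral {0..1} (\<lambda>v. (1 - v) ^ n * Re (Q v)) = 0" for n
      using integral_linear[OF ii bounded_linear_Re, of n] unfolding mom by (simp add: o_def)
    have "continuous_on {0..1} (\<lambda>v. Re (Q v))" by (intro continuous_intros Qc)
    from continuous_moments_zero[OF this mRe v] have "Re (Q v) = 0" .
    moreover
    have mIm: "integral {0..1} (\<lambda>v. (1 - v) ^ n * Im (Q v)) = 0" for n
      using integral_linear[OF ii bounded_linear_Im, of n] unfolding mom by (simp add: o_def)
    have "continuous_on {0..1} (\<lambda>v. Im (Q v))" by (intro continuous_intros Qc)
    from continuous_moments_zero[OF this mIm v] have "Im (Q v) = 0" .
    ultimately show ?thesis by (simp add: complex_eq_iff)
  qed
  show ?thesis
  proof (cases "z \<in> half_plane")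
    case True
    show ?thesis
    proof (rule analytic_continuation[OF hardy2_holomorphic[OF G] _ _ _ _ _ _ True[unfolded half_plane_def]])
      show "open {z. 0 < Re z}" by (rule open_halfspace_Re_gt)
      show "connected {z. 0 < Re z}" by (rule convex_connected[OF convex_halfspace_Re_gt])
      show "complex_of_real ` {1<..} \<subseteq> {z. 0 < Re z}" by auto
      show "complex_of_real 2 \<in> {z. 0 < Re z}" by simp
      show "complex_of_real 2 islimpt complex_of_real ` {1<..}"
        unfolding islimpt_approachable
      proof (intro allI impI)
        fix e :: real assume e: "0 < e"
        show "\<exists>x'\<in>complex_of_real ` {1<..}. x' \<noteq> complex_of_real 2 \<and> dist x' (complex_of_real 2) < e"
        proof (rule bexI, rule conjI)
          show "complex_of_real (2 + e / 2) \<noteq> complex_of_real 2"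
            unfolding of_real_eq_iff using e by simp
          show "dist (complex_of_real (2 + e / 2)) (complex_of_real 2) < e"
            unfolding dist_of_real dist_real_def using e by simp
        qed (use e in \<open>intro imageI, simp\<close>)
      qed
      show "G u = 0" if u: "u \<in> complex_of_real ` {1<..}" for u
      proof -
        obtain x where x: "1 < x" "u = of_real x" using u by auto
        have "Q (1 / x) = 0" by (rule Q0) (use x in auto)
        then show ?thesis using x by (simp add: Q_def)
      qed
    qed
  next
    case False
    then show ?thesis using hardy2_outside[OF G] by (simp add: half_plane_def)
  qed
qed

section \<open>The reproducing kernel\<close>

lemma cesaro_adj_inj_on:
  assumes \<alpha>: "0 < \<alpha>"
  shows "inj_on (cesaro_adj \<alpha>) hardy2"
proof (rule inj_onI)
  fix F G assume FG: "F \<in> hardy2" "G \<in> hardy2" and eq: "cesaro_adj \<alpha> F = cesaro_adj \<alpha> G"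
  have "cesaro_adj \<alpha> (\<lambda>z. F z - G z) w = 0" if w: "w \<in> half_plane" for w
    using cesaro_adj_eval[OF \<alpha> FG(1) w] cesaro_adj_eval[OF \<alpha> FG(2) w] eq
    by (simp add: cesaro_adj_eval(2)[OF \<alpha> hardy2_diff[OF FG] w] diff_divide_distrib)
  then have "F z - G z = 0" for z
    using cesaro_adj_injective[OF \<alpha> hardy2_diff[OF FG]] by blast
  then show "F = G" by (intro ext) simp
qed

definition cesaro_kernel :: "real \<Rightarrow> complex \<Rightarrow> complex \<Rightarrow> complex" where
  "cesaro_kernel \<alpha> w v = (\<integral>s. (\<integral>r. 1 / (of_real s * cnj w + of_real r * v) \<partial>cesaro_measure \<alpha>) \<partial>cesaro_measure \<alpha>)"

lemma reproducing_kernel_preimage: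
  assumes \<alpha>: "0 < \<alpha>" and K: "is_reproducing_kernel half_plane (hardy2_frac \<alpha>) (hardy2_frac_inner \<alpha>) K"
    and w: "w \<in> half_plane"
  defines "h \<equiv> cesaro_adj_inv \<alpha> (\<lambda>z. K z w)"
  shows "h \<in> hardy2"
    and "G \<in> hardy2 \<Longrightarrow> cesaro_adj \<alpha> G w = of_real ((Gamma (\<alpha> + 1))\<^sup>2) * hardy2_inner G h"
proof -
  have "(\<lambda>z. K z w) \<in> cesaro_adj \<alpha> ` hardy2"
    using K w by (simp add: is_reproducing_kernel_def hardy2_frac_def)
  then show "h \<in> hardy2" unfolding h_def cesaro_adj_inv_def by (rule inv_into_into)
  assume G: "G \<in> hardy2"
  then have "cesaro_adj \<alpha> G \<in> hardy2_frac \<alpha>" by (simp add: hardy2_frac_def)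
  then have "cesaro_adj \<alpha> G w = hardy2_frac_inner \<alpha> (cesaro_adj \<alpha> G) (\<lambda>z. K z w)"
    using K w unfolding is_reproducing_kernel_def by blast
  moreover have "cesaro_adj_inv \<alpha> (cesaro_adj \<alpha> G) = G"
    unfolding cesaro_adj_inv_def by (rule inv_into_f_f[OF cesaro_adj_inj_on[OF \<alpha>] G])
  ultimately show "cesaro_adj \<alpha> G w = of_real ((Gamma (\<alpha> + 1))\<^sup>2) * hardy2_inner G h"
    by (simp add: hardy2_frac_inner_def h_def)
qed

lemma reproducing_kernel_preimage_eval:
  assumes \<alpha>: "0 < \<alpha>" and K: "is_reproducing_kernel half_plane (hardy2_frac \<alpha>) (hardy2_frac_inner \<alpha>) K"
    and w: "w \<in> half_plane" and v: "v \<in> half_plane"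
  shows "of_real ((Gamma (\<alpha> + 1))\<^sup>2) * cesaro_adj_inv \<alpha> (\<lambda>z. K z w) v
    = (\<integral>r. 1 / (cnj w + of_real r * v) \<partial>cesaro_measure \<alpha>)"
proof -
  let ?h = "cesaro_adj_inv \<alpha> (\<lambda>z. K z w)"
  note h = reproducing_kernel_preimage[OF \<alpha> K w]
  have sz: "szego v \<in> hardy2" by (rule szego_in_hardy2[OF v])
  have "hardy2_inner (szego v) ?h = cnj (?h v)"
    using hardy2_inner_commute[OF h(1) sz] hardy2_inner_szego[OF h(1) v] by simp
  then have "of_real ((Gamma (\<alpha> + 1))\<^sup>2) * cnj (?h v) = cesaro_adj \<alpha> (szego v) w"
    using h(2)[OF sz] by simp
  also have "... = (\<integral>r. szego v (w / of_real r) / of_real r \<partial>cesaro_measure \<alpha>)"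
    by (rule cesaro_adj_eval(2)[OF \<alpha> sz w])
  finally have "cnj (of_real ((Gamma (\<alpha> + 1))\<^sup>2) * cnj (?h v)) = cnj (\<integral>r. szego v (w / of_real r) / of_real r \<partial>cesaro_measure \<alpha>)"
    by simp
  then have "of_real ((Gamma (\<alpha> + 1))\<^sup>2) * ?h v = (\<integral>r. cnj (szego v (w / of_real r) / of_real r) \<partial>cesaro_measure \<alpha>)"
    by (simp flip: Bochner_Integration.integral_cnj)
  also have "... = (\<integral>r. 1 / (cnj w + of_real r * v) \<partial>cesaro_measure \<alpha>)"
  proof (rule integral_cong_AE)
    show "(\<lambda>r. cnj (szego v (w / of_real r) / of_real r)) \<in> borel_measurable (cesaro_measure \<alpha>)"
      using measurable_compose[OF dilation_measurable[OF sz w] cnj_measurable] by simp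
    show "(\<lambda>r. 1 / (cnj w + of_real r * v)) \<in> borel_measurable (cesaro_measure \<alpha>)"
      by measurable
    show "AE r in cesaro_measure \<alpha>. cnj (szego v (w / of_real r) / of_real r) = 1 / (cnj w + of_real r * v)"
      using AE_cesaro_measure[OF \<alpha>]
    proof eventually_elim
      case (elim r)
      then have "w / of_real r \<in> half_plane" using w by (simp add: half_plane_def Re_divide_of_real)
      moreover have "(w / of_real r + cnj v) * of_real r = w + of_real r * cnj v"
        using elim by (simp add: field_simps)
      ultimately have "szego v (w / of_real r) / of_real r = 1 / (w + of_real r * cnj v)"
        by (simp add: szego_def)
      then show ?case by simp
    qed
  qed
  finally show ?thesis .
qed

lemma reproducing_kernel_preimage_inner:
  assumes \<alpha>: "0 < \<alpha>" and K: "is_reproducing_kernel half_plane (hardy2_frac \<alpha>) (hardy2_frac_inner \<alpha>) K"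
    and w: "w \<in> half_plane" and v: "v \<in> half_plane"
  shows "of_real ((Gamma (\<alpha> + 1)) ^ 4) * hardy2_inner (cesaro_adj_inv \<alpha> (\<lambda>z. K z w)) (cesaro_adj_inv \<alpha> (\<lambda>z. K z v))
      = cesaro_kernel \<alpha> w v"
    and "integrable (cesaro_measure \<alpha>) (\<lambda>s. \<integral>r. 1 / (of_real s * cnj w + of_real r * v) \<partial>cesaro_measure \<alpha>)"
proof -
  let ?h = "cesaro_adj_inv \<alpha> (\<lambda>z. K z w)" and ?\<mu> = "cesaro_measure \<alpha>" and ?c = "complex_of_real ((Gamma (\<alpha> + 1))\<^sup>2)"
  note h = reproducing_kernel_preimage(1)[OF \<alpha> K w]
  note ev = cesaro_adj_eval[OF \<alpha> h v]
  let ?I = "\<lambda>s. \<integral>r. 1 / (of_real s * cnj w + of_real r * v) \<partial>?\<mu>"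
  have Im: "?I \<in> borel_measurable ?\<mu>"
  proof -
    interpret prob_space ?\<mu> by (rule prob_space_cesaro_measure[OF \<alpha>])
    show ?thesis by measurable
  qed
  have hm: "(\<lambda>s. ?c * (?h (v / of_real s) / of_real s)) \<in> borel_measurable ?\<mu>"
    using dilation_measurable[OF h v] by measurable
  have ae: "AE s in ?\<mu>. ?c * (?h (v / of_real s) / of_real s) = ?I s"
    using AE_cesaro_measure[OF \<alpha>]
  proof eventually_elim
    case (elim s)
    then have vs: "v / of_real s \<in> half_plane" using v by (simp add: half_plane_def Re_divide_of_real)
    have "?c * (?h (v / of_real s) / of_real s) = (\<integral>r. 1 / (cnj w + of_real r * (v / of_real s)) \<partial>?\<mu>) / of_real s"
      using reproducing_kernel_preimage_eval[OF \<alpha> K w vs] by simp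
    also have "... = (\<integral>r. 1 / (cnj w + of_real r * (v / of_real s)) / of_real s \<partial>?\<mu>)"
      by (rule Bochner_Integration.integral_divide_zero[symmetric])
    also have "... = ?I s"
    proof (intro Bochner_Integration.integral_cong refl)
      fix r
      have "(cnj w + of_real r * (v / of_real s)) * of_real s = of_real s * cnj w + of_real r * v"
        using elim by (simp add: field_simps)
      then show "1 / (cnj w + of_real r * (v / of_real s)) / of_real s = 1 / (of_real s * cnj w + of_real r * v)"
        by simp
    qed
    finally show ?case .
  qed
  have "integrable ?\<mu> (\<lambda>s. ?c * (?h (v / of_real s) / of_real s))" by (intro integrable_mult_right ev(1))
  then show "integrable ?\<mu> ?I" by (rule integrable_cong_AE_imp[OF _ Im]) (use ae in auto)
  have "of_real ((Gamma (\<alpha> + 1)) ^ 4) * hardy2_inner ?h (cesaro_adj_inv \<alpha> (\<lambda>z. K z v))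
      = ?c * (?c * hardy2_inner ?h (cesaro_adj_inv \<alpha> (\<lambda>z. K z v)))"
    by (simp add: mult.assoc[symmetric] flip: of_real_mult power_add)
  also have "... = ?c * cesaro_adj \<alpha> ?h v"
    using reproducing_kernel_preimage(2)[OF \<alpha> K v h] by simp
  also have "... = (\<integral>s. ?c * (?h (v / of_real s) / of_real s) \<partial>?\<mu>)"
    unfolding ev(2) Bochner_Integration.integral_mult_right_zero ..
  also have "... = cesaro_kernel \<alpha> w v"
    unfolding cesaro_kernel_def by (rule integral_cong_AE[OF hm Im ae])
  finally show "of_real ((Gamma (\<alpha> + 1)) ^ 4) * hardy2_inner ?h (cesaro_adj_inv \<alpha> (\<lambda>z. K z v)) = cesaro_kernel \<alpha> w v" .
qed

lemma hardy2_frac_norm_kernel: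
  assumes \<alpha>: "0 < \<alpha>" and K: "is_reproducing_kernel half_plane (hardy2_frac \<alpha>) (hardy2_frac_inner \<alpha>) K"
    and w: "w \<in> half_plane"
  shows "cesaro_kernel \<alpha> w w = of_real ((Gamma (\<alpha> + 1))\<^sup>2 * (hardy2_frac_norm \<alpha> (\<lambda>u. K u w))\<^sup>2)"
  unfolding reproducing_kernel_preimage_inner(1)[OF \<alpha> K w w, symmetric]
    hardy2_inner_self[OF reproducing_kernel_preimage(1)[OF \<alpha> K w]] hardy2_frac_norm_def
  by (simp add: power_mult_distrib mult.assoc[symmetric] flip: power_add)

text \<open>Off the positive axis the kernel integrand oscillates, so the lower bound is taken from the
  Cauchy--Schwarz inequality for the kernel functions at \<open>w\<close> and \<open>cnj w\<close>, whose inner product is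
  a real multiple of \<open>1 / cnj w\<close>.\<close>
lemma cesaro_kernel_cnj_le:
  assumes \<alpha>: "0 < \<alpha>" and K: "is_reproducing_kernel half_plane (hardy2_frac \<alpha>) (hardy2_frac_inner \<alpha>) K"
    and w: "w \<in> half_plane"
  shows "cmod (cesaro_kernel \<alpha> w (cnj w)) \<le> Re (cesaro_kernel \<alpha> w w)"
proof -
  define h where "h v = cesaro_adj_inv \<alpha> (\<lambda>z. K z v)" for v
  let ?g = "Gamma (\<alpha> + 1) ^ 4"
  have w': "cnj w \<in> half_plane" using w by (simp add: half_plane_def)
  note hw = reproducing_kernel_preimage(1)[OF \<alpha> K w, folded h_def] and hw' = reproducing_kernel_preimage(1)[OF \<alpha> K w', folded h_def]
  have g: "0 \<le> ?g" by simp
  have n: "cesaro_kernel \<alpha> v v = of_real (?g * (hardy2_norm (h v))\<^sup>2)" if "v \<in> half_plane" for v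
    using reproducing_kernel_preimage_inner(1)[OF \<alpha> K that that] hardy2_inner_self[OF reproducing_kernel_preimage(1)[OF \<alpha> K that]]
    unfolding h_def by simp
  have "cesaro_kernel \<alpha> (cnj w) (cnj w) = cnj (cesaro_kernel \<alpha> w w)"
    unfolding cesaro_kernel_def by (simp flip: Bochner_Integration.integral_cnj)
  then have "of_real (?g * (hardy2_norm (h (cnj w)))\<^sup>2) = complex_of_real (?g * (hardy2_norm (h w))\<^sup>2)"
    unfolding n[OF w] n[OF w'] by simp
  then have "?g * (hardy2_norm (h (cnj w)))\<^sup>2 = ?g * (hardy2_norm (h w))\<^sup>2" by (simp only: of_real_eq_iff)
  moreover have "?g \<noteq> 0" using less_imp_neq[OF Gamma_real_pos[of "\<alpha> + 1"]] \<alpha> by simp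
  ultimately have "(hardy2_norm (h (cnj w)))\<^sup>2 = (hardy2_norm (h w))\<^sup>2" by simp
  then have eq: "hardy2_norm (h (cnj w)) = hardy2_norm (h w)"
    using hardy2_norm_nonneg[OF hw] hardy2_norm_nonneg[OF hw'] by simp
  have "cmod (cesaro_kernel \<alpha> w (cnj w)) = ?g * cmod (hardy2_inner (h w) (h (cnj w)))"
    unfolding reproducing_kernel_preimage_inner(1)[OF \<alpha> K w w', symmetric] h_def norm_mult norm_of_real by simp
  also have "... \<le> ?g * (hardy2_norm (h w) * hardy2_norm (h (cnj w)))"
    by (intro mult_left_mono hardy2_Cauchy_Schwarz hw hw' g)
  also have "... = Re (cesaro_kernel \<alpha> w w)" unfolding n[OF w] eq by (simp add: power2_eq_square)
  finally show ?thesis .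
qed

section \<open>Kernel estimates\<close>

lemma cmod_cesaro_combination_ge:
  assumes "0 < s" "0 < r" "0 < Re w"
  shows "2 * Re w * (sqrt s * sqrt r) \<le> cmod (of_real s * cnj w + of_real r * w)"
proof -
  have "0 \<le> (sqrt s - sqrt r)\<^sup>2" by simp
  then have "2 * (sqrt s * sqrt r) \<le> s + r" using assms by (simp add: power2_diff)
  then have "2 * (sqrt s * sqrt r) * Re w \<le> (s + r) * Re w" using assms by (intro mult_right_mono) auto
  also have "... = Re (of_real s * cnj w + of_real r * w)" by (simp add: distrib_right)
  also have "... \<le> cmod (of_real s * cnj w + of_real r * w)" by (rule complex_Re_le_cmod)
  finally show ?thesis by (simp add: mult_ac)
qed

lemma integral_norm_bound_AE:
  fixes f :: "'a \<Rightarrow> 'b::{banach, second_countable_topology}"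
  assumes g: "integrable M g" and le: "AE x in M. norm (f x) \<le> g x"
  shows "norm (\<integral>x. f x \<partial>M) \<le> (\<integral>x. g x \<partial>M)"
proof (cases "integrable M f")
  case True
  have "norm (\<integral>x. f x \<partial>M) \<le> (\<integral>x. norm (f x) \<partial>M)" by (rule integral_norm_bound)
  also have "... \<le> (\<integral>x. g x \<partial>M)" by (rule integral_mono_AE[OF integrable_norm[OF True] g le])
  finally show ?thesis .
next
  case False
  have "AE x in M. 0 \<le> g x" using le by eventually_elim (rule order_trans[OF norm_ge_zero])
  then show ?thesis using False by (simp add: not_integrable_integral_eq integral_nonneg_AE)
qed

lemma cesaro_kernel_le_Beta:
  assumes \<alpha>: "0 < \<alpha>" and w: "w \<in> half_plane"
  shows "cmod (cesaro_kernel \<alpha> w w) \<le> (\<alpha> * Beta (1 / 2) \<alpha>)\<^sup>2 / (2 * Re w)"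
proof -
  let ?\<mu> = "cesaro_measure \<alpha>" and ?B = "\<alpha> * Beta (1 / 2) \<alpha>"
  have w0: "0 < Re w" using w by (simp add: half_plane_def)
  note p = cesaro_measure_powr[OF \<alpha>, of "- (1 / 2)"]
  have pB: "(\<integral>r. r powr - (1 / 2) \<partial>?\<mu>) = ?B" using p(2) by simp
  have pi: "integrable ?\<mu> (\<lambda>r. r powr - (1 / 2))" using p(1) by simp
  have B0: "0 \<le> ?B" unfolding pB[symmetric] by (intro integral_nonneg_AE) simp
  have bound: "cmod (1 / (of_real s * cnj w + of_real r * w)) \<le> s powr - (1 / 2) / (2 * Re w) * r powr - (1 / 2)"
    if "0 < s" "0 < r" for s r
  proof -
    have p: "0 < 2 * Re w * (sqrt s * sqrt r)" using that w0 by simp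
    note q = cmod_cesaro_combination_ge[OF that w0]
    have "cmod (1 / (of_real s * cnj w + of_real r * w)) \<le> 1 / (2 * Re w * (sqrt s * sqrt r))"
      unfolding norm_divide norm_one
      by (rule divide_left_mono[OF q zero_le_one mult_pos_pos[OF less_le_trans[OF p q] p]])
    also have "... = s powr - (1 / 2) / (2 * Re w) * r powr - (1 / 2)"
      using that by (simp add: powr_minus powr_half_sqrt field_simps)
    finally show ?thesis .
  qed
  have inner: "cmod (\<integral>r. 1 / (of_real s * cnj w + of_real r * w) \<partial>?\<mu>) \<le> s powr - (1 / 2) / (2 * Re w) * ?B" if s: "0 < s" for s
  proof -
    have b: "AE r in ?\<mu>. cmod (1 / (of_real s * cnj w + of_real r * w)) \<le> s powr - (1 / 2) / (2 * Re w) * r powr - (1 / 2)"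
      using AE_cesaro_measure[OF \<alpha>] by eventually_elim (use bound[OF s] in auto)
    have "cmod (\<integral>r. 1 / (of_real s * cnj w + of_real r * w) \<partial>?\<mu>) \<le> (\<integral>r. s powr - (1 / 2) / (2 * Re w) * r powr - (1 / 2) \<partial>?\<mu>)"
      by (rule integral_norm_bound_AE[OF _ b]) (intro integrable_mult_right pi)
    then show ?thesis by (simp only: Bochner_Integration.integral_mult_right_zero pB)
  qed
  have "AE s in ?\<mu>. cmod (\<integral>r. 1 / (of_real s * cnj w + of_real r * w) \<partial>?\<mu>) \<le> (?B / (2 * Re w)) * s powr - (1 / 2)"
    using AE_cesaro_measure[OF \<alpha>] by eventually_elim (use inner in \<open>simp add: mult_ac\<close>)
  then have "cmod (cesaro_kernel \<alpha> w w) \<le> (\<integral>s. (?B / (2 * Re w)) * s powr - (1 / 2) \<partial>?\<mu>)"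
    unfolding cesaro_kernel_def by (rule integral_norm_bound_AE[rotated]) (intro integrable_mult_right pi)
  also have "... = ?B / (2 * Re w) * ?B" by (simp only: Bochner_Integration.integral_mult_right_zero pB)
  finally show ?thesis by (simp add: power2_eq_square)
qed

lemma Beta_half_le:
  assumes \<alpha>: "0 < \<alpha>" "\<alpha> \<le> 1 / 2"
  shows "\<alpha> * Beta (1 / 2) \<alpha> \<le> pi / 2"
proof -
  let ?g = "ln \<circ> Gamma :: real \<Rightarrow> real"
  have incr: "?g (\<alpha> + 1) - ?g (\<alpha> + 1 / 2) \<le> ?g (3 / 2) - ?g 1"
  proof (cases "\<alpha> = 1 / 2")
    case False
    then have a: "\<alpha> < 1 / 2" using \<alpha> by simp
    note cv = log_convex_Gamma_real
    define l where "l = 1 / 2 / (1 - \<alpha>)"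
    have l: "0 \<le> l" "l \<le> 1" "l * (1 - \<alpha>) = 1 / 2" using \<alpha> a by (auto simp: l_def field_simps)
    have e: "\<alpha> * l = l - 1 / 2" using l(3) by (simp add: algebra_simps)
    have "?g ((1 - l) *\<^sub>R (\<alpha> + 1 / 2) + l *\<^sub>R (3 / 2)) \<le> (1 - l) * ?g (\<alpha> + 1 / 2) + l * ?g (3 / 2)"
      by (rule convex_onD[OF cv]) (use l \<alpha> in auto)
    moreover have "(1 - l) *\<^sub>R (\<alpha> + 1 / 2) + l *\<^sub>R (3 / 2) = \<alpha> + 1" using e by (simp add: field_simps)
    moreover have "?g ((1 - (1 - l)) *\<^sub>R (\<alpha> + 1 / 2) + (1 - l) *\<^sub>R (3 / 2)) \<le> (1 - (1 - l)) * ?g (\<alpha> + 1 / 2) + (1 - l) * ?g (3 / 2)"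
      by (rule convex_onD[OF cv]) (use l \<alpha> in auto)
    moreover have "(1 - (1 - l)) *\<^sub>R (\<alpha> + 1 / 2) + (1 - l) *\<^sub>R (3 / 2) = 1" using e by (simp add: field_simps)
    ultimately show ?thesis by (simp add: algebra_simps)
  next
    case True
    show ?thesis unfolding True by simp
  qed
  have pos: "0 < Gamma (\<alpha> + 1)" "0 < Gamma (\<alpha> + 1 / 2)" "0 < Gamma (3 / 2 :: real)" using \<alpha> by (auto intro!: Gamma_real_pos)
  have g32: "Gamma (3 / 2 :: real) = sqrt pi / 2"
    using Gamma_plus1_pos[of "1 / 2"] by (simp add: Gamma_one_half_real)
  have "ln (Gamma (\<alpha> + 1) / Gamma (\<alpha> + 1 / 2)) \<le> ln (sqrt pi / 2)"
    using incr pos unfolding g32[symmetric] by (simp add: ln_div)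
  then have le: "Gamma (\<alpha> + 1) / Gamma (\<alpha> + 1 / 2) \<le> sqrt pi / 2"
    using pos by (subst (asm) ln_le_cancel_iff) auto
  have "\<alpha> * Beta (1 / 2) \<alpha> = sqrt pi * (Gamma (\<alpha> + 1) / Gamma (\<alpha> + 1 / 2))"
    by (simp add: Beta_def Gamma_one_half_real Gamma_plus1_pos[OF \<alpha>(1)] add.commute[of "1 / 2" \<alpha>])
  also have "... \<le> sqrt pi * (sqrt pi / 2)" by (intro mult_left_mono le) simp
  also have "... = pi / 2" by simp
  finally show ?thesis .
qed

lemma cesaro_kernel_cnj_ge:
  assumes \<alpha>: "0 < \<alpha>" and w: "w \<in> half_plane"
  shows "(\<alpha> + 1) / (2 * cmod w) \<le> cmod (cesaro_kernel \<alpha> w (cnj w))"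
proof -
  let ?\<mu> = "cesaro_measure \<alpha>"
  interpret prob_space ?\<mu> by (rule prob_space_cesaro_measure[OF \<alpha>])
  have pU: "prob UNIV = 1" using prob_space by simp
  define E where "E = (\<integral>s. (\<integral>r. 1 / (s + r) \<partial>?\<mu>) \<partial>?\<mu>)"
  have meanint: "integrable ?\<mu> (\<lambda>r. r)" "(\<integral>r. r \<partial>?\<mu>) = 1 / (\<alpha> + 1)"
  proof -
    have ae: "AE r in ?\<mu>. r powr 1 = r" using AE_cesaro_measure[OF \<alpha>] by eventually_elim simp
    show "integrable ?\<mu> (\<lambda>r. r)"
      by (rule integrable_cong_AE_imp[OF cesaro_measure_powr(1)[OF \<alpha>, of 1]]) (use ae in auto)
    have "(\<integral>r. r \<partial>?\<mu>) = (\<integral>r. r powr 1 \<partial>?\<mu>)"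
      by (rule integral_cong_AE) (use ae in auto)
    also have "... = \<alpha> * Beta 2 \<alpha>" using cesaro_measure_powr(2)[OF \<alpha>, of 1] by simp
    also have "... = 1 / (\<alpha> + 1)"
    proof -
      have "Gamma (2 + \<alpha>) = (\<alpha> + 1) * (\<alpha> * Gamma \<alpha>)"
        using Gamma_plus1_pos[of "\<alpha> + 1"] Gamma_plus1_pos[of \<alpha>] \<alpha> by (simp add: add.commute)
      moreover have "Gamma (2 :: real) = 1" using Gamma_plus1_pos[of 1] by simp
      ultimately show ?thesis using \<alpha> less_imp_neq[OF Gamma_real_pos[OF \<alpha>]] by (simp add: Beta_def)
    qed
    finally show "(\<integral>r. r \<partial>?\<mu>) = 1 / (\<alpha> + 1)" .
  qed
  define b where "b = (\<alpha> + 1) / 2"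
  have b: "0 < b" using \<alpha> by (simp add: b_def)
  have tangent: "2 * b - b\<^sup>2 * u \<le> 1 / u" if "0 < u" for u
  proof -
    have "0 \<le> (b * u - 1)\<^sup>2" by simp
    then have "(2 * b - b\<^sup>2 * u) * u \<le> 1" by (simp add: power2_eq_square algebra_simps)
    then show ?thesis using that by (simp add: le_divide_eq)
  qed
  have inv_int: "integrable ?\<mu> (\<lambda>r. 1 / (s + r))" if "0 < s" for s
  proof (rule Bochner_Integration.integrable_bound[of _ "\<lambda>_. 1 / s"])
    show "AE r in ?\<mu>. norm (1 / (s + r)) \<le> norm (1 / s)"
      using AE_cesaro_measure[OF \<alpha>] by eventually_elim (use that in \<open>auto intro!: divide_left_mono mult_pos_pos\<close>)
  qed auto
  have inv_int': "integrable ?\<mu> (\<lambda>s. \<integral>r. 1 / (s + r) \<partial>?\<mu>)"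
  proof (rule Bochner_Integration.integrable_bound[of _ "\<lambda>s. (\<integral>r. r powr - (1 / 2) \<partial>?\<mu>) * s powr - (1 / 2)"])
    have pi: "integrable ?\<mu> (\<lambda>r. r powr - (1 / 2))" using cesaro_measure_powr(1)[OF \<alpha>, of "- (1 / 2)"] by simp
    then show "integrable ?\<mu> (\<lambda>s. (\<integral>r. r powr - (1 / 2) \<partial>?\<mu>) * s powr - (1 / 2))" by (rule integrable_mult_right)
    show "AE s in ?\<mu>. norm (\<integral>r. 1 / (s + r) \<partial>?\<mu>) \<le> norm ((\<integral>r. r powr - (1 / 2) \<partial>?\<mu>) * s powr - (1 / 2))"
      using AE_cesaro_measure[OF \<alpha>]
    proof eventually_elim
      case (elim s)
      have "AE r in ?\<mu>. norm (1 / (s + r)) \<le> s powr - (1 / 2) * r powr - (1 / 2)"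
        using AE_cesaro_measure[OF \<alpha>]
      proof eventually_elim
        case (elim r)
        have "0 \<le> (sqrt s - sqrt r)\<^sup>2" by simp
        then have "sqrt s * sqrt r \<le> s + r" using elim \<open>0 < s \<and> s < 1\<close> mult_nonneg_nonneg[of "sqrt s" "sqrt r"] by (simp add: power2_diff)
        then have "1 / (s + r) \<le> 1 / (sqrt s * sqrt r)"
          using elim \<open>0 < s \<and> s < 1\<close> by (intro divide_left_mono mult_pos_pos add_pos_pos) auto
        then show ?case using elim \<open>0 < s \<and> s < 1\<close> by (simp add: powr_minus powr_half_sqrt inverse_eq_divide)
      qed
      then have "norm (\<integral>r. 1 / (s + r) \<partial>?\<mu>) \<le> (\<integral>r. s powr - (1 / 2) * r powr - (1 / 2) \<partial>?\<mu>)"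
        by (rule integral_norm_bound_AE[rotated]) (intro integrable_mult_right pi)
      also have "... = (\<integral>r. r powr - (1 / 2) \<partial>?\<mu>) * s powr - (1 / 2)"
        unfolding Bochner_Integration.integral_mult_right_zero by (rule mult.commute)
      also have "... \<le> norm ..." by simp
      finally show ?case .
    qed
  qed measurable
  have "b = 2 * b - b\<^sup>2 * (2 / (\<alpha> + 1))" using \<alpha> by (simp add: b_def power2_eq_square field_simps)
  also have "... = (\<integral>s. 2 * b - b\<^sup>2 * (s + 1 / (\<alpha> + 1)) \<partial>?\<mu>)"
    using meanint \<alpha> by (simp add: pU algebra_simps)
  also have "... \<le> E"
    unfolding E_def
  proof (rule integral_mono_AE[OF _ inv_int'])
    show "integrable ?\<mu> (\<lambda>s. 2 * b - b\<^sup>2 * (s + 1 / (\<alpha> + 1)))" using meanint(1) by simp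
    show "AE s in ?\<mu>. 2 * b - b\<^sup>2 * (s + 1 / (\<alpha> + 1)) \<le> (\<integral>r. 1 / (s + r) \<partial>?\<mu>)"
      using AE_cesaro_measure[OF \<alpha>]
    proof eventually_elim
      case (elim s)
      have "2 * b - b\<^sup>2 * (s + 1 / (\<alpha> + 1)) = (\<integral>r. 2 * b - b\<^sup>2 * (s + r) \<partial>?\<mu>)"
        using meanint by (simp add: pU algebra_simps)
      also have "... \<le> (\<integral>r. 1 / (s + r) \<partial>?\<mu>)"
      proof (rule integral_mono_AE[OF _ inv_int])
        show "integrable ?\<mu> (\<lambda>r. 2 * b - b\<^sup>2 * (s + r))" using meanint(1) by simp
        show "AE r in ?\<mu>. 2 * b - b\<^sup>2 * (s + r) \<le> 1 / (s + r)"
          using AE_cesaro_measure[OF \<alpha>] by eventually_elim (use elim in \<open>auto intro!: tangent\<close>)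
      qed (use elim in simp)
      finally show ?case .
    qed
  qed
  finally have E: "b \<le> E" .
  have "cesaro_kernel \<alpha> w (cnj w) = (\<integral>s. (\<integral>r. of_real (1 / (s + r)) / cnj w \<partial>?\<mu>) \<partial>?\<mu>)"
  proof -
    have "1 / (of_real s * cnj w + of_real r * cnj w) = of_real (1 / (s + r)) / cnj w" for s r
      by (simp flip: distrib_right of_real_add)
    then show ?thesis unfolding cesaro_kernel_def by simp
  qed
  also have "... = of_real E / cnj w"
    unfolding E_def integral_divide_zero integral_complex_of_real ..
  finally have "cmod (cesaro_kernel \<alpha> w (cnj w)) = \<bar>E\<bar> / cmod w" by (simp add: norm_divide)
  moreover have "b / cmod w \<le> \<bar>E\<bar> / cmod w" using E by (intro divide_right_mono) auto
  ultimately show ?thesis by (simp add: b_def)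
qed

lemma Re_cesaro_combination:
  fixes s r :: real
  shows "Re (1 / (of_real s * cnj w + of_real r * w)) = (s + r) * Re w / ((s + r)\<^sup>2 * (Re w)\<^sup>2 + (r - s)\<^sup>2 * (Im w)\<^sup>2)"
  by (simp add: Re_divide power2_eq_square algebra_simps)

lemma schur_antiderivative:
  fixes a m r s :: real
  assumes "0 < a" "0 < m" "0 < r" "0 < s"
  shows "((\<lambda>s. arctan (m * (s - r) / (2 * a * sqrt (r * s))) / m) has_real_derivative
     (s + r) * a / ((s + r)\<^sup>2 * a\<^sup>2 + (r - s)\<^sup>2 * (m\<^sup>2 - a\<^sup>2)) * sqrt (r / s)) (at s)"
proof -
  define q where "q = sqrt (r * s)"
  have q: "0 < q" "q\<^sup>2 = r * s" using assms by (auto simp: q_def)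
  have "((\<lambda>s. r * s) has_real_derivative r) (at s)" by (auto intro!: derivative_eq_intros)
  from DERIV_chain2[OF DERIV_real_sqrt this] have dq: "((\<lambda>s. sqrt (r * s)) has_real_derivative r / (2 * q)) (at s)"
    using assms by (simp add: q_def field_simps)
  have dN: "((\<lambda>s. m * (s - r)) has_real_derivative m) (at s)" by (auto intro!: derivative_eq_intros)
  have ne: "2 * a * sqrt (r * s) \<noteq> 0" using assms by simp
  note DERIV_cdivide[OF DERIV_chain2[OF DERIV_arctan DERIV_divide[OF dN DERIV_cmult[OF dq, of "2 * a"] ne]], of m]
  moreover have "inverse (1 + (m * (s - r) / (2 * a * sqrt (r * s)))\<^sup>2) *
       ((m * (2 * a * sqrt (r * s)) - m * (s - r) * (2 * a * (r / (2 * q)))) / (2 * a * sqrt (r * s) * (2 * a * sqrt (r * s)))) / m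
      = (s + r) * a / ((s + r)\<^sup>2 * a\<^sup>2 + (r - s)\<^sup>2 * (m\<^sup>2 - a\<^sup>2)) * sqrt (r / s)"
  proof -
    define d where "d = 4 * a\<^sup>2 * (r * s) + m\<^sup>2 * (s - r)\<^sup>2"
    have d: "0 < d" using assms by (auto simp: d_def intro!: add_pos_nonneg mult_pos_pos)
    have sq: "sqrt (r / s) = r / q"
    proof (rule real_sqrt_unique)
      show "(r / q)\<^sup>2 = r / s" unfolding power_divide q(2) using assms by (simp add: power2_eq_square)
    qed (use assms q in simp)
    have e1: "(s + r)\<^sup>2 * a\<^sup>2 + (r - s)\<^sup>2 * (m\<^sup>2 - a\<^sup>2) = d"
      by (simp add: d_def power2_eq_square algebra_simps)
    have "1 + (m * (s - r) / (2 * a * q))\<^sup>2 = d / (4 * a\<^sup>2 * q\<^sup>2)"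
    proof -
      have "(m * (s - r) / (2 * a * q))\<^sup>2 = m\<^sup>2 * (s - r)\<^sup>2 / (4 * a\<^sup>2 * q\<^sup>2)"
        by (simp add: power_divide power_mult_distrib)
      moreover have "d / (4 * a\<^sup>2 * q\<^sup>2) = 1 + m\<^sup>2 * (s - r)\<^sup>2 / (4 * a\<^sup>2 * q\<^sup>2)"
        unfolding d_def q(2)[symmetric] using assms q(1) by (simp add: add_divide_distrib)
      ultimately show ?thesis by simp
    qed
    then have e2: "inverse (1 + (m * (s - r) / (2 * a * q))\<^sup>2) = 4 * a\<^sup>2 * q\<^sup>2 / d" by simp
    have e3: "m * (2 * a * q) - m * (s - r) * (2 * a * (r / (2 * q))) = m * a * r * (s + r) / q"
    proof -
      have "m * (2 * a * q) = 2 * m * a * q\<^sup>2 / q" using q(1) by (simp add: power2_eq_square)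
      also have "... = 2 * m * a * (r * s) / q" by (simp only: q(2))
      finally show ?thesis using q(1) by (simp add: diff_divide_distrib[symmetric] algebra_simps)
    qed
    show ?thesis unfolding q_def[symmetric] e1 e2 e3 sq using assms q(1) d by (simp add: power2_eq_square field_simps)
  qed
  ultimately show ?thesis by (simp only: mult.commute[of "2 * a * (r / (2 * q))"])
qed

lemma schur_integral_bound:
  fixes a m r :: real
  assumes "0 < a" "a \<le> m" "0 < r"
  defines "k \<equiv> \<lambda>s. (s + r) * a / ((s + r)\<^sup>2 * a\<^sup>2 + (r - s)\<^sup>2 * (m\<^sup>2 - a\<^sup>2)) * sqrt (r / s)"
  shows "(\<integral>\<^sup>+s. ennreal (k s) * indicator {0<..<1} s \<partial>lborel) \<le> ennreal (pi / m)"
proof -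
  have m: "0 < m" using assms by simp
  let ?\<Phi> = "\<lambda>s. arctan (m * (s - r) / (2 * a * sqrt (r * s))) / m"
  have am: "a\<^sup>2 \<le> m\<^sup>2" using assms by (simp add: power_mono)
  have k0: "0 \<le> k s" if "0 < s" for s
    unfolding k_def using assms that am by (intro mult_nonneg_nonneg divide_nonneg_nonneg add_nonneg_nonneg) auto
  have km: "(\<lambda>s. k s) \<in> borel_measurable borel" unfolding k_def by measurable
  have step: "(\<integral>\<^sup>+s. ennreal (k s) * indicator {1 / real (Suc n)..1} s \<partial>lborel) \<le> ennreal (pi / m)" for n
  proof -
    let ?e = "1 / real (Suc n)"
    have e: "0 < ?e" "?e \<le> 1" by auto
    have "(\<integral>\<^sup>+s. ennreal (k s) * indicator {?e..1} s \<partial>lborel) = ennreal (?\<Phi> 1 - ?\<Phi> ?e)"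
    proof (rule nn_integral_FTC_Icc[OF km _ _ e(2)])
      fix s assume "s \<in> {?e..1}"
      then have s: "0 < s" using less_le_trans[OF e(1), of s] by simp
      show "(?\<Phi> has_real_derivative k s) (at s)"
        unfolding k_def by (rule schur_antiderivative[OF assms(1) m assms(3) s])
      show "0 \<le> k s" by (rule k0[OF s])
    qed
    also have "... \<le> ennreal (pi / m)"
    proof (rule ennreal_leI)
      have "arctan (m * (1 - r) / (2 * a * sqrt (r * 1))) - arctan (m * (?e - r) / (2 * a * sqrt (r * ?e))) \<le> pi"
        using arctan_ubound[of "m * (1 - r) / (2 * a * sqrt (r * 1))"] arctan_lbound[of "m * (?e - r) / (2 * a * sqrt (r * ?e))"]
        by linarith
      from divide_right_mono[OF this less_imp_le[OF m]] show "?\<Phi> 1 - ?\<Phi> ?e \<le> pi / m"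
        by (simp only: diff_divide_distrib)
    qed
    finally show ?thesis .
  qed
  have "(\<integral>\<^sup>+s. ennreal (k s) * indicator {0<..<1} s \<partial>lborel)
      \<le> (\<integral>\<^sup>+s. (SUP n. ennreal (k s) * indicator {1 / real (Suc n)..1} s) \<partial>lborel)"
  proof (rule nn_integral_mono)
    fix s :: real
    show "ennreal (k s) * indicator {0<..<1} s \<le> (SUP n. ennreal (k s) * indicator {1 / real (Suc n)..1} s)"
    proof (cases "s \<in> {0<..<1}")
      case True
      then obtain n where "1 / real (Suc n) < s" using nat_approx_posE[of s] by auto
      then have "ennreal (k s) * indicator {0<..<1} s \<le> ennreal (k s) * indicator {1 / real (Suc n)..1} s"
        using True by simp
      then show ?thesis by (rule SUP_upper2[OF UNIV_I])
    qed simp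
  qed
  also have "... = (SUP n. \<integral>\<^sup>+s. ennreal (k s) * indicator {1 / real (Suc n)..1} s \<partial>lborel)"
  proof (rule nn_integral_monotone_convergence_SUP)
    show "incseq (\<lambda>n s. ennreal (k s) * indicator {1 / real (Suc n)..1} s)"
    proof (rule incseq_SucI, rule le_funI)
      fix n and s :: real
      have "1 / real (Suc (Suc n)) \<le> 1 / real (Suc n)" by (intro divide_left_mono) auto
      then show "ennreal (k s) * indicator {1 / real (Suc n)..1} s \<le> ennreal (k s) * indicator {1 / real (Suc (Suc n))..1} s"
        by (intro mult_left_mono) (auto simp: indicator_def)
    qed
  qed (use km in measurable)
  also have "... \<le> ennreal (pi / m)" by (rule SUP_least) (rule step)
  finally show ?thesis .
qed

lemma cesaro_density_square_integral:
  assumes "1 / 2 < \<alpha>"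
  shows "(\<integral>\<^sup>+r. ennreal ((cesaro_density \<alpha> r)\<^sup>2) \<partial>lborel) = ennreal (\<alpha>\<^sup>2 / (2 * \<alpha> - 1))"
proof -
  have eq: "(cesaro_density \<alpha> r)\<^sup>2 = \<alpha>\<^sup>2 * (indicator {0<..<1} r * (r powr (1 - 1) * (1 - r) powr (2 * \<alpha> - 1 - 1)))" for r
  proof (cases "r \<in> {0<..<1}")
    case True
    then have "((1 - r) powr (\<alpha> - 1))\<^sup>2 = (1 - r) powr (2 * \<alpha> - 1 - 1)"
      by (simp add: power2_eq_square flip: powr_add)
    then show ?thesis using True by (simp add: cesaro_density_def power_mult_distrib)
  qed (simp add: cesaro_density_def)
  have p: "0 < 2 * \<alpha> - 1" using assms by simp
  have beta: "Beta 1 (2 * \<alpha> - 1) = 1 / (2 * \<alpha> - 1)"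
    using Gamma_plus1_pos[OF p] less_imp_neq[OF Gamma_real_pos[OF p]] by (simp add: Beta_def)
  have "integrable lborel (\<lambda>r. (cesaro_density \<alpha> r)\<^sup>2)"
    unfolding eq by (intro integrable_mult_right integrable_Beta_lborel p) simp
  moreover have "(\<integral>r. (cesaro_density \<alpha> r)\<^sup>2 \<partial>lborel) = \<alpha>\<^sup>2 / (2 * \<alpha> - 1)"
    unfolding eq Bochner_Integration.integral_mult_right_zero integrable_Beta_lborel(2)[OF zero_less_one p] beta by simp
  ultimately show ?thesis by (simp add: nn_integral_eq_integral)
qed

text \<open>Schur test with the weight \<open>sqrt (r / s)\<close>: for \<open>w = m e\<^sup>i\<^sup>\<theta>\<close> the integral of the
  homogeneous kernel \<open>Re (1 / (s cnj w + r w)) sqrt (r / s)\<close> over \<open>0 < s < \<infinity>\<close> is \<open>\<pi> / m\<close>,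
  whatever the angle.\<close>
lemma cesaro_kernel_schur:
  assumes \<alpha>: "1 / 2 < \<alpha>" and w: "w \<in> half_plane"
    and outer: "integrable (cesaro_measure \<alpha>) (\<lambda>s. \<integral>r. 1 / (of_real s * cnj w + of_real r * w) \<partial>cesaro_measure \<alpha>)"
  shows "Re (cesaro_kernel \<alpha> w w) \<le> pi * \<alpha>\<^sup>2 / ((2 * \<alpha> - 1) * cmod w)"
proof -
  let ?\<mu> = "cesaro_measure \<alpha>"
  have \<alpha>0: "0 < \<alpha>" using \<alpha> by simp
  interpret prob_space ?\<mu> by (rule prob_space_cesaro_measure[OF \<alpha>0])
  have w0: "0 < Re w" using w by (simp add: half_plane_def)
  define f where "f = cesaro_density \<alpha>"
  have fm[measurable]: "f \<in> borel_measurable borel" unfolding f_def by measurable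
  have f0: "0 \<le> f r" for r unfolding f_def by (rule cesaro_density_nonneg[OF \<alpha>0])
  have fout: "f r = 0" if "r \<notin> {0<..<1}" for r using that by (simp add: f_def cesaro_density_def)
  define A where "A s r = (s + r) * Re w / ((s + r)\<^sup>2 * (Re w)\<^sup>2 + (r - s)\<^sup>2 * (Im w)\<^sup>2)" for s r
  have Am[measurable]: "(\<lambda>(s, r). A s r) \<in> borel_measurable (lborel \<Otimes>\<^sub>M lborel)" unfolding A_def by measurable
  have A0: "0 \<le> A s r" if "0 < s" "0 < r" for s r
    unfolding A_def using that w0 by (intro divide_nonneg_nonneg mult_nonneg_nonneg add_nonneg_nonneg) auto
  have Asym: "A s r = A r s" for s r by (simp add: A_def add.commute power2_commute)
  have ARe: "Re (1 / (of_real s * cnj w + of_real r * w)) = A s r" for s r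
    unfolding A_def by (rule Re_cesaro_combination)
  have inner_int: "integrable ?\<mu> (\<lambda>r. 1 / (of_real s * cnj w + of_real r * w))" if s: "0 < s" for s
  proof (rule Bochner_Integration.integrable_bound[of _ "\<lambda>_. 1 / (s * Re w)"])
    show "AE r in ?\<mu>. norm (1 / (of_real s * cnj w + of_real r * w)) \<le> norm (1 / (s * Re w))"
      using AE_cesaro_measure[OF \<alpha>0]
    proof eventually_elim
      case (elim r)
      have p: "0 < s * Re w" using s w0 by simp
      have "s * Re w \<le> Re (of_real s * cnj w + of_real r * w)" using elim w0 by simp
      also have "... \<le> cmod (of_real s * cnj w + of_real r * w)" by (rule complex_Re_le_cmod)
      finally have q: "s * Re w \<le> cmod (of_real s * cnj w + of_real r * w)" .
      have "cmod (1 / (of_real s * cnj w + of_real r * w)) \<le> 1 / (s * Re w)"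
        unfolding norm_divide norm_one
        by (rule divide_left_mono[OF q zero_le_one mult_pos_pos[OF less_le_trans[OF p q] p]])
      also have "... \<le> norm (1 / (s * Re w))" unfolding real_norm_def by (rule abs_ge_self)
      finally show ?case .
    qed
  qed auto
  have Aint: "integrable ?\<mu> (A s)" "Re (\<integral>r. 1 / (of_real s * cnj w + of_real r * w) \<partial>?\<mu>) = (\<integral>r. A s r \<partial>?\<mu>)" if "0 < s" for s
    using integrable_Re[OF inner_int[OF that]] integral_Re[OF inner_int[OF that]] unfolding ARe by simp_all
  have nn: "(\<integral>\<^sup>+r. g r \<partial>?\<mu>) = (\<integral>\<^sup>+r. ennreal (f r) * g r \<partial>lborel)" if "g \<in> borel_measurable borel" for g
    unfolding cesaro_measure_def f_def by (rule nn_integral_density) (use that in auto)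
  have Re_le: "ennreal (Re (cesaro_kernel \<alpha> w w)) \<le> (\<integral>\<^sup>+s. \<integral>\<^sup>+r. ennreal (f s * f r * A s r) \<partial>lborel \<partial>lborel)"
  proof -
    have "Re (cesaro_kernel \<alpha> w w) = (\<integral>s. Re (\<integral>r. 1 / (of_real s * cnj w + of_real r * w) \<partial>?\<mu>) \<partial>?\<mu>)"
      unfolding cesaro_kernel_def by (rule integral_Re[OF outer, symmetric])
    also have "ennreal ... \<le> (\<integral>\<^sup>+s. ennreal (Re (\<integral>r. 1 / (of_real s * cnj w + of_real r * w) \<partial>?\<mu>)) \<partial>?\<mu>)"
    proof -
      have nonneg: "AE s in ?\<mu>. 0 \<le> Re (\<integral>r. 1 / (of_real s * cnj w + of_real r * w) \<partial>?\<mu>)"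
        using AE_cesaro_measure[OF \<alpha>0]
      proof eventually_elim
        case (elim s)
        have "AE r in ?\<mu>. 0 \<le> A s r" using AE_cesaro_measure[OF \<alpha>0] by eventually_elim (use elim A0 in auto)
        then show ?case using elim by (simp add: Aint(2) integral_nonneg_AE)
      qed
      show ?thesis by (subst nn_integral_eq_integral[OF integrable_Re[OF outer] nonneg]) simp
    qed
    also have "... = (\<integral>\<^sup>+s. (\<integral>\<^sup>+r. ennreal (A s r) \<partial>?\<mu>) \<partial>?\<mu>)"
    proof (rule nn_integral_cong_AE)
      show "AE s in ?\<mu>. ennreal (Re (\<integral>r. 1 / (of_real s * cnj w + of_real r * w) \<partial>?\<mu>)) = (\<integral>\<^sup>+r. ennreal (A s r) \<partial>?\<mu>)"
        using AE_cesaro_measure[OF \<alpha>0]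
      proof eventually_elim
        case (elim s)
        have "AE r in ?\<mu>. 0 \<le> A s r" using AE_cesaro_measure[OF \<alpha>0] by eventually_elim (use elim A0 in auto)
        then show ?case using elim by (simp add: Aint nn_integral_eq_integral)
      qed
    qed
    also have "... = (\<integral>\<^sup>+s. ennreal (f s) * (\<integral>\<^sup>+r. ennreal (f r) * ennreal (A s r) \<partial>lborel) \<partial>lborel)"
      by (subst nn, measurable)+
    also have "... = (\<integral>\<^sup>+s. \<integral>\<^sup>+r. ennreal (f s) * (ennreal (f r) * ennreal (A s r)) \<partial>lborel \<partial>lborel)"
      by (intro nn_integral_cong nn_integral_cmult[symmetric]) measurable
    also have "... = (\<integral>\<^sup>+s. \<integral>\<^sup>+r. ennreal (f s * f r * A s r) \<partial>lborel \<partial>lborel)"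
      by (simp add: ennreal_mult' f0 mult.assoc)
    finally show ?thesis .
  qed
  define B where "B s r = ennreal ((f r)\<^sup>2 * (A s r * sqrt (r / s)) * indicator {0<..<1} s)" for s r
  have Bm[measurable]: "(\<lambda>(s, r). B s r) \<in> borel_measurable (lborel \<Otimes>\<^sub>M lborel)" unfolding B_def by measurable
  have pointwise: "2 * ennreal (f s * f r * A s r) \<le> B s r + B r s" for s r
  proof (cases "s \<in> {0<..<1} \<and> r \<in> {0<..<1}")
    case True
    then have s: "0 < s" and r: "0 < r" by auto
    define x where "x = sqrt (sqrt (r / s))"
    have x: "0 < x" "x\<^sup>2 = sqrt (r / s)" "(1 / x)\<^sup>2 = sqrt (s / r)"
      using s r by (auto simp: x_def power_divide real_sqrt_divide)
    have "0 \<le> (f r * x - f s * (1 / x))\<^sup>2" by simp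
    then have "2 * (f s * f r) \<le> (f r)\<^sup>2 * x\<^sup>2 + (f s)\<^sup>2 * (1 / x)\<^sup>2"
      using x(1) by (simp add: power2_diff power_mult_distrib power_divide algebra_simps)
    then have "2 * (f s * f r) * A s r \<le> ((f r)\<^sup>2 * x\<^sup>2 + (f s)\<^sup>2 * (1 / x)\<^sup>2) * A s r"
      by (intro mult_right_mono A0 s r)
    then have le: "2 * (f s * f r * A s r) \<le> (f r)\<^sup>2 * (A s r * sqrt (r / s)) + (f s)\<^sup>2 * (A r s * sqrt (s / r))"
      unfolding x(2,3) Asym[of r s] by (simp add: algebra_simps)
    have "2 * ennreal (f s * f r * A s r) = ennreal (2 * (f s * f r * A s r))"
      by (subst ennreal_mult') auto
    also have "... \<le> ennreal ((f r)\<^sup>2 * (A s r * sqrt (r / s)) + (f s)\<^sup>2 * (A r s * sqrt (s / r)))"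
      by (rule ennreal_leI[OF le])
    also have "... = B s r + B r s"
      unfolding B_def using True by (subst ennreal_plus) (auto intro!: mult_nonneg_nonneg A0)
    finally show ?thesis .
  next
    case False
    then have "f s * f r * A s r = 0" using fout by auto
    then show ?thesis by (simp only: ennreal_0 mult_zero_right zero_le)
  qed
  have Bint: "(\<integral>\<^sup>+r. \<integral>\<^sup>+s. B s r \<partial>lborel \<partial>lborel) \<le> ennreal (\<alpha>\<^sup>2 / (2 * \<alpha> - 1)) * ennreal (pi / cmod w)"
  proof -
    have "(\<integral>\<^sup>+s. B s r \<partial>lborel) \<le> ennreal ((f r)\<^sup>2) * ennreal (pi / cmod w)" for r
    proof (cases "r \<in> {0<..<1}")
      case True
      have le: "Re w \<le> cmod w" by (rule complex_Re_le_cmod)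
      have Im: "(cmod w)\<^sup>2 - (Re w)\<^sup>2 = (Im w)\<^sup>2" by (simp add: cmod_power2)
      have "(\<integral>\<^sup>+s. B s r \<partial>lborel) = (\<integral>\<^sup>+s. ennreal ((f r)\<^sup>2) * (ennreal (A s r * sqrt (r / s)) * indicator {0<..<1} s) \<partial>lborel)"
        by (intro nn_integral_cong) (auto simp: B_def indicator_def ennreal_mult')
      also have "... = ennreal ((f r)\<^sup>2) * (\<integral>\<^sup>+s. ennreal (A s r * sqrt (r / s)) * indicator {0<..<1} s \<partial>lborel)"
        by (rule nn_integral_cmult) measurable
      also have "(\<integral>\<^sup>+s. ennreal (A s r * sqrt (r / s)) * indicator {0<..<1} s \<partial>lborel) \<le> ennreal (pi / cmod w)"
        using schur_integral_bound[OF w0 le, of r] True unfolding Im A_def by simp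
      finally show ?thesis by (simp add: mult_left_mono)
    next
      case False
      then show ?thesis using fout by (simp add: B_def)
    qed
    then have "(\<integral>\<^sup>+r. \<integral>\<^sup>+s. B s r \<partial>lborel \<partial>lborel) \<le> (\<integral>\<^sup>+r. ennreal ((f r)\<^sup>2) * ennreal (pi / cmod w) \<partial>lborel)"
      by (intro nn_integral_mono)
    also have "... = (\<integral>\<^sup>+r. ennreal ((f r)\<^sup>2) \<partial>lborel) * ennreal (pi / cmod w)"
      by (rule nn_integral_multc) measurable
    also have "... = ennreal (\<alpha>\<^sup>2 / (2 * \<alpha> - 1)) * ennreal (pi / cmod w)"
      unfolding f_def cesaro_density_square_integral[OF \<alpha>] ..
    finally show ?thesis .
  qed
  have swap: "(\<integral>\<^sup>+s. \<integral>\<^sup>+r. B s r \<partial>lborel \<partial>lborel) = (\<integral>\<^sup>+r. \<integral>\<^sup>+s. B s r \<partial>lborel \<partial>lborel)"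
    by (rule lborel_pair.Fubini'[symmetric, of "\<lambda>s r. B s r"]) measurable
  have "2 * (\<integral>\<^sup>+s. \<integral>\<^sup>+r. ennreal (f s * f r * A s r) \<partial>lborel \<partial>lborel)
      = (\<integral>\<^sup>+s. \<integral>\<^sup>+r. 2 * ennreal (f s * f r * A s r) \<partial>lborel \<partial>lborel)"
    by (subst nn_integral_cmult, measurable)+
  also have "... \<le> (\<integral>\<^sup>+s. \<integral>\<^sup>+r. (B s r + B r s) \<partial>lborel \<partial>lborel)"
    by (intro nn_integral_mono pointwise)
  also have "... = (\<integral>\<^sup>+s. (\<integral>\<^sup>+r. B s r \<partial>lborel) + (\<integral>\<^sup>+r. B r s \<partial>lborel) \<partial>lborel)"
    by (intro nn_integral_cong nn_integral_add) measurable
  also have "... = (\<integral>\<^sup>+s. \<integral>\<^sup>+r. B s r \<partial>lborel \<partial>lborel) + (\<integral>\<^sup>+s. \<integral>\<^sup>+r. B r s \<partial>lborel \<partial>lborel)"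
    by (intro nn_integral_add) measurable
  also have "... = 2 * (\<integral>\<^sup>+r. \<integral>\<^sup>+s. B s r \<partial>lborel \<partial>lborel)"
    unfolding swap by (simp add: mult_2)
  also have "... \<le> 2 * (ennreal (\<alpha>\<^sup>2 / (2 * \<alpha> - 1)) * ennreal (pi / cmod w))"
    by (intro mult_left_mono Bint) simp
  finally have "(\<integral>\<^sup>+s. \<integral>\<^sup>+r. ennreal (f s * f r * A s r) \<partial>lborel \<partial>lborel)
      \<le> ennreal (\<alpha>\<^sup>2 / (2 * \<alpha> - 1)) * ennreal (pi / cmod w)"
    by (subst (asm) ennreal_mult_le_mult_iff) auto
  also have "... = ennreal (\<alpha>\<^sup>2 / (2 * \<alpha> - 1) * (pi / cmod w))"
    by (rule ennreal_mult[symmetric]) (use \<alpha> in auto)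
  finally have "ennreal (Re (cesaro_kernel \<alpha> w w)) \<le> ennreal (\<alpha>\<^sup>2 / (2 * \<alpha> - 1) * (pi / cmod w))"
    by (rule order_trans[OF Re_le])
  then have "Re (cesaro_kernel \<alpha> w w) \<le> \<alpha>\<^sup>2 / (2 * \<alpha> - 1) * (pi / cmod w)"
    by (subst (asm) ennreal_le_iff) (use \<alpha> in auto)
  then show ?thesis by (simp add: mult.commute)
qed

lemma kernel_norm_lower_bound:
  assumes \<alpha>: "0 < \<alpha>" and K: "is_reproducing_kernel half_plane (hardy2_frac \<alpha>) (hardy2_frac_inner \<alpha>) K"
    and z: "z \<in> half_plane"
  shows "(\<alpha> + 1) / (2 * \<alpha>\<^sup>2) / (Gamma \<alpha>)\<^sup>2 * (1 / cmod z) \<le> (hardy2_frac_norm \<alpha> (\<lambda>u. K u z))\<^sup>2"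
proof -
  have G: "0 < (Gamma (\<alpha> + 1))\<^sup>2" by (intro zero_less_power Gamma_real_pos) (use \<alpha> in simp)
  have "(\<alpha> + 1) / (2 * cmod z) \<le> Re (cesaro_kernel \<alpha> z z)"
    using cesaro_kernel_cnj_ge[OF \<alpha> z] cesaro_kernel_cnj_le[OF \<alpha> K z] by linarith
  also have "... = (Gamma (\<alpha> + 1))\<^sup>2 * (hardy2_frac_norm \<alpha> (\<lambda>u. K u z))\<^sup>2"
    unfolding hardy2_frac_norm_kernel[OF \<alpha> K z] by simp
  finally have "(\<alpha> + 1) / (2 * cmod z) / (Gamma (\<alpha> + 1))\<^sup>2 \<le> (hardy2_frac_norm \<alpha> (\<lambda>u. K u z))\<^sup>2"
    using G by (subst pos_divide_le_eq) (auto simp: mult.commute)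
  moreover have "(\<alpha> + 1) / (2 * cmod z) / (Gamma (\<alpha> + 1))\<^sup>2 = (\<alpha> + 1) / (2 * \<alpha>\<^sup>2) / (Gamma \<alpha>)\<^sup>2 * (1 / cmod z)"
    unfolding Gamma_plus1_pos[OF \<alpha>] by (simp add: power_mult_distrib mult_ac)
  ultimately show ?thesis by (simp only:)
qed

lemma kernel_norm_upper_bound_schur:
  assumes \<alpha>: "1 / 2 < \<alpha>" and K: "is_reproducing_kernel half_plane (hardy2_frac \<alpha>) (hardy2_frac_inner \<alpha>) K"
    and z: "z \<in> half_plane"
  shows "(hardy2_frac_norm \<alpha> (\<lambda>u. K u z))\<^sup>2 \<le> pi / ((2 * \<alpha> - 1) * (Gamma \<alpha>)\<^sup>2) * (1 / cmod z)"
proof -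
  have \<alpha>0: "0 < \<alpha>" using \<alpha> by simp
  have G: "0 < (Gamma (\<alpha> + 1))\<^sup>2" by (intro zero_less_power Gamma_real_pos) (use \<alpha>0 in simp)
  have "(Gamma (\<alpha> + 1))\<^sup>2 * (hardy2_frac_norm \<alpha> (\<lambda>u. K u z))\<^sup>2 = Re (cesaro_kernel \<alpha> z z)"
    unfolding hardy2_frac_norm_kernel[OF \<alpha>0 K z] by simp
  also have "... \<le> pi * \<alpha>\<^sup>2 / ((2 * \<alpha> - 1) * cmod z)"
    by (rule cesaro_kernel_schur[OF \<alpha> z reproducing_kernel_preimage_inner(2)[OF \<alpha>0 K z z]])
  finally have "(hardy2_frac_norm \<alpha> (\<lambda>u. K u z))\<^sup>2 \<le> pi * \<alpha>\<^sup>2 / ((2 * \<alpha> - 1) * cmod z) / (Gamma (\<alpha> + 1))\<^sup>2"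
    using G by (subst pos_le_divide_eq) (auto simp: mult.commute)
  also have "... = pi / ((2 * \<alpha> - 1) * (Gamma \<alpha>)\<^sup>2) * (1 / cmod z)"
    unfolding Gamma_plus1_pos[OF \<alpha>0] using \<alpha>0 by (simp add: power_mult_distrib mult_ac)
  finally show ?thesis .
qed

lemma kernel_norm_upper_bound_small:
  assumes \<alpha>: "0 < \<alpha>" "\<alpha> \<le> 1 / 2"
    and K: "is_reproducing_kernel half_plane (hardy2_frac \<alpha>) (hardy2_frac_inner \<alpha>) K"
    and z: "z \<in> half_plane"
  shows "(hardy2_frac_norm \<alpha> (\<lambda>u. K u z))\<^sup>2 \<le> pi\<^sup>2 / (8 * Re z) / (Gamma (\<alpha> + 1))\<^sup>2"
proof -
  have z0: "0 < Re z" using z by (simp add: half_plane_def)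
  have G: "0 < (Gamma (\<alpha> + 1))\<^sup>2" by (intro zero_less_power Gamma_real_pos) (use \<alpha> in simp)
  have B0: "0 \<le> \<alpha> * Beta (1 / 2) \<alpha>" using \<alpha> by (simp add: Beta_def Gamma_real_nonneg)
  have "(Gamma (\<alpha> + 1))\<^sup>2 * (hardy2_frac_norm \<alpha> (\<lambda>u. K u z))\<^sup>2 = cmod (cesaro_kernel \<alpha> z z)"
    unfolding hardy2_frac_norm_kernel[OF \<alpha>(1) K z] norm_of_real by simp
  also have "... \<le> (\<alpha> * Beta (1 / 2) \<alpha>)\<^sup>2 / (2 * Re z)" by (rule cesaro_kernel_le_Beta[OF \<alpha>(1) z])
  also have "... \<le> (pi / 2)\<^sup>2 / (2 * Re z)"
    using z0 by (intro divide_right_mono power_mono Beta_half_le \<alpha> B0) auto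
  also have "... = pi\<^sup>2 / (8 * Re z)" by (simp add: power_divide)
  finally show ?thesis
    using G by (subst pos_le_divide_eq) (auto simp: mult.commute)
qed

theorem theorem7p2:
  fixes \<alpha> \<theta> :: real and z :: complex and K :: "complex \<Rightarrow> complex \<Rightarrow> complex"
  assumes "\<alpha> > 0"
    and "is_reproducing_kernel half_plane (hardy2_frac \<alpha>) (hardy2_frac_inner \<alpha>) K"
    and "z \<in> half_plane"
    and "- pi / 2 < \<theta>" and "\<theta> < pi / 2"
    and "z = of_real (cmod z) * exp (\<i> * of_real \<theta>)"
  shows
    "(\<alpha> \<ge> 1 \<longrightarrow>
        1 / ((2 * \<alpha> - 1) * (Gamma \<alpha>)\<^sup>2) * (1 / cmod z) \<le> (hardy2_frac_norm \<alpha> (\<lambda>u. K u z))\<^sup>2 \<and>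
        (hardy2_frac_norm \<alpha> (\<lambda>u. K u z))\<^sup>2 \<le> pi / (\<alpha> * (Gamma \<alpha>)\<^sup>2) * (1 / cmod z)) \<and>
     (1 / 2 < \<alpha> \<and> \<alpha> < 1 \<longrightarrow>
        1 / (Gamma \<alpha>)\<^sup>2 * (1 / cmod z) \<le> (hardy2_frac_norm \<alpha> (\<lambda>u. K u z))\<^sup>2 \<and>
        (hardy2_frac_norm \<alpha> (\<lambda>u. K u z))\<^sup>2 \<le> pi / ((2 * \<alpha> - 1) * (Gamma \<alpha>)\<^sup>2) * (1 / cmod z)) \<and>
     (\<alpha> \<le> 1 / 2 \<longrightarrow>
        (\<bar>\<theta>\<bar> \<le> pi / 4 \<longrightarrow>
          1 / (Gamma \<alpha>)\<^sup>2 * (1 / cmod z) \<le> (hardy2_frac_norm \<alpha> (\<lambda>u. K u z))\<^sup>2 \<and>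
          (hardy2_frac_norm \<alpha> (\<lambda>u. K u z))\<^sup>2 \<le> 2 / (Gamma (\<alpha> + 1))\<^sup>2 * (1 / cmod z)) \<and>
        (pi / 4 < \<bar>\<theta>\<bar> \<and> \<bar>\<theta>\<bar> < pi / 2 \<longrightarrow>
          1 / (Gamma \<alpha>)\<^sup>2 * (1 / cmod z) \<le> (hardy2_frac_norm \<alpha> (\<lambda>u. K u z))\<^sup>2 \<and>
          (hardy2_frac_norm \<alpha> (\<lambda>u. K u z))\<^sup>2 \<le> 2 / (Gamma (\<alpha> + 1))\<^sup>2 * (1 / Re z)))"
proof -
  note \<alpha> = assms(1) and K = assms(2) and z = assms(3)
  let ?n = "(hardy2_frac_norm \<alpha> (\<lambda>u. K u z))\<^sup>2"
  have Rz: "0 < Re z" using z by (simp add: half_plane_def)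
  then have z0: "0 < cmod z" using complex_Re_le_cmod[of z] by linarith
  have G: "0 < (Gamma \<alpha>)\<^sup>2" "0 < (Gamma (\<alpha> + 1))\<^sup>2" by (intro zero_less_power Gamma_real_pos; use \<alpha> in simp)+
  have lower: "c / (Gamma \<alpha>)\<^sup>2 * (1 / cmod z) \<le> ?n" if "c \<le> (\<alpha> + 1) / (2 * \<alpha>\<^sup>2)" for c
    by (rule order_trans[OF _ kernel_norm_lower_bound[OF \<alpha> K z]])
      (use that in \<open>intro mult_right_mono divide_right_mono; simp\<close>)
  have i: "1 / ((2 * \<alpha> - 1) * (Gamma \<alpha>)\<^sup>2) * (1 / cmod z) \<le> ?n \<and> ?n \<le> pi / (\<alpha> * (Gamma \<alpha>)\<^sup>2) * (1 / cmod z)"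
    if a: "1 \<le> \<alpha>"
  proof
    have "2 * \<alpha>\<^sup>2 \<le> (\<alpha> + 1) * (2 * \<alpha> - 1)" using a by (simp add: power2_eq_square algebra_simps)
    then have "1 / (2 * \<alpha> - 1) \<le> (\<alpha> + 1) / (2 * \<alpha>\<^sup>2)" using a \<alpha> by (simp add: field_simps)
    from lower[OF this] show "1 / ((2 * \<alpha> - 1) * (Gamma \<alpha>)\<^sup>2) * (1 / cmod z) \<le> ?n" by simp
    have "?n \<le> pi / ((2 * \<alpha> - 1) * (Gamma \<alpha>)\<^sup>2) * (1 / cmod z)"
      by (rule kernel_norm_upper_bound_schur[OF _ K z]) (use a in simp)
    also have "... \<le> pi / (\<alpha> * (Gamma \<alpha>)\<^sup>2) * (1 / cmod z)"
      by (intro mult_right_mono divide_left_mono mult_pos_pos G) (use a \<alpha> in auto)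
    finally show "?n \<le> pi / (\<alpha> * (Gamma \<alpha>)\<^sup>2) * (1 / cmod z)" .
  qed
  have low1: "1 / (Gamma \<alpha>)\<^sup>2 * (1 / cmod z) \<le> ?n" if a: "\<alpha> \<le> 1"
  proof (rule lower)
    have "0 \<le> (2 * \<alpha> + 1) * (1 - \<alpha>)" using a \<alpha> by (intro mult_nonneg_nonneg) auto
    then have "2 * \<alpha>\<^sup>2 \<le> \<alpha> + 1" by (simp add: power2_eq_square algebra_simps)
    then show "1 \<le> (\<alpha> + 1) / (2 * \<alpha>\<^sup>2)" using \<alpha> by (simp add: le_divide_eq)
  qed
  have ii: "?n \<le> pi / ((2 * \<alpha> - 1) * (Gamma \<alpha>)\<^sup>2) * (1 / cmod z)" if "1 / 2 < \<alpha>"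
    by (rule kernel_norm_upper_bound_schur[OF that K z])
  have pi2: "pi\<^sup>2 \<le> 10"
  proof -
    have "pi\<^sup>2 \<le> 3.15\<^sup>2" using pi_approx by (intro power_mono) auto
    then show ?thesis by (simp add: power2_eq_square)
  qed
  have iii: "?n \<le> 2 / (Gamma (\<alpha> + 1))\<^sup>2 * (1 / Re z)" if a: "\<alpha> \<le> 1 / 2"
  proof -
    have "pi\<^sup>2 / (8 * Re z) \<le> 2 * (1 / Re z)" using pi2 Rz by (simp add: field_simps)
    then have "pi\<^sup>2 / (8 * Re z) / (Gamma (\<alpha> + 1))\<^sup>2 \<le> 2 * (1 / Re z) / (Gamma (\<alpha> + 1))\<^sup>2"
      by (rule divide_right_mono) simp
    then show ?thesis using kernel_norm_upper_bound_small[OF \<alpha> a K z] by (simp add: mult.commute)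
  qed
  have iii': "?n \<le> 2 / (Gamma (\<alpha> + 1))\<^sup>2 * (1 / cmod z)" if a: "\<alpha> \<le> 1 / 2" and t: "\<bar>\<theta>\<bar> \<le> pi / 4"
  proof -
    have "Re z = cmod z * cos \<theta>"
      using arg_cong[OF assms(6), of Re] by (simp add: Re_exp)
    moreover have "sqrt 2 / 2 \<le> cos \<theta>"
    proof -
      have "cos (pi / 4) \<le> cos \<bar>\<theta>\<bar>" by (rule cos_monotone_0_pi_le) (use t pi_gt_zero in auto)
      then show ?thesis by (simp add: cos_45)
    qed
    moreover have "7 / 10 \<le> sqrt 2 / 2"
      using real_le_rsqrt[of "7 / 5" 2] by (simp add: power2_eq_square)
    ultimately have "cmod z * (7 / 10) \<le> Re z" using z0 by (simp add: mult_left_mono)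
    then have "pi\<^sup>2 / (8 * Re z) \<le> pi\<^sup>2 / (8 * (cmod z * (7 / 10)))"
      using z0 Rz by (intro divide_left_mono) auto
    also have "... \<le> 2 * (1 / cmod z)" using pi2 z0 by (simp add: field_simps)
    finally have "pi\<^sup>2 / (8 * Re z) / (Gamma (\<alpha> + 1))\<^sup>2 \<le> 2 * (1 / cmod z) / (Gamma (\<alpha> + 1))\<^sup>2"
      by (rule divide_right_mono) simp
    then show ?thesis using kernel_norm_upper_bound_small[OF \<alpha> a K z] by (simp add: mult.commute)
  qed
  show ?thesis using i low1 ii iii iii' by auto
qed

end
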